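(* Let $(R,\mathfrak m,k)$ be a commutative Noetherian local ring and let $M$ and $N$ be nonzero finitely generated $R\ltimes k$-modules. If $N$ is Tor-rigid (over $R\ltimes k$) and $\operatorname{Ext}_{R\ltimes k}^{1}(M,N)=0$, then $M$ is a free $R\ltimes k$-module or $N$ is a free $R\ltimes k$-module.
   Context: For a commutative ring $R$ and an $R$-module $L$, the idealization $R\ltimes L$ is the commutative ring whose additive group is $R\oplus L$, with identity $(1,0)$ and multiplication $(r_1,l_1)(r_2,l_2)=(r_1r_2,\,r_1l_2+r_2l_1)$. If $(R,\mathfrak m,k)$ is Noetherian local and $L$ is finitely generated, then $R\ltimes L$ is a Noetherian local ring with maximal ideal $\mathfrak m\ltimes L$ and residue field $k$. Here $k=R/\mathfrak m$ is regarded as an $R$-module. A module $N$ over a Noetherian local ring $A$ is Tor-rigid if for every (finitely generated) $A$-module $L$ and every $i\ge 1$, $\operatorname{Tor}_i^A(N,L)=0$ implies $\operatorname{Tor}_{i+1}^A(N,L)=0$. *)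

theory Defs
  imports "HOL-Algebra.Algebra"
begin

section \<open>Noetherian local rings and idealizations\<close>

locale noetherian_local_ring = cring R + noetherian_ring R for R (structure) +
  fixes \<mm>
  assumes maximal: "maximalideal \<mm> R"
    and unique_maximal: "maximalideal J R \<Longrightarrow> J = \<mm>"

text \<open>In module records the fields \<open>mult\<close> and \<open>one\<close> are not part of the module structure;
  \<^locale>\<open>module\<close> does not constrain them and nothing below depends on them.\<close>

definition residue_module :: "('a, 'x) ring_scheme \<Rightarrow> 'a set \<Rightarrow> ('a, 'a set) module" where
  "residue_module R \<mm> =
    ring.extend (R Quot \<mm>)
      (module.fields (\<lambda>r C. (\<mm> +>\<^bsub>R\<^esub> r) \<otimes>\<^bsub>R Quot \<mm>\<^esub> C))"

definition idealization ::
  "('a, 'x) ring_scheme \<Rightarrow> ('a, 'l, 'y) module_scheme \<Rightarrow> ('a \<times> 'l) ring" (infixl "\<ltimes>" 65) where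
  "R \<ltimes> L =
    \<lparr>carrier = carrier R \<times> carrier L,
     monoid.mult = (\<lambda>(r\<^sub>1, l\<^sub>1) (r\<^sub>2, l\<^sub>2).
       (r\<^sub>1 \<otimes>\<^bsub>R\<^esub> r\<^sub>2, (r\<^sub>1 \<odot>\<^bsub>L\<^esub> l\<^sub>2) \<oplus>\<^bsub>L\<^esub> (r\<^sub>2 \<odot>\<^bsub>L\<^esub> l\<^sub>1))),
     monoid.one = (\<one>\<^bsub>R\<^esub>, \<zero>\<^bsub>L\<^esub>),
     ring.zero = (\<zero>\<^bsub>R\<^esub>, \<zero>\<^bsub>L\<^esub>),
     ring.add = (\<lambda>(r\<^sub>1, l\<^sub>1) (r\<^sub>2, l\<^sub>2). (r\<^sub>1 \<oplus>\<^bsub>R\<^esub> r\<^sub>2, l\<^sub>1 \<oplus>\<^bsub>L\<^esub> l\<^sub>2))\<rparr>"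


section \<open>Finitely generated and free modules, linear maps\<close>

definition fin_gen :: "('a, 'x) ring_scheme \<Rightarrow> ('a, 'm, 'y) module_scheme \<Rightarrow> bool" where
  "fin_gen A M \<longleftrightarrow>
    (\<exists>S \<subseteq> carrier M. finite S \<and>
      (\<forall>x \<in> carrier M. \<exists>a \<in> S \<rightarrow> carrier A. x = (\<Oplus>\<^bsub>M\<^esub>s\<in>S. a s \<odot>\<^bsub>M\<^esub> s)))"

definition is_basis :: "('a, 'x) ring_scheme \<Rightarrow> ('a, 'm, 'y) module_scheme \<Rightarrow> 'm set \<Rightarrow> bool" where
  "is_basis A M B \<longleftrightarrow> B \<subseteq> carrier M \<and>
    (\<forall>x \<in> carrier M. \<exists>F \<subseteq> B. finite F \<and>
      (\<exists>a \<in> F \<rightarrow> carrier A. x = (\<Oplus>\<^bsub>M\<^esub>b\<in>F. a b \<odot>\<^bsub>M\<^esub> b))) \<and>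
    (\<forall>F \<subseteq> B. finite F \<longrightarrow>
      (\<forall>a \<in> F \<rightarrow> carrier A. (\<Oplus>\<^bsub>M\<^esub>b\<in>F. a b \<odot>\<^bsub>M\<^esub> b) = \<zero>\<^bsub>M\<^esub> \<longrightarrow> (\<forall>b\<in>F. a b = \<zero>\<^bsub>A\<^esub>)))"

definition free_module :: "('a, 'x) ring_scheme \<Rightarrow> ('a, 'm, 'y) module_scheme \<Rightarrow> bool" where
  "free_module A M \<longleftrightarrow> (\<exists>B. is_basis A M B)"

definition linear_maps ::
  "('a, 'x) ring_scheme \<Rightarrow> ('a, 'm, 'y) module_scheme \<Rightarrow> ('a, 'n, 'z) module_scheme \<Rightarrow> ('m \<Rightarrow> 'n) set"
  where
  "linear_maps A M N =
    {f \<in> carrier M \<rightarrow>\<^sub>E carrier N.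
      (\<forall>x \<in> carrier M. \<forall>y \<in> carrier M. f (x \<oplus>\<^bsub>M\<^esub> y) = f x \<oplus>\<^bsub>N\<^esub> f y) \<and>
      (\<forall>a \<in> carrier A. \<forall>x \<in> carrier M. f (a \<odot>\<^bsub>M\<^esub> x) = a \<odot>\<^bsub>N\<^esub> f x)}"

text \<open>The free module \<open>A\<^sup>n\<close>, with vectors as extensional functions on \<open>{..<n}\<close>.\<close>

definition free_mod :: "('a, 'x) ring_scheme \<Rightarrow> nat \<Rightarrow> ('a, nat \<Rightarrow> 'a) module" where
  "free_mod A n =
    \<lparr>carrier = {..<n} \<rightarrow>\<^sub>E carrier A,
     monoid.mult = undefined,
     monoid.one = undefined,
     ring.zero = (\<lambda>i\<in>{..<n}. \<zero>\<^bsub>A\<^esub>),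
     ring.add = (\<lambda>v w. \<lambda>i\<in>{..<n}. v i \<oplus>\<^bsub>A\<^esub> w i),
     smult = (\<lambda>a v. \<lambda>i\<in>{..<n}. a \<otimes>\<^bsub>A\<^esub> v i)\<rparr>"


section \<open>Free resolutions\<close>

text \<open>\<open>(n, d)\<close> represents the resolution
  \<open>\<cdots> \<rightarrow> A\<^bsup>n 2\<^esup> \<rightarrow> A\<^bsup>n 1\<^esup> \<rightarrow> A\<^bsup>n 0\<^esup> \<rightarrow> M \<rightarrow> 0\<close> with
  \<open>d i : A\<^bsup>n (i + 1)\<^esup> \<rightarrow> A\<^bsup>n i\<^esup>\<close>.\<close>

definition is_free_resolution ::
  "('a, 'x) ring_scheme \<Rightarrow> ('a, 'm, 'y) module_scheme \<Rightarrow>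
    (nat \<Rightarrow> nat) \<times> (nat \<Rightarrow> (nat \<Rightarrow> 'a) \<Rightarrow> (nat \<Rightarrow> 'a)) \<Rightarrow> bool" where
  "is_free_resolution A M = (\<lambda>(n, d).
    (\<exists>\<epsilon> \<in> linear_maps A (free_mod A (n 0)) M.
      \<epsilon> ` carrier (free_mod A (n 0)) = carrier M \<and>
      a_kernel (free_mod A (n 0)) M \<epsilon> = d 0 ` carrier (free_mod A (n 1))) \<and>
    (\<forall>i. d i \<in> linear_maps A (free_mod A (n (Suc i))) (free_mod A (n i))) \<and>
    (\<forall>i. a_kernel (free_mod A (n (Suc i))) (free_mod A (n i)) (d i) =
      d (Suc i) ` carrier (free_mod A (n (Suc (Suc i))))))"

text \<open>A finitely generated module over a Noetherian ring has such a resolution, and up to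
  isomorphism the Tor and Ext groups below do not depend on which one is chosen. They are meaningful
  only for a first module argument that has a resolution by free modules of finite rank.\<close>

definition free_resolution ::
  "('a, 'x) ring_scheme \<Rightarrow> ('a, 'm, 'y) module_scheme \<Rightarrow>
    (nat \<Rightarrow> nat) \<times> (nat \<Rightarrow> (nat \<Rightarrow> 'a) \<Rightarrow> (nat \<Rightarrow> 'a))" where
  "free_resolution A M = (SOME P. is_free_resolution A M P)"

definition res_mod ::
  "('a, 'x) ring_scheme \<Rightarrow> ('a, 'm, 'y) module_scheme \<Rightarrow> nat \<Rightarrow> ('a, nat \<Rightarrow> 'a) module" where
  "res_mod A M i = free_mod A (fst (free_resolution A M) i)"

definition res_map ::
  "('a, 'x) ring_scheme \<Rightarrow> ('a, 'm, 'y) module_scheme \<Rightarrow> nat \<Rightarrow> (nat \<Rightarrow> 'a) \<Rightarrow> (nat \<Rightarrow> 'a)" where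
  "res_map A M = snd (free_resolution A M)"


section \<open>Tensor products and Tor\<close>

definition tensor_relations ::
  "('a, 'x) ring_scheme \<Rightarrow> ('a, 'm, 'y) module_scheme \<Rightarrow> ('a, 'n, 'z) module_scheme \<Rightarrow>
    (('m \<times> 'n) \<Rightarrow>\<^sub>0 int) set" where
  "tensor_relations A M N = generate (free_Abelian_group (carrier M \<times> carrier N))
    ({frag_of (x \<oplus>\<^bsub>M\<^esub> x', y) - frag_of (x, y) - frag_of (x', y) |x x' y.
        x \<in> carrier M \<and> x' \<in> carrier M \<and> y \<in> carrier N} \<union>
     {frag_of (x, y \<oplus>\<^bsub>N\<^esub> y') - frag_of (x, y) - frag_of (x, y') |x y y'.
        x \<in> carrier M \<and> y \<in> carrier N \<and> y' \<in> carrier N} \<union>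
     {frag_of (a \<odot>\<^bsub>M\<^esub> x, y) - frag_of (x, a \<odot>\<^bsub>N\<^esub> y) |a x y.
        a \<in> carrier A \<and> x \<in> carrier M \<and> y \<in> carrier N})"

text \<open>The underlying abelian group of the tensor product, written multiplicatively.\<close>

definition tensor ::
  "('a, 'x) ring_scheme \<Rightarrow> ('a, 'm, 'y) module_scheme \<Rightarrow> ('a, 'n, 'z) module_scheme \<Rightarrow>
    (('m \<times> 'n) \<Rightarrow>\<^sub>0 int) set monoid" where
  "tensor A M N = free_Abelian_group (carrier M \<times> carrier N) Mod tensor_relations A M N"

text \<open>The map \<open>f \<otimes> id : M \<otimes> N \<rightarrow> M' \<otimes> N\<close> induced by \<open>f : M \<rightarrow> M'\<close>. The cosets in the union all
  coincide.\<close>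

definition tensor_map ::
  "('a, 'x) ring_scheme \<Rightarrow> ('a, 'm', 'y) module_scheme \<Rightarrow> ('a, 'n, 'z) module_scheme \<Rightarrow>
    ('m \<Rightarrow> 'm') \<Rightarrow> (('m \<times> 'n) \<Rightarrow>\<^sub>0 int) set \<Rightarrow> (('m' \<times> 'n) \<Rightarrow>\<^sub>0 int) set" where
  "tensor_map A M' N f C =
    (\<Union>c \<in> C. tensor_relations A M' N
      #>\<^bsub>free_Abelian_group (carrier M' \<times> carrier N)\<^esub> frag_extend (\<lambda>(x, y). frag_of (f x, y)) c)"

text \<open>\<open>Tor A i N L\<close> is the homology in degree \<open>i\<close> of \<open>P \<otimes> L\<close> for a free resolution \<open>P\<close> of \<open>N\<close>.\<close>

fun Tor ::
  "('a, 'x) ring_scheme \<Rightarrow> nat \<Rightarrow> ('a, 'n, 'y) module_scheme \<Rightarrow> ('a, 'l, 'z) module_scheme \<Rightarrow>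
    (((nat \<Rightarrow> 'a) \<times> 'l) \<Rightarrow>\<^sub>0 int) set set monoid" where
  "Tor A 0 N L =
    tensor A (res_mod A N 0) L Mod
      (tensor_map A (res_mod A N 0) L (res_map A N 0) ` carrier (tensor A (res_mod A N 1) L))"
| "Tor A (Suc i) N L =
    (tensor A (res_mod A N (Suc i)) L)
      \<lparr>carrier := kernel (tensor A (res_mod A N (Suc i)) L) (tensor A (res_mod A N i) L)
        (tensor_map A (res_mod A N i) L (res_map A N i))\<rparr>
    Mod (tensor_map A (res_mod A N (Suc i)) L (res_map A N (Suc i)) `
      carrier (tensor A (res_mod A N (Suc (Suc i))) L))"

text \<open>HOL cannot quantify over all carrier types inside a formula. The carrier type used for \<open>L\<close>
  contains the quotients \<open>A\<^sup>n / K\<close>, hence a copy of every finitely generated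
  \<open>A\<close>-module.\<close>

definition Tor_rigid :: "('a, 'x) ring_scheme \<Rightarrow> ('a, 'n, 'y) module_scheme \<Rightarrow> bool" where
  "Tor_rigid A N \<longleftrightarrow>
    (\<forall>L :: ('a, (nat \<Rightarrow> 'a) set) module. module A L \<and> fin_gen A L \<longrightarrow>
      (\<forall>i \<ge> 1. trivial_group (Tor A i N L) \<longrightarrow> trivial_group (Tor A (i + 1) N L)))"


section \<open>Hom and Ext\<close>

text \<open>The abelian group of \<open>A\<close>-linear maps, written multiplicatively.\<close>

definition Hom ::
  "('a, 'x) ring_scheme \<Rightarrow> ('a, 'm, 'y) module_scheme \<Rightarrow> ('a, 'n, 'z) module_scheme \<Rightarrow>
    ('m \<Rightarrow> 'n) monoid" where
  "Hom A M N =
    \<lparr>carrier = linear_maps A M N,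
     monoid.mult = (\<lambda>f g. \<lambda>x\<in>carrier M. f x \<oplus>\<^bsub>N\<^esub> g x),
     monoid.one = (\<lambda>x\<in>carrier M. \<zero>\<^bsub>N\<^esub>)\<rparr>"

text \<open>The coboundary \<open>Hom(P\<^sub>i, N) \<rightarrow> Hom(P\<^sub>i\<^sub>+\<^sub>1, N)\<close> for the chosen resolution \<open>P\<close> of \<open>M\<close>.\<close>

definition Hom_map ::
  "('a, 'x) ring_scheme \<Rightarrow> ('a, 'm, 'y) module_scheme \<Rightarrow> nat \<Rightarrow>
    ((nat \<Rightarrow> 'a) \<Rightarrow> 'n) \<Rightarrow> ((nat \<Rightarrow> 'a) \<Rightarrow> 'n)" where
  "Hom_map A M i f = compose (carrier (res_mod A M (Suc i))) f (res_map A M i)"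

text \<open>\<open>Ext A i M N\<close> is the cohomology in degree \<open>i\<close> of \<open>Hom(P, N)\<close> for a free resolution \<open>P\<close> of
  \<open>M\<close>.\<close>

fun Ext ::
  "('a, 'x) ring_scheme \<Rightarrow> nat \<Rightarrow> ('a, 'm, 'y) module_scheme \<Rightarrow> ('a, 'n, 'z) module_scheme \<Rightarrow>
    ((nat \<Rightarrow> 'a) \<Rightarrow> 'n) set monoid" where
  "Ext A 0 M N =
    (Hom A (res_mod A M 0) N)
      \<lparr>carrier := kernel (Hom A (res_mod A M 0) N) (Hom A (res_mod A M 1) N) (Hom_map A M 0)\<rparr>
    Mod {\<one>\<^bsub>Hom A (res_mod A M 0) N\<^esub>}"
| "Ext A (Suc i) M N =
    (Hom A (res_mod A M (Suc i)) N)
      \<lparr>carrier := kernel (Hom A (res_mod A M (Suc i)) N) (Hom A (res_mod A M (Suc (Suc i))) N)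
        (Hom_map A M (Suc i))\<rparr>
    Mod (Hom_map A M i ` carrier (Hom A (res_mod A M i) N))"

end

(* Put A = R \<ltimes> k with maximal ideal n, and let F and G be free resolutions of M and N with
   differentials d and e. Let X be the Auslander transpose of the first syzygy of M, the cokernel of
   the dual of d_1. A diagram chase turns Ext^1(M, N) = 0 into Tor_1(N, X) = 0, so rigidity
   gives Tor_3(N, X) = 0.
   The element s = (0, 1) spans a copy of k, its annihilator is n, and n is the direct sum of the
   ideal m x 0 and of A s. If M is not free, that is if Tor_1(M, k) is nonzero, then a functional on
   F_1 that detects Tor_1(M, k) becomes, after multiplication by s, a generator of a direct
   summand k of the second syzygy of X. So Tor_1(N, k) is a summand of Tor_3(N, X) = 0, and N is
   free. *)
theory Submission
  imports Defs
begin

section \<open>Linear maps\<close>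

text \<open>Degree three comes from the presentation of X by the duals of F_1 and F_2: its second
  syzygy is the module Z of functionals on F_1 that vanish on the image of d_1, and Tor_3(N, X) is
  Tor_1(N, Z). If M is not free, there are x in F_1 with d_0 x in n F_0 and a functional zeta with
  zeta(x) = 1 that maps the image of d_1 into n. As s kills n, s zeta lies in Z and spans a copy of
  k. The retraction of Z onto it is evaluation at x followed by the projection of n to A s along m x
  0: since s d_0 x = 0, s x lies in the image of d_1, so a functional in Z takes at x a value killed
  by s, that is, a value in n. The splitting of n is what makes this projection linear. X is handled
  through Hom(A^q, A^b) modulo Hom(A^p, A^b), so every homological statement becomes one about
  linear maps between free modules, which can be lifted by projectivity.\<close>

definition lin_map ::
  "('a, 'x) ring_scheme \<Rightarrow> ('a, 'm, 'y) module_scheme \<Rightarrow> ('a, 'n, 'z) module_scheme \<Rightarrow> ('m \<Rightarrow> 'n) \<Rightarrow> bool"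
  where
  "lin_map A M N f \<longleftrightarrow> f \<in> carrier M \<rightarrow> carrier N \<and>
      (\<forall>x \<in> carrier M. \<forall>y \<in> carrier M. f (x \<oplus>\<^bsub>M\<^esub> y) = f x \<oplus>\<^bsub>N\<^esub> f y) \<and>
      (\<forall>a \<in> carrier A. \<forall>x \<in> carrier M. f (a \<odot>\<^bsub>M\<^esub> x) = a \<odot>\<^bsub>N\<^esub> f x)"

text \<open>\<open>lin_map\<close> drops the extensionality demanded by \<open>linear_maps\<close>,
  so that plain lambda terms for composites and pointwise sums qualify; this is the bridge between
  the two.\<close>

lemma linear_maps_iff: "f \<in> linear_maps A M N \<longleftrightarrow> lin_map A M N f \<and> f \<in> extensional (carrier M)"
  unfolding linear_maps_def lin_map_def by (auto simp: PiE_def)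

lemma lin_map_closed: "lin_map A M N f \<Longrightarrow> x \<in> carrier M \<Longrightarrow> f x \<in> carrier N"
  unfolding lin_map_def by auto

lemma lin_map_add:
  "lin_map A M N f \<Longrightarrow> x \<in> carrier M \<Longrightarrow> y \<in> carrier M \<Longrightarrow> f (x \<oplus>\<^bsub>M\<^esub> y) = f x \<oplus>\<^bsub>N\<^esub> f y"
  unfolding lin_map_def by auto

lemma lin_map_smult:
  "lin_map A M N f \<Longrightarrow> a \<in> carrier A \<Longrightarrow> x \<in> carrier M \<Longrightarrow> f (a \<odot>\<^bsub>M\<^esub> x) = a \<odot>\<^bsub>N\<^esub> f x"
  unfolding lin_map_def by auto

lemma lin_map_cong:
  assumes "lin_map A M N f" "module A M" "\<And>x. x \<in> carrier M \<Longrightarrow> g x = f x"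
  shows "lin_map A M N g"
proof -
  interpret module A M by fact
  show ?thesis using assms(1,3) unfolding lin_map_def by (auto simp: Pi_iff)
qed

lemma lin_map_comp:
  "lin_map A M N f \<Longrightarrow> lin_map A N P g \<Longrightarrow> lin_map A M P (\<lambda>x. g (f x))"
  unfolding lin_map_def by (auto simp: Pi_iff)

lemma lin_map_zero_map:
  assumes "module A N"
  shows "lin_map A M N (\<lambda>_. \<zero>\<^bsub>N\<^esub>)"
proof -
  interpret N: module A N by fact
  show ?thesis unfolding lin_map_def by auto
qed

lemma lin_map_zero:
  assumes "module A M" "module A N" "lin_map A M N f"
  shows "f \<zero>\<^bsub>M\<^esub> = \<zero>\<^bsub>N\<^esub>"
proof -
  interpret M: module A M by fact
  interpret N: module A N by fact
  have "f (\<zero>\<^bsub>A\<^esub> \<odot>\<^bsub>M\<^esub> \<zero>\<^bsub>M\<^esub>) = \<zero>\<^bsub>A\<^esub> \<odot>\<^bsub>N\<^esub> f \<zero>\<^bsub>M\<^esub>"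
    by (rule lin_map_smult[OF assms(3)]) auto
  thus ?thesis using lin_map_closed[OF assms(3), of "\<zero>\<^bsub>M\<^esub>"] by simp
qed

lemma lin_map_neg:
  assumes "module A M" "module A N" "lin_map A M N f" "x \<in> carrier M"
  shows "f (\<ominus>\<^bsub>M\<^esub> x) = \<ominus>\<^bsub>N\<^esub> f x"
proof -
  interpret M: module A M by fact
  interpret N: module A N by fact
  have "f x \<oplus>\<^bsub>N\<^esub> f (\<ominus>\<^bsub>M\<^esub> x) = \<zero>\<^bsub>N\<^esub>"
    using lin_map_add[OF assms(3,4), of "\<ominus>\<^bsub>M\<^esub> x"] assms(4) lin_map_zero[OF assms(1-3)]
    by (simp add: M.r_neg)
  thus ?thesis using lin_map_closed[OF assms(3)] assms(4)
    by (metis M.M.a_inv_closed N.M.add.inv_equality N.M.add.m_comm)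
qed

lemma lin_map_minus:
  assumes "module A M" "module A N" "lin_map A M N f" "x \<in> carrier M" "y \<in> carrier M"
  shows "f (x \<ominus>\<^bsub>M\<^esub> y) = f x \<ominus>\<^bsub>N\<^esub> f y"
proof -
  interpret M: module A M by fact
  show ?thesis unfolding a_minus_def
    using assms lin_map_add[OF assms(3,4)] lin_map_neg[OF assms(1-3)] by simp
qed

lemma lin_map_sum:
  assumes "module A M" "module A N" "lin_map A M N f" "g \<in> I \<rightarrow> carrier M"
  shows "f (\<Oplus>\<^bsub>M\<^esub>i\<in>I. g i) = (\<Oplus>\<^bsub>N\<^esub>i\<in>I. f (g i))"
proof -
  interpret M: module A M by fact
  interpret N: module A N by fact
  note [simp] = lin_map_zero[OF assms(1-3)]
  show ?thesis using assms(4)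
  proof (induction I rule: infinite_finite_induct)
    case (insert i I)
    then have gi: "g i \<in> carrier M" and gI: "g \<in> I \<rightarrow> carrier M" by auto
    have "f (\<Oplus>\<^bsub>M\<^esub>i\<in>insert i I. g i) = f (g i \<oplus>\<^bsub>M\<^esub> (\<Oplus>\<^bsub>M\<^esub>i\<in>I. g i))"
      using insert gi gI by (subst M.M.finsum_insert) auto
    also have "\<dots> = f (g i) \<oplus>\<^bsub>N\<^esub> (\<Oplus>\<^bsub>N\<^esub>i\<in>I. f (g i))"
      using insert gi gI lin_map_add[OF assms(3) gi] by auto
    also have "\<dots> = (\<Oplus>\<^bsub>N\<^esub>i\<in>insert i I. f (g i))"
      using insert gi gI lin_map_closed[OF assms(3)] by (subst N.M.finsum_insert) auto
    finally show ?case .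
  qed auto
qed

lemma lin_map_plus:
  assumes "module A M" "module A N" "lin_map A M N f" "lin_map A M N g"
  shows "lin_map A M N (\<lambda>x. f x \<oplus>\<^bsub>N\<^esub> g x)"
proof -
  interpret M: module A M by fact
  interpret N: module A N by fact
  show ?thesis using assms(3,4) unfolding lin_map_def
    by (auto simp: Pi_iff N.smult_r_distr N.M.a_ac)
qed

lemma lin_map_uminus:
  assumes "module A M" "module A N" "lin_map A M N f"
  shows "lin_map A M N (\<lambda>x. \<ominus>\<^bsub>N\<^esub> f x)"
proof -
  interpret M: module A M by fact
  interpret N: module A N by fact
  show ?thesis using assms(3) unfolding lin_map_def
    by (auto simp: Pi_iff N.smult_r_minus N.M.minus_add)
qed

lemma lin_map_diff:
  assumes "module A M" "module A N" "lin_map A M N f" "lin_map A M N g"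
  shows "lin_map A M N (\<lambda>x. f x \<ominus>\<^bsub>N\<^esub> g x)"
  unfolding a_minus_def
  by (rule lin_map_plus[OF assms(1-3) lin_map_uminus[OF assms(1,2,4)]])

section \<open>The free modules \<open>A\<^sup>n\<close>\<close>

lemma free_mod_simps [simp]:
  "carrier (free_mod A n) = {..<n} \<rightarrow>\<^sub>E carrier A"
  "\<zero>\<^bsub>free_mod A n\<^esub> = (\<lambda>i\<in>{..<n}. \<zero>\<^bsub>A\<^esub>)"
  "v \<oplus>\<^bsub>free_mod A n\<^esub> w = (\<lambda>i\<in>{..<n}. v i \<oplus>\<^bsub>A\<^esub> w i)"
  "a \<odot>\<^bsub>free_mod A n\<^esub> v = (\<lambda>i\<in>{..<n}. a \<otimes>\<^bsub>A\<^esub> v i)"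
  by (simp_all add: free_mod_def)

definition unitv :: "('a, 'x) ring_scheme \<Rightarrow> nat \<Rightarrow> nat \<Rightarrow> (nat \<Rightarrow> 'a)" where
  "unitv A n j = (\<lambda>i\<in>{..<n}. if i = j then \<one>\<^bsub>A\<^esub> else \<zero>\<^bsub>A\<^esub>)"

definition lincomb ::
  "('a, 'm, 'y) module_scheme \<Rightarrow> nat \<Rightarrow> (nat \<Rightarrow> 'm) \<Rightarrow> (nat \<Rightarrow> 'a) \<Rightarrow> 'm" where
  "lincomb M n w x = (\<Oplus>\<^bsub>M\<^esub>j\<in>{..<n}. x j \<odot>\<^bsub>M\<^esub> w j)"

context cring
begin

lemma free_mod_module: "module R (free_mod R n)"
proof (rule moduleI)
  show "abelian_group (free_mod R n)"
  proof (rule abelian_groupI)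
    fix x assume x: "x \<in> carrier (free_mod R n)"
    show "\<exists>y\<in>carrier (free_mod R n). y \<oplus>\<^bsub>free_mod R n\<^esub> x = \<zero>\<^bsub>free_mod R n\<^esub>"
      using x by (intro bexI[of _ "\<lambda>i\<in>{..<n}. \<ominus> x i"]) (auto simp: l_neg PiE_iff intro!: restrict_ext)
  qed (auto simp: PiE_iff a_ac fun_eq_iff extensional_def)
qed (auto simp: PiE_iff l_distr r_distr m_ac fun_eq_iff extensional_def cring_axioms)

lemma free_mod_neg:
  assumes "x \<in> carrier (free_mod R n)"
  shows "\<ominus>\<^bsub>free_mod R n\<^esub> x = (\<lambda>i\<in>{..<n}. \<ominus> x i)"
proof -
  interpret V: module R "free_mod R n" by (rule free_mod_module)
  show ?thesis
    by (rule V.M.add.inv_equality) (use assms in \<open>auto simp: l_neg PiE_iff intro!: restrict_ext\<close>)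
qed

lemma free_mod_minus:
  assumes "x \<in> carrier (free_mod R n)" "y \<in> carrier (free_mod R n)"
  shows "x \<ominus>\<^bsub>free_mod R n\<^esub> y = (\<lambda>i\<in>{..<n}. x i \<ominus> y i)"
  unfolding a_minus_def free_mod_neg[OF assms(2)] by (auto intro!: restrict_ext)

lemma free_mod_minus_coord:
  assumes "x \<in> carrier (free_mod R n)" "y \<in> carrier (free_mod R n)" "i < n"
  shows "(x \<ominus>\<^bsub>free_mod R n\<^esub> y) i = x i \<ominus> y i"
  using assms(3) unfolding free_mod_minus[OF assms(1,2)] by simp

lemma free_mod_sum:
  assumes "finite I" "g \<in> I \<rightarrow> carrier (free_mod R n)"
  shows "(\<Oplus>\<^bsub>free_mod R n\<^esub>j\<in>I. g j) = (\<lambda>i\<in>{..<n}. \<Oplus>j\<in>I. g j i)"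
  using assms
proof (induction I)
  case empty
  interpret V: module R "free_mod R n" by (rule free_mod_module)
  show ?case by simp
next
  case (insert a I)
  interpret V: module R "free_mod R n" by (rule free_mod_module)
  have "(\<Oplus>\<^bsub>free_mod R n\<^esub>j\<in>insert a I. g j) = g a \<oplus>\<^bsub>free_mod R n\<^esub> (\<Oplus>\<^bsub>free_mod R n\<^esub>j\<in>I. g j)"
    using insert by (intro V.M.finsum_insert) auto
  also have "\<dots> = (\<lambda>i\<in>{..<n}. \<Oplus>j\<in>insert a I. g j i)"
    using insert by (auto simp: Pi_iff PiE_iff intro!: restrict_ext)
  finally show ?case .
qed

lemma unitv_closed [simp]: "unitv R n j \<in> carrier (free_mod R n)"
  by (auto simp: unitv_def)

end

section \<open>Linear combinations and the universal property of A^n\<close>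

context module
begin

lemma finsum_mem:
  assumes "\<zero>\<^bsub>M\<^esub> \<in> W" "W \<subseteq> carrier M" "\<And>x y. x \<in> W \<Longrightarrow> y \<in> W \<Longrightarrow> x \<oplus>\<^bsub>M\<^esub> y \<in> W" "g \<in> I \<rightarrow> W"
  shows "(\<Oplus>\<^bsub>M\<^esub>i\<in>I. g i) \<in> W"
  using assms(4)
proof (induction I rule: infinite_finite_induct)
  case (insert i I)
  then show ?case using assms(1-3) by (subst M.finsum_insert) auto
qed (use assms in auto)

lemma lincomb_lin_map:
  assumes w: "w \<in> {..<n} \<rightarrow> carrier M"
  shows "lin_map R (free_mod R n) M (lincomb M n w)"
proof -
  have c: "x j \<odot>\<^bsub>M\<^esub> w j \<in> carrier M" if "x \<in> carrier (free_mod R n)" "j < n" for x j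
    using that w by (auto simp: Pi_iff)
  show ?thesis unfolding lin_map_def
  proof (intro conjI ballI)
    show "lincomb M n w \<in> carrier (free_mod R n) \<rightarrow> carrier M"
      using c unfolding lincomb_def by (auto intro!: M.finsum_closed)
  next
    fix x y assume x: "x \<in> carrier (free_mod R n)" and y: "y \<in> carrier (free_mod R n)"
    have "lincomb M n w (x \<oplus>\<^bsub>free_mod R n\<^esub> y) = (\<Oplus>\<^bsub>M\<^esub>j\<in>{..<n}. x j \<odot>\<^bsub>M\<^esub> w j \<oplus>\<^bsub>M\<^esub> y j \<odot>\<^bsub>M\<^esub> w j)"
      unfolding lincomb_def using x y w c
      by (intro M.finsum_cong') (auto simp: Pi_iff PiE_iff smult_l_distr)
    also have "\<dots> = lincomb M n w x \<oplus>\<^bsub>M\<^esub> lincomb M n w y"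
      unfolding lincomb_def using x y c by (intro M.finsum_addf) auto
    finally show "lincomb M n w (x \<oplus>\<^bsub>free_mod R n\<^esub> y) = lincomb M n w x \<oplus>\<^bsub>M\<^esub> lincomb M n w y" .
  next
    fix a x assume a: "a \<in> carrier R" and x: "x \<in> carrier (free_mod R n)"
    have "lincomb M n w (a \<odot>\<^bsub>free_mod R n\<^esub> x) = (\<Oplus>\<^bsub>M\<^esub>j\<in>{..<n}. a \<odot>\<^bsub>M\<^esub> (x j \<odot>\<^bsub>M\<^esub> w j))"
      unfolding lincomb_def using x a w c
      by (intro M.finsum_cong') (auto simp: Pi_iff PiE_iff smult_assoc1)
    also have "\<dots> = a \<odot>\<^bsub>M\<^esub> lincomb M n w x"
      unfolding lincomb_def using x a c by (intro finsum_smult_ldistr[symmetric]) auto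
    finally show "lincomb M n w (a \<odot>\<^bsub>free_mod R n\<^esub> x) = a \<odot>\<^bsub>M\<^esub> lincomb M n w x" .
  qed
qed

lemma lincomb_unitv:
  assumes w: "w \<in> {..<n} \<rightarrow> carrier M" and j: "j < n"
  shows "lincomb M n w (unitv R n j) = w j"
proof -
  have "lincomb M n w (unitv R n j) = (\<Oplus>\<^bsub>M\<^esub>i\<in>{..<n}. if j = i then w i else \<zero>\<^bsub>M\<^esub>)"
    unfolding lincomb_def using w by (intro M.finsum_cong') (auto simp: unitv_def Pi_iff)
  also have "\<dots> = w j" using w j by (intro M.finsum_singleton) auto
  finally show ?thesis .
qed

end

context cring
begin

lemma free_mod_expand:
  assumes x: "x \<in> carrier (free_mod R n)"
  shows "x = (\<Oplus>\<^bsub>free_mod R n\<^esub>j\<in>{..<n}. x j \<odot>\<^bsub>free_mod R n\<^esub> unitv R n j)"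
proof -
  have "(\<Oplus>j\<in>{..<n}. (x j \<odot>\<^bsub>free_mod R n\<^esub> unitv R n j) i) = x i" if i: "i < n" for i
  proof -
    have "(\<Oplus>j\<in>{..<n}. (x j \<odot>\<^bsub>free_mod R n\<^esub> unitv R n j) i) = (\<Oplus>j\<in>{..<n}. if i = j then x j else \<zero>)"
      using i x by (intro finsum_cong') (auto simp: unitv_def PiE_iff)
    also have "\<dots> = x i" using i x by (intro finsum_singleton) (auto simp: PiE_iff)
    finally show ?thesis .
  qed
  then show ?thesis
    using x by (subst free_mod_sum) (auto simp: PiE_iff fun_eq_iff extensional_def unitv_def)
qed

lemma lin_map_lincomb:
  assumes "module R M" "lin_map R (free_mod R n) M f" "x \<in> carrier (free_mod R n)"
  shows "f x = lincomb M n (\<lambda>j. f (unitv R n j)) x"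
proof -
  interpret V: module R "free_mod R n" by (rule free_mod_module)
  interpret M: module R M by fact
  have c: "x j \<in> carrier R" if "j < n" for j using assms(3) that by auto
  have "f x = f (\<Oplus>\<^bsub>free_mod R n\<^esub>j\<in>{..<n}. x j \<odot>\<^bsub>free_mod R n\<^esub> unitv R n j)"
    using free_mod_expand[OF assms(3)] by simp
  also have "\<dots> = (\<Oplus>\<^bsub>M\<^esub>j\<in>{..<n}. f (x j \<odot>\<^bsub>free_mod R n\<^esub> unitv R n j))"
    by (rule lin_map_sum[OF free_mod_module assms(1,2)])
       (use c in \<open>auto intro!: V.smult_closed simp del: free_mod_simps\<close>)
  also have "\<dots> = lincomb M n (\<lambda>j. f (unitv R n j)) x"
    unfolding lincomb_def
    by (rule M.M.finsum_cong')
       (use c lin_map_smult[OF assms(2) _ unitv_closed] lin_map_closed[OF assms(2) unitv_closed] in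
         \<open>auto simp del: free_mod_simps\<close>)
  finally show ?thesis .
qed

lemma lin_map_ext:
  assumes "module R M" "lin_map R (free_mod R n) M f" "lin_map R (free_mod R n) M g"
    "\<And>j. j < n \<Longrightarrow> f (unitv R n j) = g (unitv R n j)" "x \<in> carrier (free_mod R n)"
  shows "f x = g x"
proof -
  interpret M: module R M by fact
  have c: "x j \<in> carrier R" if "j < n" for j using assms(5) that by auto
  show ?thesis
    unfolding lin_map_lincomb[OF assms(1,2,5)] lin_map_lincomb[OF assms(1,3,5)] lincomb_def
    by (rule M.M.finsum_cong')
      (use c assms(4) lin_map_closed[OF assms(3) unitv_closed] in \<open>auto simp del: free_mod_simps\<close>)
qed

text \<open>Projectivity of A^n: preimages are chosen at the unit vectors only and extended
  linearly.\<close>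

lemma free_mod_lift:
  assumes "module R M" "module R N" "lin_map R (free_mod R n) N g" "lin_map R M N p"
    and sub: "\<And>x. x \<in> carrier (free_mod R n) \<Longrightarrow> g x \<in> p ` carrier M"
  obtains h where "lin_map R (free_mod R n) M h" "\<And>x. x \<in> carrier (free_mod R n) \<Longrightarrow> p (h x) = g x"
proof -
  interpret M: module R M by fact
  define w where "w j = (SOME m. m \<in> carrier M \<and> p m = g (unitv R n j))" for j
  have w: "w j \<in> carrier M \<and> p (w j) = g (unitv R n j)" for j
  proof -
    have "\<exists>m. m \<in> carrier M \<and> p m = g (unitv R n j)" using sub[OF unitv_closed, of j] by force
    then show ?thesis unfolding w_def by (rule someI_ex)
  qed
  have l: "lin_map R (free_mod R n) M (lincomb M n w)"
    by (rule M.lincomb_lin_map) (use w in auto)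
  show ?thesis
  proof (rule that[OF l])
    fix x assume x: "x \<in> carrier (free_mod R n)"
    show "p (lincomb M n w x) = g x"
    proof (rule lin_map_ext[OF assms(2) lin_map_comp[OF l assms(4)] assms(3) _ x])
      fix j assume "j < n"
      then show "p (lincomb M n w (unitv R n j)) = g (unitv R n j)"
        using w by (subst M.lincomb_unitv) auto
    qed
  qed
qed

text \<open>A map between free modules is a matrix over R, so the coordinates of \<open>f x\<close>
  are combinations of those of \<open>x\<close>. This is applied both to the maximal ideal and to
  the complement \<open>P\<close> of the socle line.\<close>

lemma lin_map_ideal:
  assumes "ideal I R" "lin_map R (free_mod R n) (free_mod R m) f" "x \<in> {..<n} \<rightarrow>\<^sub>E I"
  shows "f x \<in> {..<m} \<rightarrow>\<^sub>E I"
proof -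
  interpret I: ideal I R by fact
  interpret V: module R "free_mod R m" by (rule free_mod_module)
  have Ic: "I \<subseteq> carrier R" using I.a_subset .
  then have x: "x \<in> carrier (free_mod R n)" using assms(3) by (auto simp: PiE_iff)
  have "(\<Oplus>\<^bsub>free_mod R m\<^esub>j\<in>{..<n}. x j \<odot>\<^bsub>free_mod R m\<^esub> f (unitv R n j)) \<in> {..<m} \<rightarrow>\<^sub>E I"
  proof (rule V.finsum_mem)
    show "\<zero>\<^bsub>free_mod R m\<^esub> \<in> {..<m} \<rightarrow>\<^sub>E I" by auto
    show "{..<m} \<rightarrow>\<^sub>E I \<subseteq> carrier (free_mod R m)" using Ic by (auto simp: PiE_iff)
    show "(\<lambda>j. x j \<odot>\<^bsub>free_mod R m\<^esub> f (unitv R n j)) \<in> {..<n} \<rightarrow> ({..<m} \<rightarrow>\<^sub>E I)"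
      using assms(3) lin_map_closed[OF assms(2) unitv_closed]
      by (auto simp: PiE_iff intro!: I.I_r_closed split: if_splits)
  qed (auto simp: PiE_iff)
  then show ?thesis unfolding lin_map_lincomb[OF free_mod_module assms(2) x] lincomb_def .
qed

end

section \<open>The ring as a module over itself, and linear functionals\<close>

definition reg_mod :: "('a, 'x) ring_scheme \<Rightarrow> ('a, 'a) module" where
  "reg_mod A = \<lparr>carrier = carrier A, monoid.mult = undefined, monoid.one = undefined,
     ring.zero = \<zero>\<^bsub>A\<^esub>, ring.add = ring.add A, smult = monoid.mult A\<rparr>"

lemma reg_mod_simps [simp]:
  "carrier (reg_mod A) = carrier A" "\<zero>\<^bsub>reg_mod A\<^esub> = \<zero>\<^bsub>A\<^esub>"
  "x \<oplus>\<^bsub>reg_mod A\<^esub> y = x \<oplus>\<^bsub>A\<^esub> y" "x \<odot>\<^bsub>reg_mod A\<^esub> y = x \<otimes>\<^bsub>A\<^esub> y"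
  by (simp_all add: reg_mod_def)

context cring
begin

lemma reg_mod_module: "module R (reg_mod R)"
proof (rule moduleI)
  show "abelian_group (reg_mod R)"
  proof (rule abelian_groupI)
    fix x assume "x \<in> carrier (reg_mod R)"
    then show "\<exists>y\<in>carrier (reg_mod R). y \<oplus>\<^bsub>reg_mod R\<^esub> x = \<zero>\<^bsub>reg_mod R\<^esub>"
      by (intro bexI[of _ "\<ominus> x"]) (auto simp: l_neg)
  qed (auto simp: a_ac)
qed (auto simp: l_distr r_distr m_assoc cring_axioms)

lemma lin_map_coord:
  "i < n \<Longrightarrow> lin_map R (free_mod R n) (reg_mod R) (\<lambda>x. x i)"
  unfolding lin_map_def by (auto simp: PiE_iff)

lemma lin_map_functional_smult:
  assumes "module R M" "module R N" "lin_map R M (reg_mod R) z" "y \<in> carrier N"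
  shows "lin_map R M N (\<lambda>x. z x \<odot>\<^bsub>N\<^esub> y)"
proof -
  interpret M: module R M by fact
  interpret N: module R N by fact
  show ?thesis using assms(3,4) unfolding lin_map_def
    by (auto simp: Pi_iff N.smult_l_distr N.smult_assoc1)
qed

lemma lin_map_id: "lin_map R M M (\<lambda>x. x)"
  unfolding lin_map_def by auto

end

section \<open>Local rings\<close>

locale local_cring = cring R + nn: ideal \<nn> R for R (structure) and \<nn> +
  assumes one_notin: "\<one> \<notin> \<nn>"
    and Units_if_notin: "a \<in> carrier R \<Longrightarrow> a \<notin> \<nn> \<Longrightarrow> a \<in> Units R"
begin

lemma local_minusD: "a \<ominus> b \<in> \<nn> \<Longrightarrow> b \<in> \<nn> \<Longrightarrow> a \<in> carrier R \<Longrightarrow> a \<in> \<nn>"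
  by (metis a_minus_def add.inv_solve_right nn.Icarr nn.a_closed minus_closed)

text \<open>The submodule may be replaced by its image under the projection along one of its elements with
  a unit coordinate; this lowers the number of coordinates in play.\<close>

lemma separating_functional:
  assumes "J \<subseteq> {..<n}" "lin_map R (free_mod R m) (free_mod R n) d" "x \<in> carrier (free_mod R n)"
    and "\<And>i. i < n \<Longrightarrow> i \<notin> J \<Longrightarrow> x i = \<zero>"
    and "\<And>i z. i < n \<Longrightarrow> i \<notin> J \<Longrightarrow> z \<in> carrier (free_mod R m) \<Longrightarrow> d z i = \<zero>"
    and "\<And>z. z \<in> carrier (free_mod R m) \<Longrightarrow> x \<ominus>\<^bsub>free_mod R n\<^esub> d z \<notin> {..<n} \<rightarrow>\<^sub>E \<nn>"
  shows "\<exists>\<zeta>. lin_map R (free_mod R n) (reg_mod R) \<zeta> \<and> \<zeta> x = \<one> \<and>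
    (\<forall>z\<in>carrier (free_mod R m). \<zeta> (d z) \<in> \<nn>)"
  using assms
proof (induction "card J" arbitrary: J d x rule: less_induct)
  case less
  note J = less.prems(1) and d = less.prems(2) and x = less.prems(3)
    and xJ = less.prems(4) and dJ = less.prems(5) and notin = less.prems(6)
  interpret V: module R "free_mod R n" by (rule free_mod_module)
  interpret U: module R "free_mod R m" by (rule free_mod_module)
  have dc: "d z \<in> carrier (free_mod R n)" if "z \<in> carrier (free_mod R m)" for z
    using lin_map_closed[OF d that] .
  have finJ: "finite J" using J by (rule finite_subset) auto
  show ?case
  proof (cases "\<forall>z\<in>carrier (free_mod R m). d z \<in> {..<n} \<rightarrow>\<^sub>E \<nn>")
    case True
    \<comment> \<open>The choice z = 0 in \<open>notin\<close> shows that x itself has a coordinate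
      outside the maximal ideal, hence a unit. All values of d lie in the ideal in this case, so
      that coordinate, rescaled, is the functional.\<close>
    have "x \<ominus>\<^bsub>free_mod R n\<^esub> d \<zero>\<^bsub>free_mod R m\<^esub> = x"
      using lin_map_zero[OF free_mod_module free_mod_module d] x by (simp add: a_minus_def del: free_mod_simps)
    then have "x \<notin> {..<n} \<rightarrow>\<^sub>E \<nn>" using notin[of "\<zero>\<^bsub>free_mod R m\<^esub>"] by (simp del: free_mod_simps)
    then obtain i where i: "i < n" "x i \<notin> \<nn>" using x by (auto simp: PiE_iff)
    have u: "x i \<in> Units R" using Units_if_notin i x by auto
    let ?\<zeta> = "\<lambda>v. v i \<otimes> inv (x i)"
    have "lin_map R (free_mod R n) (reg_mod R) ?\<zeta>"
      using lin_map_functional_smult[OF free_mod_module reg_mod_module lin_map_coord[OF i(1)], of "inv (x i)"] u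
      by simp
    moreover have "?\<zeta> x = \<one>" using u by simp
    moreover have "?\<zeta> (d z) \<in> \<nn>" if "z \<in> carrier (free_mod R m)" for z
    proof -
      have "d z i \<in> \<nn>" using True that i by (meson PiE_mem lessThan_iff)
      then show ?thesis using u by (intro nn.I_r_closed) auto
    qed
    ultimately show ?thesis by blast
  next
    case False
    then obtain z where z: "z \<in> carrier (free_mod R m)" "d z \<notin> {..<n} \<rightarrow>\<^sub>E \<nn>" by blast
    then obtain j where j: "j < n" "d z j \<notin> \<nn>" using dc[OF z(1)] by (auto simp: PiE_iff)
    have u: "d z j \<in> Units R" using Units_if_notin j dc[OF z(1)] by auto
    have jJ: "j \<in> J" using dJ[OF j(1) _ z(1)] j(2) nn.zero_closed by force
    define w where "w = inv (d z j) \<odot>\<^bsub>free_mod R m\<^esub> z"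
    have w: "w \<in> carrier (free_mod R m)" unfolding w_def using u z(1) by (intro U.smult_closed) auto
    have dw: "d w = inv (d z j) \<odot>\<^bsub>free_mod R n\<^esub> d z"
      unfolding w_def using u z(1) by (intro lin_map_smult[OF d]) auto
    have dwj: "d w j = \<one>" using dw u j by simp
    define p where "p v = v \<ominus>\<^bsub>free_mod R n\<^esub> v j \<odot>\<^bsub>free_mod R n\<^esub> d w" for v
    have p: "lin_map R (free_mod R n) (free_mod R n) p"
      unfolding p_def
      by (rule lin_map_diff[OF free_mod_module free_mod_module lin_map_id
            lin_map_functional_smult[OF free_mod_module free_mod_module lin_map_coord[OF j(1)] dc[OF w]]])
    have pv: "p v i = v i \<ominus> v j \<otimes> d w i" if "v \<in> carrier (free_mod R n)" "i < n" for v i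
      unfolding p_def using that j dc[OF w] by (subst free_mod_minus) (auto simp: PiE_iff)
    have ex: "\<exists>\<zeta>. lin_map R (free_mod R n) (reg_mod R) \<zeta> \<and> \<zeta> (p x) = \<one> \<and>
      (\<forall>z\<in>carrier (free_mod R m). \<zeta> (p (d z)) \<in> \<nn>)"
    proof (rule less.hyps[of "J - {j}"])
      show "card (J - {j}) < card J" using jJ finJ by (meson card_Diff1_less)
      show "J - {j} \<subseteq> {..<n}" using J by auto
      show "lin_map R (free_mod R m) (free_mod R n) (\<lambda>a. p (d a))" by (rule lin_map_comp[OF d p])
      show "p x \<in> carrier (free_mod R n)" by (rule lin_map_closed[OF p x])
      have z0: "p v i = \<zero>" if v: "v \<in> carrier (free_mod R n)" and i: "i < n" "i \<notin> J - {j}"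
        and vJ: "\<And>i. i < n \<Longrightarrow> i \<notin> J \<Longrightarrow> v i = \<zero>" for v i
      proof (cases "i = j")
        case True
        have "v j \<in> carrier R" using v j by auto
        then show ?thesis using pv[OF v i(1)] True dwj by (simp add: a_minus_def r_neg)
      next
        case False
        then have "i \<notin> J" using i by auto
        moreover have "v j \<in> carrier R" using v j by auto
        ultimately show ?thesis using pv[OF v i(1)] vJ[OF i(1)] dJ[OF i(1) _ w] by (simp add: a_minus_def)
      qed
      show "p x i = \<zero>" if "i < n" "i \<notin> J - {j}" for i by (rule z0[OF x that xJ])
      show "p (d a) i = \<zero>" if "i < n" "i \<notin> J - {j}" "a \<in> carrier (free_mod R m)" for i a
        by (rule z0[OF dc[OF that(3)] that(1,2) dJ[OF _ _ that(3)]])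
      fix a assume a: "a \<in> carrier (free_mod R m)"
      \<comment> \<open>\<open>b\<close> is \<open>a\<close> corrected by the multiple of
        \<open>w\<close> that accounts for the j-th coordinate of \<open>x - d a\<close>. The
        projected difference then equals \<open>x - d b\<close>, so the hypothesis on
        \<open>x\<close> passes to \<open>p x\<close>.\<close>
      define b where "b = a \<oplus>\<^bsub>free_mod R m\<^esub> (x j \<ominus> d a j) \<odot>\<^bsub>free_mod R m\<^esub> w"
      have cj: "x j \<ominus> d a j \<in> carrier R" using x j dc[OF a] by auto
      have b: "b \<in> carrier (free_mod R m)" unfolding b_def
        by (rule U.M.add.m_closed[OF a U.smult_closed[OF cj w]])
      have db: "d b = d a \<oplus>\<^bsub>free_mod R n\<^esub> (x j \<ominus> d a j) \<odot>\<^bsub>free_mod R n\<^esub> d w"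
        unfolding b_def lin_map_add[OF d a U.smult_closed[OF cj w]] lin_map_smult[OF d cj w] ..
      have "p x i \<ominus> p (d a) i = x i \<ominus> d b i" if i: "i < n" for i
      proof -
        have c: "x i \<in> carrier R" "x j \<in> carrier R" "d a i \<in> carrier R" "d a j \<in> carrier R" "d w i \<in> carrier R"
          using x j i dc[OF a] dc[OF w] by auto
        then have "(x i \<ominus> x j \<otimes> d w i) \<ominus> (d a i \<ominus> d a j \<otimes> d w i) = x i \<ominus> (d a i \<oplus> (x j \<ominus> d a j) \<otimes> d w i)"
          by algebra
        then show ?thesis using pv[OF x i] pv[OF dc[OF a] i] db i by simp
      qed
      then have "p x \<ominus>\<^bsub>free_mod R n\<^esub> p (d a) = x \<ominus>\<^bsub>free_mod R n\<^esub> d b"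
        using free_mod_minus[OF x dc[OF b]]
          free_mod_minus[OF lin_map_closed[OF p x] lin_map_closed[OF p dc[OF a]]]
        by (auto simp: fun_eq_iff)
      then show "p x \<ominus>\<^bsub>free_mod R n\<^esub> p (d a) \<notin> {..<n} \<rightarrow>\<^sub>E \<nn>" using notin[OF b] by simp
    qed
    then obtain \<zeta> where \<zeta>: "lin_map R (free_mod R n) (reg_mod R) \<zeta>" "\<zeta> (p x) = \<one>"
      "\<forall>z\<in>carrier (free_mod R m). \<zeta> (p (d z)) \<in> \<nn>" by blast
    show ?thesis
      by (rule exI[of _ "\<lambda>v. \<zeta> (p v)"]) (use lin_map_comp[OF p \<zeta>(1)] \<zeta>(2,3) in auto)
  qed
qed

section \<open>Minimal generating families and Nakayama's lemma\<close>

definition supported :: "nat set \<Rightarrow> nat \<Rightarrow> (nat \<Rightarrow> 'a) set" where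
  "supported J n = {v \<in> carrier (free_mod R n). \<forall>i<n. i \<notin> J \<longrightarrow> v i = \<zero>}"

lemma supported_carrier: "supported J n \<subseteq> carrier (free_mod R n)"
  unfolding supported_def by blast

lemma supported_minus:
  assumes "v \<in> supported J n" "w \<in> supported J n"
  shows "v \<ominus>\<^bsub>free_mod R n\<^esub> w \<in> supported J n"
proof -
  have "v \<in> carrier (free_mod R n)" "w \<in> carrier (free_mod R n)" using assms supported_carrier by auto
  then show ?thesis
    using assms unfolding supported_def free_mod_minus[OF \<open>v \<in> carrier _\<close> \<open>w \<in> carrier _\<close>]
    by (auto simp: PiE_iff a_minus_def)
qed

lemma unitv_supported: "j \<in> J \<Longrightarrow> unitv R n j \<in> supported J n"
  by (auto simp: supported_def unitv_def)

lemma supported_lincomb: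
  assumes "w \<in> {..<n} \<rightarrow> supported J m" "x \<in> carrier (free_mod R n)"
  shows "lincomb (free_mod R m) n w x \<in> supported J m"
proof -
  interpret V: module R "free_mod R m" by (rule free_mod_module)
  show ?thesis unfolding lincomb_def
    by (rule V.finsum_mem[OF _ supported_carrier])
       (use assms in \<open>auto simp: supported_def Pi_iff PiE_iff\<close>)
qed

text \<open>J is a set of coordinates of least size that still gives the whole image of f, that is,
  a minimal generating family chosen among the images of the unit vectors. A kernel vector with a
  unit coordinate j could be used to eliminate j, so by minimality all relations have entries in
  \<nn>.\<close>

lemma minimal_support:
  assumes "module R M" and f: "lin_map R (free_mod R n) M f"
  obtains J where "J \<subseteq> {..<n}"
    "\<And>v. v \<in> carrier (free_mod R n) \<Longrightarrow> \<exists>w\<in>supported J n. f w = f v"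
    "\<And>v. v \<in> supported J n \<Longrightarrow> f v = \<zero>\<^bsub>M\<^esub> \<Longrightarrow> v \<in> {..<n} \<rightarrow>\<^sub>E \<nn>"
proof -
  interpret M: module R M by fact
  interpret V: module R "free_mod R n" by (rule free_mod_module)
  define P where "P J \<longleftrightarrow> J \<subseteq> {..<n} \<and> (\<forall>v\<in>carrier (free_mod R n). \<exists>w\<in>supported J n. f w = f v)" for J
  have "P {..<n}" unfolding P_def by (auto simp: supported_def)
  then obtain J where J: "P J" and min: "\<And>K. P K \<Longrightarrow> card J \<le> card K"
    using ex_has_least_nat[of P _ card] by metis
  have finJ: "finite J" using J unfolding P_def by (auto intro: finite_subset)
  show ?thesis
  proof (rule that[of J])
    show "J \<subseteq> {..<n}" using J unfolding P_def by auto
    show "\<exists>w\<in>supported J n. f w = f v" if "v \<in> carrier (free_mod R n)" for v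
      using J that unfolding P_def by auto
    fix v assume v: "v \<in> supported J n" and fv: "f v = \<zero>\<^bsub>M\<^esub>"
    have vc: "v \<in> carrier (free_mod R n)" using v by (simp add: supported_def)
    show "v \<in> {..<n} \<rightarrow>\<^sub>E \<nn>"
    proof (rule ccontr)
      assume "v \<notin> {..<n} \<rightarrow>\<^sub>E \<nn>"
      then obtain j where j: "j < n" "v j \<notin> \<nn>" using vc by (auto simp: PiE_iff)
      have u: "v j \<in> Units R" using Units_if_notin j vc by auto
      have jJ: "j \<in> J" using v j by (auto simp: supported_def)
      have "P (J - {j})" unfolding P_def
      proof (intro conjI ballI)
        show "J - {j} \<subseteq> {..<n}" using J unfolding P_def by auto
        fix a assume a: "a \<in> carrier (free_mod R n)"
        then obtain b where b: "b \<in> supported J n" "f b = f a" using J unfolding P_def by blast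
        have bc: "b \<in> carrier (free_mod R n)" using b by (simp add: supported_def)
        define c where "c = b j \<otimes> inv (v j)"
        have c: "c \<in> carrier R" unfolding c_def using u bc j by auto
        have bj: "b j \<in> carrier R" using bc j by auto
        have "c \<otimes> v j = b j \<otimes> (inv (v j) \<otimes> v j)"
          unfolding c_def using u bj by (intro m_assoc) auto
        then have cv: "c \<otimes> v j = b j" using u bj by simp
        define w where "w = b \<ominus>\<^bsub>free_mod R n\<^esub> c \<odot>\<^bsub>free_mod R n\<^esub> v"
        have cvc: "c \<odot>\<^bsub>free_mod R n\<^esub> v \<in> carrier (free_mod R n)" by (rule V.smult_closed[OF c vc])
        have wi: "w i = b i \<ominus> c \<otimes> v i" if "i < n" for i
          unfolding w_def free_mod_minus[OF bc cvc] using that by simp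
        have "w \<in> supported (J - {j}) n"
          unfolding supported_def
        proof (intro CollectI conjI allI impI)
          show "w \<in> carrier (free_mod R n)" unfolding w_def by (rule V.M.minus_closed[OF bc cvc])
          fix i assume i: "i < n" "i \<notin> J - {j}"
          show "w i = \<zero>"
          proof (cases "i = j")
            case True
            then show ?thesis using wi[OF i(1)] cv bj by (simp add: a_minus_def r_neg)
          next
            case False
            then have "i \<notin> J" using i by auto
            then have "b i = \<zero>" "v i = \<zero>" using b v i(1) by (auto simp: supported_def)
            then show ?thesis using wi[OF i(1)] c by (simp add: a_minus_def)
          qed
        qed
        moreover have "f w = f a"
          unfolding w_def lin_map_minus[OF free_mod_module assms bc cvc] lin_map_smult[OF f c vc] fv b(2)
          using c lin_map_closed[OF f a] by (simp add: a_minus_def)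
        ultimately show "\<exists>w\<in>supported (J - {j}) n. f w = f a" by blast
      qed
      from min[OF this] show False using jJ finJ by (metis card_Diff1_less not_le)
    qed
  qed
qed

text \<open>For a minimal coordinate set J, the unit vector at j in J has the same image as some
  J-supported vector b with entries in \<nn>. Their difference is a relation, so its j-th coordinate
  \<open>1 - b j\<close> lies in \<nn>, and with it 1. Hence J is empty.\<close>

lemma nakayama:
  assumes M: "module R M" and f: "lin_map R (free_mod R n) M f"
    and nak: "\<And>v. v \<in> carrier (free_mod R n) \<Longrightarrow> \<exists>w \<in> {..<n} \<rightarrow>\<^sub>E \<nn>. f w = f v"
    and v: "v \<in> carrier (free_mod R n)"
  shows "f v = \<zero>\<^bsub>M\<^esub>"
proof -
  interpret M: module R M by fact
  interpret V: module R "free_mod R n" by (rule free_mod_module)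
  obtain J where J: "J \<subseteq> {..<n}"
    and sp: "\<And>v. v \<in> carrier (free_mod R n) \<Longrightarrow> \<exists>w\<in>supported J n. f w = f v"
    and mn: "\<And>v. v \<in> supported J n \<Longrightarrow> f v = \<zero>\<^bsub>M\<^esub> \<Longrightarrow> v \<in> {..<n} \<rightarrow>\<^sub>E \<nn>"
    using minimal_support[OF M f] by blast
  have "J = {}"
  proof (rule ccontr)
    assume "J \<noteq> {}"
    then obtain j where j: "j \<in> J" by blast
    then have jn: "j < n" using J by auto
    obtain a where a: "a \<in> {..<n} \<rightarrow>\<^sub>E \<nn>" "f a = f (unitv R n j)" using nak[OF unitv_closed] by blast
    then have ac: "a \<in> carrier (free_mod R n)" using PiE_mono[of "{..<n}" "\<lambda>_. \<nn>" "\<lambda>_. carrier R"] nn.a_subset by auto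
    have "\<forall>i. \<exists>w. w \<in> supported J n \<and> f w = f (unitv R n i)" using sp[OF unitv_closed] by blast
    then obtain w where w: "\<And>i. w i \<in> supported J n" "\<And>i. f (w i) = f (unitv R n i)" by metis
    have wc: "w \<in> {..<n} \<rightarrow> carrier (free_mod R n)" using w(1) by (auto simp: supported_def)
    \<comment> \<open>\<open>a\<close> has entries in the ideal but arbitrary support. Replacing
      each unit vector by its J-supported substitute \<open>w i\<close> moves the support into J and
      keeps both the value under f and the entries in the ideal.\<close>
    define b where "b = lincomb (free_mod R n) n w a"
    note l = V.lincomb_lin_map[OF wc]
    have bs: "b \<in> supported J n" unfolding b_def using w(1) ac by (intro supported_lincomb) auto
    have bn: "b \<in> {..<n} \<rightarrow>\<^sub>E \<nn>"
      unfolding b_def by (rule lin_map_ideal[OF nn.ideal_axioms l a(1)])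
    have fb: "f b = f a" unfolding b_def
      by (rule lin_map_ext[OF M lin_map_comp[OF l f] f _ ac])
        (simp add: V.lincomb_unitv[OF wc] w(2) del: free_mod_simps)
    have bc: "b \<in> carrier (free_mod R n)" using bs by (simp add: supported_def)
    let ?c = "unitv R n j \<ominus>\<^bsub>free_mod R n\<^esub> b"
    have cs: "?c \<in> supported J n"
      by (rule supported_minus[OF unitv_supported[OF j] bs])
    have "f ?c = \<zero>\<^bsub>M\<^esub>"
      unfolding lin_map_minus[OF free_mod_module M f unitv_closed bc] fb a(2)
      using lin_map_closed[OF f unitv_closed] by (simp add: a_minus_def M.M.r_neg)
    from mn[OF cs this] have "?c j \<in> \<nn>" using jn by (meson PiE_mem lessThan_iff)
    then have "\<one> \<ominus> b j \<in> \<nn>" unfolding free_mod_minus_coord[OF unitv_closed bc jn] using jn by (simp add: unitv_def)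
    moreover have "b j \<in> \<nn>" using bn jn by auto
    ultimately show False using local_minusD[of \<one>] one_notin by auto
  qed
  obtain w where w: "w \<in> supported J n" "f w = f v" using sp[OF v] by blast
  then have "w = \<zero>\<^bsub>free_mod R n\<^esub>" using \<open>J = {}\<close> by (auto simp: supported_def PiE_iff extensional_def)
  then show ?thesis using w(2) lin_map_zero[OF free_mod_module M f] by (simp del: free_mod_simps)
qed

text \<open>The hypothesis on \<open>d\<close> expresses the vanishing of \<open>Tor\<^sub>1(M, k)\<close>.\<close>

lemma free_module_criterion:
  assumes M: "module R M"
    and e: "lin_map R (free_mod R n) M e" and surj: "e ` carrier (free_mod R n) = carrier M"
    and d: "lin_map R (free_mod R m) (free_mod R n) d"
    and ker: "\<And>x. x \<in> carrier (free_mod R n) \<Longrightarrow> e x = \<zero>\<^bsub>M\<^esub> \<longleftrightarrow> x \<in> d ` carrier (free_mod R m)"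
    and crit: "\<And>v. v \<in> carrier (free_mod R m) \<Longrightarrow> d v \<in> {..<n} \<rightarrow>\<^sub>E \<nn> \<Longrightarrow>
      \<exists>w \<in> {..<m} \<rightarrow>\<^sub>E \<nn>. d w = d v"
  shows "free_module R M"
proof -
  interpret M: module R M by fact
  interpret V: module R "free_mod R n" by (rule free_mod_module)
  obtain J where J: "J \<subseteq> {..<n}"
    and sp: "\<And>v. v \<in> carrier (free_mod R n) \<Longrightarrow> \<exists>w\<in>supported J n. e w = e v"
    and mn: "\<And>v. v \<in> supported J n \<Longrightarrow> e v = \<zero>\<^bsub>M\<^esub> \<Longrightarrow> v \<in> {..<n} \<rightarrow>\<^sub>E \<nn>"
    using minimal_support[OF M e] by blast
  have sc: "supported J n \<subseteq> carrier (free_mod R n)" by (auto simp: supported_def)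
  \<comment> \<open>The extra clause for i in J makes the map \<open>b\<close> built from
    \<open>w\<close> a retraction of A^n onto the J-supported vectors that is compatible with
    e.\<close>
  have "\<forall>i. \<exists>w. w \<in> supported J n \<and> e w = e (unitv R n i) \<and> (i \<in> J \<longrightarrow> w = unitv R n i)"
  proof
    fix i
    show "\<exists>w. w \<in> supported J n \<and> e w = e (unitv R n i) \<and> (i \<in> J \<longrightarrow> w = unitv R n i)"
    proof (cases "i \<in> J")
      case True
      then have "unitv R n i \<in> supported J n" by (auto simp: supported_def unitv_def)
      then show ?thesis by blast
    qed (use sp[OF unitv_closed] in blast)
  qed
  then obtain w where w: "\<And>i. w i \<in> supported J n" "\<And>i. e (w i) = e (unitv R n i)"
    "\<And>i. i \<in> J \<Longrightarrow> w i = unitv R n i" by metis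
  have wc: "w \<in> {..<n} \<rightarrow> carrier (free_mod R n)" using w(1) by (auto simp: supported_def)
  define b where "b = lincomb (free_mod R n) n w"
  have b: "lin_map R (free_mod R n) (free_mod R n) b" unfolding b_def by (rule V.lincomb_lin_map[OF wc])
  have bs: "b x \<in> supported J n" if "x \<in> carrier (free_mod R n)" for x
    unfolding b_def using w(1) that by (intro supported_lincomb) auto
  have eb: "e (b x) = e x" if "x \<in> carrier (free_mod R n)" for x
    by (rule lin_map_ext[OF M lin_map_comp[OF b e] e _ that])
       (simp add: b_def V.lincomb_unitv[OF wc] w(2) del: free_mod_simps)
  have bid: "b x = x" if x: "x \<in> supported J n" for x
  proof -
    have xc: "x \<in> carrier (free_mod R n)" using x sc by auto
    have "b x = (\<Oplus>\<^bsub>free_mod R n\<^esub>j\<in>{..<n}. x j \<odot>\<^bsub>free_mod R n\<^esub> unitv R n j)"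
      unfolding b_def lincomb_def
    proof (rule V.M.finsum_cong')
      show "(\<lambda>j. x j \<odot>\<^bsub>free_mod R n\<^esub> unitv R n j) \<in> {..<n} \<rightarrow> carrier (free_mod R n)"
        using xc by (auto simp: unitv_def PiE_iff)
      fix j assume j: "j \<in> {..<n}"
      show "x j \<odot>\<^bsub>free_mod R n\<^esub> w j = x j \<odot>\<^bsub>free_mod R n\<^esub> unitv R n j"
      proof (cases "j \<in> J")
        case False
        then have "x j = \<zero>" using x j by (auto simp: supported_def)
        moreover have wj: "w j \<in> carrier (free_mod R n)" using w(1) sc by blast
        ultimately show ?thesis
          using V.smult_l_null[OF wj] V.smult_l_null[OF unitv_closed, of j]
          by (simp del: free_mod_simps V.smult_l_null)
      qed (simp add: w(3))
    qed simp
    also have "\<dots> = x" by (rule free_mod_expand[OF xc, symmetric])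
    finally show ?thesis .
  qed
  have f: "lin_map R (free_mod R m) (free_mod R n) (\<lambda>v. b (d v))" by (rule lin_map_comp[OF d b])
  \<comment> \<open>The image of b after d is the kernel K of e on J-supported vectors. Minimality
    of J puts K into \<nn> A^n, the criterion then yields K = \<nn> K, and Nakayama's lemma gives K
    = 0.\<close>
  have f0: "b (d v) = \<zero>\<^bsub>free_mod R n\<^esub>" if v: "v \<in> carrier (free_mod R m)" for v
  proof (rule nakayama[OF free_mod_module f _ v])
    fix v assume v: "v \<in> carrier (free_mod R m)"
    have dv: "d v \<in> carrier (free_mod R n)" by (rule lin_map_closed[OF d v])
    have bc: "b (d v) \<in> carrier (free_mod R n)" by (rule lin_map_closed[OF b dv])
    have "e (d v) = \<zero>\<^bsub>M\<^esub>" using ker[OF dv] v by blast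
    then have eb0: "e (b (d v)) = \<zero>\<^bsub>M\<^esub>" using eb[OF dv] by simp
    then obtain u where u: "u \<in> carrier (free_mod R m)" "b (d v) = d u" using ker[OF bc] by blast
    obtain u' where u': "u' \<in> {..<m} \<rightarrow>\<^sub>E \<nn>" "d u' = d u"
      using crit[OF u(1)] mn[OF bs[OF dv] eb0] u(2) by metis
    have "b (d u') = b (d v)" using u'(2) u(2) bid[OF bs[OF dv]] by simp
    then show "\<exists>w\<in>{..<m} \<rightarrow>\<^sub>E \<nn>. b (d w) = b (d v)" using u'(1) by blast
  qed
  have inj: "x = \<zero>\<^bsub>free_mod R n\<^esub>" if x: "x \<in> supported J n" and ex: "e x = \<zero>\<^bsub>M\<^esub>" for x
  proof -
    obtain v where "v \<in> carrier (free_mod R m)" "x = d v" using ker[of x] x sc ex by blast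
    then show ?thesis using f0[of v] bid[OF x] by simp
  qed
  define h where "h j = e (unitv R n j)" for j
  have hc: "h j \<in> carrier M" for j unfolding h_def by (rule lin_map_closed[OF e unitv_closed])
  have injh: "inj_on h J"
  proof (rule inj_onI)
    fix i j assume ij: "i \<in> J" "j \<in> J" "h i = h j"
    let ?x = "unitv R n i \<ominus>\<^bsub>free_mod R n\<^esub> unitv R n j"
    have "?x \<in> supported J n" using ij by (intro supported_minus unitv_supported)
    moreover have "e ?x = \<zero>\<^bsub>M\<^esub>"
      unfolding lin_map_minus[OF free_mod_module M e unitv_closed unitv_closed]
      using ij(3) hc[of j] unfolding h_def by (simp add: a_minus_def M.M.r_neg)
    ultimately have "?x = \<zero>\<^bsub>free_mod R n\<^esub>" by (rule inj)
    then have "?x i = \<zero>" using ij(1) J by auto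
    then have "unitv R n i i \<ominus> unitv R n j i = \<zero>"
      using free_mod_minus_coord[OF unitv_closed unitv_closed] ij(1) J by auto
    then show "i = j"
      using ij J one_notin nn.zero_closed by (auto simp: unitv_def a_minus_def split: if_splits)
  qed
  \<comment> \<open>A basis is a set of elements of M, so coefficients are indexed by elements;
    injectivity of \<open>h\<close> on J lets \<open>vec\<close> turn them into coordinates.\<close>
  define vec where "vec F a = (\<lambda>i\<in>{..<n}. if i \<in> J \<and> h i \<in> F then a (h i) else \<zero>)" for F a
  have vec: "vec F a \<in> supported J n" if "a \<in> F \<rightarrow> carrier R" for F a
    using that unfolding vec_def supported_def by (auto simp: Pi_iff)
  have sum: "(\<Oplus>\<^bsub>M\<^esub>b\<in>F. a b \<odot>\<^bsub>M\<^esub> b) = e (vec F a)"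
    if F: "F \<subseteq> h ` J" and a: "a \<in> F \<rightarrow> carrier R" for F a
  proof -
    define K where "K = {j\<in>J. h j \<in> F}"
    have FK: "F = h ` K" using F unfolding K_def by auto
    have injK: "inj_on h K" using injh unfolding K_def by (auto simp: inj_on_def)
    have KJ: "K \<subseteq> {..<n}" using J unfolding K_def by auto
    have finK: "finite K" using KJ by (rule finite_subset) simp
    have vc: "vec F a \<in> carrier (free_mod R n)" using vec[OF a] sc by blast
    have "(\<Oplus>\<^bsub>M\<^esub>b\<in>F. a b \<odot>\<^bsub>M\<^esub> b) = (\<Oplus>\<^bsub>M\<^esub>j\<in>K. a (h j) \<odot>\<^bsub>M\<^esub> h j)"
      unfolding FK using a hc injK by (intro M.M.add.finprod_reindex) (auto simp: FK)
    also have "\<dots> = (\<Oplus>\<^bsub>M\<^esub>j\<in>{..<n}. vec F a j \<odot>\<^bsub>M\<^esub> h j)"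
      using KJ finK hc a
      by (intro M.M.add.finprod_mono_neutral_cong) (auto simp: vec_def K_def Pi_iff)
    also have "\<dots> = e (vec F a)"
      unfolding lin_map_lincomb[OF M e vc] lincomb_def h_def ..
    finally show ?thesis .
  qed
  have "is_basis R M (h ` J)"
    unfolding is_basis_def
  proof (intro conjI ballI allI impI)
    show "h ` J \<subseteq> carrier M" using hc by auto
  next
    fix x assume "x \<in> carrier M"
    then obtain v where v: "v \<in> carrier (free_mod R n)" "x = e v" using surj by blast
    obtain u where u: "u \<in> supported J n" "e u = x" using sp[OF v(1)] v(2) by blast
    define a where "a y = u (inv_into J h y)" for y
    have ah: "a (h j) = u j" if "j \<in> J" for j unfolding a_def using that injh by simp
    have ac: "a \<in> h ` J \<rightarrow> carrier R" using u J by (auto simp: ah supported_def PiE_iff)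
    have "vec (h ` J) a = u" using u(1) unfolding vec_def
      by (auto simp: ah supported_def PiE_iff extensional_def fun_eq_iff)
    then have "x = (\<Oplus>\<^bsub>M\<^esub>b\<in>h ` J. a b \<odot>\<^bsub>M\<^esub> b)" using sum[OF _ ac] u(2) by simp
    moreover have "finite (h ` J)" using J by (auto intro: finite_subset)
    ultimately show "\<exists>F\<subseteq>h ` J. finite F \<and> (\<exists>a\<in>F \<rightarrow> carrier R. x = (\<Oplus>\<^bsub>M\<^esub>b\<in>F. a b \<odot>\<^bsub>M\<^esub> b))"
      using ac by blast
  next
    fix F a y assume F: "F \<subseteq> h ` J" and a: "a \<in> F \<rightarrow> carrier R"
      and 0: "(\<Oplus>\<^bsub>M\<^esub>b\<in>F. a b \<odot>\<^bsub>M\<^esub> b) = \<zero>\<^bsub>M\<^esub>" and y: "y \<in> F"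
    obtain j where j: "j \<in> J" "y = h j" using F y by blast
    have "vec F a = \<zero>\<^bsub>free_mod R n\<^esub>" using inj[OF vec[OF a]] sum[OF F a] 0 by simp
    then have "vec F a j = \<zero>" using j J by auto
    then show "a y = \<zero>" using j y J by (auto simp: vec_def)
  qed
  then show ?thesis unfolding free_module_def by blast
qed

end

lemma (in abelian_group) diff_zero: "x \<in> carrier G \<Longrightarrow> x \<ominus> \<zero> = x"
  unfolding a_minus_def by simp

section \<open>Vanishing of Tor in terms of linear maps\<close>

text \<open>For \<open>d : A\<^sup>q \<rightarrow> A\<^sup>p\<close> let \<open>X\<close> be the cokernel of the dual map \<open>Hom(A\<^sup>p, A) \<rightarrow> Hom(A\<^sup>q, A)\<close>. Then
  \<open>A\<^sup>b \<otimes> X\<close> is the cokernel of \<open>Hom(A\<^sup>p, A\<^sup>b) \<rightarrow> Hom(A\<^sup>q, A\<^sup>b)\<close>, and the predicate below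
  expresses exactness of \<open>A\<^sup>c \<otimes> X \<rightarrow> A\<^sup>b \<otimes> X \<rightarrow> A\<^sup>a \<otimes> X\<close>.\<close>

definition tor_exact where
  "tor_exact A p q d a b c e e' \<longleftrightarrow>
    (\<forall>v w. lin_map A (free_mod A q) (free_mod A b) v \<longrightarrow> lin_map A (free_mod A p) (free_mod A a) w \<longrightarrow>
      (\<forall>x\<in>carrier (free_mod A q). e (v x) = w (d x)) \<longrightarrow>
      (\<exists>w' u. lin_map A (free_mod A p) (free_mod A b) w' \<and> lin_map A (free_mod A q) (free_mod A c) u \<and>
        (\<forall>x\<in>carrier (free_mod A q). v x = w' (d x) \<oplus>\<^bsub>free_mod A b\<^esub> e' (u x))))"

definition exact_at where
  "exact_at L M N f g \<longleftrightarrow> (\<forall>y\<in>carrier M. g y = \<zero>\<^bsub>N\<^esub> \<longleftrightarrow> y \<in> f ` carrier L)"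

lemma exact_atD1: "exact_at L M N f g \<Longrightarrow> f \<in> carrier L \<rightarrow> carrier M \<Longrightarrow> x \<in> carrier L \<Longrightarrow> g (f x) = \<zero>\<^bsub>N\<^esub>"
  unfolding exact_at_def by blast

lemma exact_atD2: "exact_at L M N f g \<Longrightarrow> y \<in> carrier M \<Longrightarrow> g y = \<zero>\<^bsub>N\<^esub> \<Longrightarrow> y \<in> f ` carrier L"
  unfolding exact_at_def by blast

text \<open>Tor_1 of N against the transpose X is the group of maps to N from the cokernel of d1
  (the first syzygy of M in the application) modulo the maps that factor through a free module. By
  \<open>ext\<close> every such map factors through A^r, so the group vanishes. The proof carries
  this out on lifts to the resolution of N.\<close>

lemma (in cring) tor_exact_if_ext_zero:
  assumes d0: "lin_map R (free_mod R p) (free_mod R r) d0"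
    and d1: "lin_map R (free_mod R q) (free_mod R p) d1"
    and dd: "\<And>x. x \<in> carrier (free_mod R q) \<Longrightarrow> d0 (d1 x) = \<zero>\<^bsub>free_mod R r\<^esub>"
    and N: "module R N"
    and e: "lin_map R (free_mod R a) N e" "e ` carrier (free_mod R a) = carrier N"
    and e0: "lin_map R (free_mod R b) (free_mod R a) e0"
    and e1: "lin_map R (free_mod R c) (free_mod R b) e1"
    and ex: "exact_at (free_mod R b) (free_mod R a) N e0 e"
      "exact_at (free_mod R c) (free_mod R b) (free_mod R a) e1 e0"
    and ext: "\<And>f. lin_map R (free_mod R p) N f \<Longrightarrow>
      (\<And>x. x \<in> carrier (free_mod R q) \<Longrightarrow> f (d1 x) = \<zero>\<^bsub>N\<^esub>) \<Longrightarrow>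
      \<exists>g. lin_map R (free_mod R r) N g \<and> (\<forall>x\<in>carrier (free_mod R p). f x = g (d0 x))"
  shows "tor_exact R p q d1 a b c e0 e1"
  unfolding tor_exact_def
proof (intro allI impI)
  note fm = free_mod_module
  interpret N: module R N by fact
  interpret A: module R "free_mod R a" by (rule fm)
  interpret B: module R "free_mod R b" by (rule fm)
  fix v w
  assume v: "lin_map R (free_mod R q) (free_mod R b) v" and w: "lin_map R (free_mod R p) (free_mod R a) w"
    and vw: "\<forall>x\<in>carrier (free_mod R q). e0 (v x) = w (d1 x)"
  have vc: "v x \<in> carrier (free_mod R b)" if "x \<in> carrier (free_mod R q)" for x
    using lin_map_closed[OF v that] .
  have d1c: "d1 x \<in> carrier (free_mod R p)" if "x \<in> carrier (free_mod R q)" for x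
    using lin_map_closed[OF d1 that] .
  \<comment> \<open>A cycle of degree one comes with \<open>w\<close>, and e after w vanishes on the
    image of d1: it is a cocycle with values in N.\<close>
  have "e (w (d1 x)) = \<zero>\<^bsub>N\<^esub>" if x: "x \<in> carrier (free_mod R q)" for x
    using exact_atD1[OF ex(1) _ vc[OF x]] vw x e0 unfolding lin_map_def by auto
  then obtain g where g: "lin_map R (free_mod R r) N g"
    and wg: "\<And>x. x \<in> carrier (free_mod R p) \<Longrightarrow> e (w x) = g (d0 x)"
    using ext[OF lin_map_comp[OF w e(1)]] by blast
  \<comment> \<open>Subtracting u after d0 leaves the values of w on the image of d1 unchanged,
    since d0 d1 = 0, but moves w into the kernel of e, so that it lifts through e0.\<close>
  obtain u where u: "lin_map R (free_mod R r) (free_mod R a) u"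
    and eu: "\<And>x. x \<in> carrier (free_mod R r) \<Longrightarrow> e (u x) = g x"
    using free_mod_lift[OF fm N g e(1)] e(2) lin_map_closed[OF g] by metis
  have ud: "lin_map R (free_mod R p) (free_mod R a) (\<lambda>x. u (d0 x))" by (rule lin_map_comp[OF d0 u])
  have wud: "lin_map R (free_mod R p) (free_mod R a) (\<lambda>x. w x \<ominus>\<^bsub>free_mod R a\<^esub> u (d0 x))"
    by (rule lin_map_diff[OF fm fm w ud])
  have "w x \<ominus>\<^bsub>free_mod R a\<^esub> u (d0 x) \<in> e0 ` carrier (free_mod R b)" if x: "x \<in> carrier (free_mod R p)" for x
  proof (rule exact_atD2[OF ex(1) lin_map_closed[OF wud x]])
    show "e (w x \<ominus>\<^bsub>free_mod R a\<^esub> u (d0 x)) = \<zero>\<^bsub>N\<^esub>"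
      unfolding lin_map_minus[OF fm N e(1) lin_map_closed[OF w x] lin_map_closed[OF ud x]]
        wg[OF x] eu[OF lin_map_closed[OF d0 x]]
      using lin_map_closed[OF g lin_map_closed[OF d0 x]] by (simp add: a_minus_def N.M.r_neg)
  qed
  then obtain z where z: "lin_map R (free_mod R p) (free_mod R b) z"
    and ez: "\<And>x. x \<in> carrier (free_mod R p) \<Longrightarrow> e0 (z x) = w x \<ominus>\<^bsub>free_mod R a\<^esub> u (d0 x)"
    using free_mod_lift[OF fm fm wud e0] by metis
  have zd: "lin_map R (free_mod R q) (free_mod R b) (\<lambda>x. z (d1 x))" by (rule lin_map_comp[OF d1 z])
  have vzd: "lin_map R (free_mod R q) (free_mod R b) (\<lambda>x. v x \<ominus>\<^bsub>free_mod R b\<^esub> z (d1 x))"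
    by (rule lin_map_diff[OF fm fm v zd])
  have "v x \<ominus>\<^bsub>free_mod R b\<^esub> z (d1 x) \<in> e1 ` carrier (free_mod R c)" if x: "x \<in> carrier (free_mod R q)" for x
  proof (rule exact_atD2[OF ex(2) lin_map_closed[OF vzd x]])
    have "e0 (z (d1 x)) = w (d1 x)"
      unfolding ez[OF d1c[OF x]] dd[OF x] lin_map_zero[OF fm fm u]
      by (rule A.M.diff_zero[OF lin_map_closed[OF w d1c[OF x]]])
    then show "e0 (v x \<ominus>\<^bsub>free_mod R b\<^esub> z (d1 x)) = \<zero>\<^bsub>free_mod R a\<^esub>"
      unfolding lin_map_minus[OF fm fm e0 vc[OF x] lin_map_closed[OF zd x]]
      using vw x lin_map_closed[OF w d1c[OF x]] A.M.r_neg unfolding a_minus_def by simp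
  qed
  then obtain y where y: "lin_map R (free_mod R q) (free_mod R c) y"
    and ey: "\<And>x. x \<in> carrier (free_mod R q) \<Longrightarrow> e1 (y x) = v x \<ominus>\<^bsub>free_mod R b\<^esub> z (d1 x)"
    using free_mod_lift[OF fm fm vzd e1] by metis
  have "v x = z (d1 x) \<oplus>\<^bsub>free_mod R b\<^esub> e1 (y x)" if x: "x \<in> carrier (free_mod R q)" for x
  proof -
    have "z (d1 x) \<oplus>\<^bsub>free_mod R b\<^esub> (v x \<oplus>\<^bsub>free_mod R b\<^esub> \<ominus>\<^bsub>free_mod R b\<^esub> z (d1 x)) = v x"
      using vc[OF x] lin_map_closed[OF zd x]
      by (metis B.M.a_comm B.M.a_inv_closed B.M.add.m_assoc B.M.l_neg B.M.r_zero)
    then show ?thesis unfolding ey[OF x] a_minus_def by (rule sym)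
  qed
  then show "\<exists>w' u. lin_map R (free_mod R p) (free_mod R b) w' \<and> lin_map R (free_mod R q) (free_mod R c) u \<and>
        (\<forall>x\<in>carrier (free_mod R q). v x = w' (d1 x) \<oplus>\<^bsub>free_mod R b\<^esub> e1 (u x))"
    using y z by blast
qed

section \<open>Local rings with a split socle element\<close>

text \<open>The abstract shape of \<open>R \<ltimes> k\<close>, with \<open>s = (0, 1)\<close> and \<open>P = \<mm> \<times> 0\<close>.\<close>

locale split_socle_ring = local_cring R \<nn> + P: ideal P R
  for R (structure) and \<nn> and P +
  fixes s
  assumes s_closed: "s \<in> carrier R" and s_nonzero: "s \<noteq> \<zero>"
    and s_nn: "a \<in> \<nn> \<Longrightarrow> s \<otimes> a = \<zero>"
    and nn_split: "a \<in> \<nn> \<Longrightarrow> \<exists>p\<in>P. \<exists>c\<in>carrier R. a = p \<oplus> s \<otimes> c"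
    and P_s: "a \<in> carrier R \<Longrightarrow> s \<otimes> a \<in> P \<Longrightarrow> s \<otimes> a = \<zero>"
begin

lemma ann_s: "a \<in> carrier R \<Longrightarrow> s \<otimes> a = \<zero> \<Longrightarrow> a \<in> \<nn>"
  by (metis Units_if_notin Units_closed Units_inv_closed Units_r_inv l_null m_assoc r_one s_closed s_nonzero)

text \<open>The annihilator of s is exactly \<nn>. Multiplication by s therefore detects vanishing
  modulo \<nn>, and reductions to the residue field can be treated inside the free modules.\<close>

lemma smult_s_zero_iff:
  assumes "v \<in> carrier (free_mod R n)"
  shows "s \<odot>\<^bsub>free_mod R n\<^esub> v = \<zero>\<^bsub>free_mod R n\<^esub> \<longleftrightarrow> v \<in> {..<n} \<rightarrow>\<^sub>E \<nn>"
proof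
  assume 0: "s \<odot>\<^bsub>free_mod R n\<^esub> v = \<zero>\<^bsub>free_mod R n\<^esub>"
  have "v i \<in> \<nn>" if i: "i < n" for i
  proof (rule ann_s)
    show "v i \<in> carrier R" using assms i by auto
    show "s \<otimes> v i = \<zero>" using fun_cong[OF 0, of i] i by simp
  qed
  then show "v \<in> {..<n} \<rightarrow>\<^sub>E \<nn>" using assms by (auto simp: PiE_iff)
next
  assume v: "v \<in> {..<n} \<rightarrow>\<^sub>E \<nn>"
  have "s \<otimes> v i = \<zero>" if "i < n" for i using v that by (intro s_nn) auto
  then show "s \<odot>\<^bsub>free_mod R n\<^esub> v = \<zero>\<^bsub>free_mod R n\<^esub>" by (auto simp: fun_eq_iff)
qed

lemma nn_vector_split:
  assumes "x \<in> {..<n} \<rightarrow>\<^sub>E \<nn>"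
  obtains p c where "p \<in> {..<n} \<rightarrow>\<^sub>E P" "c \<in> carrier (free_mod R n)"
    "x = p \<oplus>\<^bsub>free_mod R n\<^esub> s \<odot>\<^bsub>free_mod R n\<^esub> c"
proof -
  have "\<exists>p c. p \<in> P \<and> c \<in> carrier R \<and> x i = p \<oplus> s \<otimes> c" if "i < n" for i
    using nn_split[of "x i"] assms that by (meson PiE_mem lessThan_iff)
  then obtain p c where pc: "\<And>i. i < n \<Longrightarrow> p i \<in> P \<and> c i \<in> carrier R \<and> x i = p i \<oplus> s \<otimes> c i" by metis
  show ?thesis
  proof (rule that[of "restrict p {..<n}" "restrict c {..<n}"])
    show "x = restrict p {..<n} \<oplus>\<^bsub>free_mod R n\<^esub> s \<odot>\<^bsub>free_mod R n\<^esub> restrict c {..<n}"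
      using pc assms by (auto simp: fun_eq_iff PiE_iff extensional_def)
  qed (use pc in auto)
qed

text \<open>If \<open>x\<close> witnesses \<open>Tor\<^sub>1(M, k) \<noteq> 0\<close>, then the second syzygy of the module \<open>X\<close> belonging to \<open>d1\<close>
  splits off a copy of \<open>k\<close>, which transports \<open>Tor\<^sub>3(N, X) = 0\<close> to \<open>Tor\<^sub>1(N, k) = 0\<close>.\<close>

lemma tor_residue_zero:
  assumes d0: "lin_map R (free_mod R p) (free_mod R r) d0"
    and d1: "lin_map R (free_mod R q) (free_mod R p) d1"
    and exd: "exact_at (free_mod R q) (free_mod R p) (free_mod R r) d1 d0"
    and e0: "lin_map R (free_mod R g1) (free_mod R g0) e0"
    and e1: "lin_map R (free_mod R g2) (free_mod R g1) e1"
    and e2: "lin_map R (free_mod R g3) (free_mod R g2) e2"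
    and e3: "lin_map R (free_mod R g4) (free_mod R g3) e3"
    and ex1: "exact_at (free_mod R g2) (free_mod R g1) (free_mod R g0) e1 e0"
    and ex2: "exact_at (free_mod R g3) (free_mod R g2) (free_mod R g1) e2 e1"
    and ex3: "exact_at (free_mod R g4) (free_mod R g3) (free_mod R g2) e3 e2"
    and tor3: "tor_exact R p q d1 g2 g3 g4 e2 e3"
    and x: "x \<in> carrier (free_mod R p)" "d0 x \<in> {..<r} \<rightarrow>\<^sub>E \<nn>"
    and xn: "\<And>w. w \<in> {..<p} \<rightarrow>\<^sub>E \<nn> \<Longrightarrow> d0 w \<noteq> d0 x"
    and v: "v \<in> carrier (free_mod R g1)" "e0 v \<in> {..<g0} \<rightarrow>\<^sub>E \<nn>"
  shows "\<exists>w \<in> {..<g1} \<rightarrow>\<^sub>E \<nn>. e0 w = e0 v"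
proof -
  note fm = free_mod_module
  interpret G0: module R "free_mod R g0" by (rule fm)
  interpret G1: module R "free_mod R g1" by (rule fm)
  interpret G2: module R "free_mod R g2" by (rule fm)
  interpret G3: module R "free_mod R g3" by (rule fm)
  interpret F0: module R "free_mod R r" by (rule fm)
  interpret F1: module R "free_mod R p" by (rule fm)
  interpret F2: module R "free_mod R q" by (rule fm)
  have d1c: "d1 z \<in> carrier (free_mod R p)" if "z \<in> carrier (free_mod R q)" for z
    by (rule lin_map_closed[OF d1 that])
  \<comment> \<open>If x were congruent to \<open>d1 z\<close> modulo \<nn>, then
    \<open>x - d1 z\<close> would have entries in \<nn> and the same image as x under d0, against
    \<open>xn\<close>. So x can be separated from the image of d1.\<close>
  have "x \<ominus>\<^bsub>free_mod R p\<^esub> d1 z \<notin> {..<p} \<rightarrow>\<^sub>E \<nn>" if z: "z \<in> carrier (free_mod R q)" for z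
  proof
    assume n: "x \<ominus>\<^bsub>free_mod R p\<^esub> d1 z \<in> {..<p} \<rightarrow>\<^sub>E \<nn>"
    have "d0 (d1 z) = \<zero>\<^bsub>free_mod R r\<^esub>" using exact_atD1[OF exd _ z] d1c by blast
    then have "d0 (x \<ominus>\<^bsub>free_mod R p\<^esub> d1 z) = d0 x"
      unfolding lin_map_minus[OF fm fm d0 x(1) d1c[OF z]]
      using F0.M.diff_zero[OF lin_map_closed[OF d0 x(1)]] by simp
    then show False using xn[OF n] by simp
  qed
  then obtain \<zeta> where \<zeta>: "lin_map R (free_mod R p) (reg_mod R) \<zeta>" and \<zeta>x: "\<zeta> x = \<one>"
    and \<zeta>d: "\<And>z. z \<in> carrier (free_mod R q) \<Longrightarrow> \<zeta> (d1 z) \<in> \<nn>"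
    using separating_functional[OF subset_refl d1 x(1)] by blast
  have sv: "s \<odot>\<^bsub>free_mod R g1\<^esub> v \<in> carrier (free_mod R g1)" by (rule G1.smult_closed[OF s_closed v(1)])
  have "e0 (s \<odot>\<^bsub>free_mod R g1\<^esub> v) = \<zero>\<^bsub>free_mod R g0\<^esub>"
    unfolding lin_map_smult[OF e0 s_closed v(1)] smult_s_zero_iff[OF lin_map_closed[OF e0 v(1)]] by (rule v(2))
  then obtain y where y: "y \<in> carrier (free_mod R g2)" and ey: "s \<odot>\<^bsub>free_mod R g1\<^esub> v = e1 y"
    using exact_atD2[OF ex1 sv] by blast
  \<comment> \<open>\<open>k\<close> is y tensored with \<zeta>. Composed with e1 it becomes v
    tensored with the functional s \<zeta>, which vanishes on the image of d1. Hence k after d1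
    lifts through e2, and the lift \<open>w\<close> is a cycle of degree three with coefficients in
    X.\<close>
  define k where "k z = \<zeta> z \<odot>\<^bsub>free_mod R g2\<^esub> y" for z
  have k: "lin_map R (free_mod R p) (free_mod R g2) k"
    unfolding k_def by (rule lin_map_functional_smult[OF fm fm \<zeta> y])
  have e1k: "e1 (k z) = \<zeta> z \<odot>\<^bsub>free_mod R g1\<^esub> (s \<odot>\<^bsub>free_mod R g1\<^esub> v)" if z: "z \<in> carrier (free_mod R p)" for z
    unfolding k_def ey using lin_map_closed[OF \<zeta> z] by (intro lin_map_smult[OF e1 _ y]) simp
  have kd: "lin_map R (free_mod R q) (free_mod R g2) (\<lambda>z. k (d1 z))" by (rule lin_map_comp[OF d1 k])
  have "k (d1 z) \<in> e2 ` carrier (free_mod R g3)" if z: "z \<in> carrier (free_mod R q)" for z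
  proof (rule exact_atD2[OF ex2 lin_map_closed[OF kd z]])
    have "\<zeta> (d1 z) \<otimes> s = \<zero>" using s_nn[OF \<zeta>d[OF z]] nn.Icarr[OF \<zeta>d[OF z]] s_closed m_comm by metis
    then show "e1 (k (d1 z)) = \<zero>\<^bsub>free_mod R g1\<^esub>"
      using e1k[OF d1c[OF z]] G1.smult_assoc1[OF nn.Icarr[OF \<zeta>d[OF z]] s_closed v(1)]
        G1.smult_l_null[OF v(1)] by simp
  qed
  then obtain w where w: "lin_map R (free_mod R q) (free_mod R g3) w"
    and ew: "\<And>z. z \<in> carrier (free_mod R q) \<Longrightarrow> e2 (w z) = k (d1 z)"
    using free_mod_lift[OF fm fm kd e2] by metis
  obtain t u where t: "lin_map R (free_mod R p) (free_mod R g3) t"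
    and u: "lin_map R (free_mod R q) (free_mod R g4) u"
    and wtu: "\<And>z. z \<in> carrier (free_mod R q) \<Longrightarrow> w z = t (d1 z) \<oplus>\<^bsub>free_mod R g3\<^esub> e3 (u z)"
    using tor3[unfolded tor_exact_def, rule_format, OF w k ew] by blast
  have et: "lin_map R (free_mod R p) (free_mod R g2) (\<lambda>z. e2 (t z))" by (rule lin_map_comp[OF t e2])
  \<comment> \<open>Removing the part that comes from the boundary makes k vanish on the image of
    d1, and composition with e1 does not notice the change because e1 e2 = 0.\<close>
  define h where "h z = k z \<ominus>\<^bsub>free_mod R g2\<^esub> e2 (t z)" for z
  have h: "lin_map R (free_mod R p) (free_mod R g2) h"
    unfolding h_def by (rule lin_map_diff[OF fm fm k et])
  have hd: "h (d1 z) = \<zero>\<^bsub>free_mod R g2\<^esub>" if z: "z \<in> carrier (free_mod R q)" for z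
  proof -
    have uz: "u z \<in> carrier (free_mod R g4)" by (rule lin_map_closed[OF u z])
    have e30: "e2 (e3 (u z)) = \<zero>\<^bsub>free_mod R g2\<^esub>"
      using exact_atD1[OF ex3 _ uz] lin_map_closed[OF e3] by blast
    have etz: "e2 (t (d1 z)) \<in> carrier (free_mod R g2)" by (rule lin_map_closed[OF et d1c[OF z]])
    have "k (d1 z) = e2 (t (d1 z))"
      unfolding ew[OF z, symmetric] wtu[OF z]
        lin_map_add[OF e2 lin_map_closed[OF t d1c[OF z]] lin_map_closed[OF e3 uz]] e30
      by (rule G2.M.r_zero[OF etz])
    then show ?thesis unfolding h_def a_minus_def using G2.M.r_neg[OF etz] by simp
  qed
  \<comment> \<open>\<open>s x\<close> lies in the kernel of d0, hence in the image of d1, where h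
    vanishes. So s kills \<open>h x\<close>, whose entries are therefore in \<nn>.\<close>
  have sx: "s \<odot>\<^bsub>free_mod R p\<^esub> x \<in> carrier (free_mod R p)" by (rule F1.smult_closed[OF s_closed x(1)])
  have hx: "h x \<in> carrier (free_mod R g2)" by (rule lin_map_closed[OF h x(1)])
  have "d0 (s \<odot>\<^bsub>free_mod R p\<^esub> x) = \<zero>\<^bsub>free_mod R r\<^esub>"
    unfolding lin_map_smult[OF d0 s_closed x(1)] smult_s_zero_iff[OF lin_map_closed[OF d0 x(1)]] by (rule x(2))
  then have "s \<odot>\<^bsub>free_mod R p\<^esub> x \<in> d1 ` carrier (free_mod R q)" by (rule exact_atD2[OF exd sx])
  then have "h (s \<odot>\<^bsub>free_mod R p\<^esub> x) = \<zero>\<^bsub>free_mod R g2\<^esub>" by (metis hd imageE)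
  then have hxn: "h x \<in> {..<g2} \<rightarrow>\<^sub>E \<nn>"
    unfolding lin_map_smult[OF h s_closed x(1)] smult_s_zero_iff[OF hx] .
  have tx: "t x \<in> carrier (free_mod R g3)" by (rule lin_map_closed[OF t x(1)])
  have "e1 (e2 (t x)) = \<zero>\<^bsub>free_mod R g1\<^esub>"
    using exact_atD1[OF ex2 _ tx] lin_map_closed[OF e2] by blast
  then have "e1 (h x) = e1 (k x) \<ominus>\<^bsub>free_mod R g1\<^esub> \<zero>\<^bsub>free_mod R g1\<^esub>"
    unfolding h_def
      lin_map_minus[OF fm fm e1 lin_map_closed[OF k x(1)] lin_map_closed[OF et x(1)]] by simp
  then have "e1 (h x) = e1 (k x)"
    using G1.M.diff_zero[OF lin_map_closed[OF e1 lin_map_closed[OF k x(1)]]] by simp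
  then have e1h: "e1 (h x) = s \<odot>\<^bsub>free_mod R g1\<^esub> v" using e1k[OF x(1)] G1.smult_one[OF sv] \<zeta>x by simp
  obtain a c where a: "a \<in> {..<g2} \<rightarrow>\<^sub>E P" and c: "c \<in> carrier (free_mod R g2)"
    and hac: "h x = a \<oplus>\<^bsub>free_mod R g2\<^esub> s \<odot>\<^bsub>free_mod R g2\<^esub> c" using nn_vector_split[OF hxn] by blast
  have ac: "a \<in> carrier (free_mod R g2)"
    using a P.a_subset PiE_mono[of "{..<g2}" "\<lambda>_. P" "\<lambda>_. carrier R"] by auto
  have ea: "e1 a \<in> {..<g1} \<rightarrow>\<^sub>E P" by (rule lin_map_ideal[OF P.ideal_axioms e1 a])
  have eac: "e1 a \<in> carrier (free_mod R g1)" by (rule lin_map_closed[OF e1 ac])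
  have ec: "e1 c \<in> carrier (free_mod R g1)" by (rule lin_map_closed[OF e1 c])
  have eq: "s \<odot>\<^bsub>free_mod R g1\<^esub> v = e1 a \<oplus>\<^bsub>free_mod R g1\<^esub> s \<odot>\<^bsub>free_mod R g1\<^esub> e1 c"
    unfolding e1h[symmetric] hac lin_map_add[OF e1 ac G2.smult_closed[OF s_closed c]]
      lin_map_smult[OF e1 s_closed c] ..
  \<comment> \<open>The equation \<open>eq\<close> says that s (v - e1 c) equals e1 a. This vector
    has entries both in P and in the multiples of s, so it is zero, and v - e1 c has entries in the
    annihilator \<nn> of s.\<close>
  define w' where "w' = v \<ominus>\<^bsub>free_mod R g1\<^esub> e1 c"
  have w'c: "w' \<in> carrier (free_mod R g1)" unfolding w'_def by (rule G1.M.minus_closed[OF v(1) ec])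
  have "w' i \<in> \<nn>" if i: "i < g1" for i
  proof (rule ann_s)
    show "w' i \<in> carrier R" using w'c i by auto
    have cs: "v i \<in> carrier R" "e1 c i \<in> carrier R" "e1 a i \<in> carrier R" using v(1) ec eac i by auto
    have "s \<otimes> v i = e1 a i \<oplus> s \<otimes> e1 c i" using fun_cong[OF eq, of i] i by simp
    moreover have "s \<otimes> (v i \<ominus> e1 c i) = s \<otimes> v i \<ominus> s \<otimes> e1 c i" using cs s_closed by algebra
    moreover have "(e1 a i \<oplus> s \<otimes> e1 c i) \<ominus> s \<otimes> e1 c i = e1 a i" using cs s_closed by algebra
    ultimately have "s \<otimes> w' i = e1 a i" unfolding w'_def free_mod_minus_coord[OF v(1) ec i] by simp
    moreover have "e1 a i \<in> P" using ea i by auto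
    ultimately show "s \<otimes> w' i = \<zero>" using P_s[OF \<open>w' i \<in> carrier R\<close>] by simp
  qed
  then have "w' \<in> {..<g1} \<rightarrow>\<^sub>E \<nn>" using w'c by (auto simp: PiE_iff)
  moreover have "e0 w' = e0 v"
  proof -
    have "e0 (e1 c) = \<zero>\<^bsub>free_mod R g0\<^esub>" using exact_atD1[OF ex1 _ c] lin_map_closed[OF e1] by blast
    then show ?thesis unfolding w'_def lin_map_minus[OF fm fm e0 v(1) ec]
      using G0.M.diff_zero[OF lin_map_closed[OF e0 v(1)]] by simp
  qed
  ultimately show ?thesis by blast
qed

end

section \<open>Existence of free resolutions\<close>

context module
begin

lemma submodule_zero: "submodule W R M \<Longrightarrow> \<zero>\<^bsub>M\<^esub> \<in> W"
  unfolding submodule_def using subgroup.one_closed by fastforce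

lemma submodule_minus:
  "submodule W R M \<Longrightarrow> x \<in> W \<Longrightarrow> y \<in> W \<Longrightarrow> x \<ominus>\<^bsub>M\<^esub> y \<in> W"
  unfolding a_minus_def by (simp add: submoduleE(3,5))

lemma submodule_Int: "submodule U R M \<Longrightarrow> submodule W R M \<Longrightarrow> submodule (U \<inter> W) R M"
  by (rule submoduleI) (simp_all add: submoduleE(3-5) submodule_zero le_infI1 submoduleE(1))

lemma lin_map_image_submodule:
  assumes "module R L" "lin_map R L M f"
  shows "submodule (f ` carrier L) R M"
proof -
  interpret L: module R L by fact
  show ?thesis
  proof (rule submoduleI)
    show "f ` carrier L \<subseteq> carrier M" using lin_map_closed[OF assms(2)] by auto
    show "\<zero>\<^bsub>M\<^esub> \<in> f ` carrier L"
      using lin_map_zero[OF assms(1) module_axioms assms(2)] by (metis L.M.zero_closed imageI)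
    show "\<ominus>\<^bsub>M\<^esub> a \<in> f ` carrier L" if a: "a \<in> f ` carrier L" for a
    proof -
      obtain x where x: "x \<in> carrier L" "a = f x" using a by blast
      then show ?thesis
        using lin_map_neg[OF assms(1) module_axioms assms(2) x(1)] imageI[of "\<ominus>\<^bsub>L\<^esub> x" "carrier L" f] by simp
    qed
    show "a \<oplus>\<^bsub>M\<^esub> b \<in> f ` carrier L" if ab: "a \<in> f ` carrier L" "b \<in> f ` carrier L" for a b
    proof -
      obtain x y where "x \<in> carrier L" "y \<in> carrier L" "a = f x" "b = f y" using ab by blast
      then show ?thesis using lin_map_add[OF assms(2), of x y] by (metis L.M.a_closed imageI)
    qed
    show "a \<odot>\<^bsub>M\<^esub> b \<in> f ` carrier L" if a: "a \<in> carrier R" and b: "b \<in> f ` carrier L" for a b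
    proof -
      obtain y where "y \<in> carrier L" "b = f y" using b by auto
      then show ?thesis using lin_map_smult[OF assms(2) a, of y] by (metis a L.smult_closed imageI)
    qed
  qed
qed

lemma lin_map_kernel_submodule:
  assumes "module R L" "lin_map R M L f"
  shows "submodule {x \<in> carrier M. f x = \<zero>\<^bsub>L\<^esub>} R M"
proof -
  interpret L: module R L by fact
  show ?thesis
    by (rule submoduleI)
      (auto simp: lin_map_zero[OF module_axioms assms] lin_map_neg[OF module_axioms assms]
        lin_map_add[OF assms(2)] lin_map_smult[OF assms(2)])
qed

text \<open>Generation is expressed by minimality among submodules instead of by linear
  combinations, so that the induction over coordinates below never handles coefficients.\<close>

definition submodule_generated_by :: "'c set \<Rightarrow> 'c set \<Rightarrow> bool" where
  "submodule_generated_by W S \<longleftrightarrow> S \<subseteq> W \<and> (\<forall>U. submodule U R M \<longrightarrow> S \<subseteq> U \<longrightarrow> W \<subseteq> U)"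

lemma fin_gen_submodule_image:
  assumes W: "submodule W R M" and S: "finite S" "submodule_generated_by W S"
  obtains m d where "lin_map R (free_mod R m) M d" "d ` carrier (free_mod R m) = W"
proof -
  obtain w where w: "bij_betw w {0..<card S} S" using ex_bij_betw_nat_finite[OF S(1)] by blast
  define m where "m = card S"
  have wS: "w ` {..<m} = S" using w unfolding m_def bij_betw_def by (simp add: lessThan_atLeast0)
  have SW: "S \<subseteq> W" using S(2) unfolding submodule_generated_by_def by blast
  have WM: "W \<subseteq> carrier M" by (rule submoduleE(1)[OF W])
  have wW: "w j \<in> W" if "j < m" for j using wS SW that by auto
  have wM: "w \<in> {..<m} \<rightarrow> carrier M" using wW WM by auto
  define d where "d = lincomb M m w"
  have d: "lin_map R (free_mod R m) M d" unfolding d_def by (rule lincomb_lin_map[OF wM])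
  have "submodule (d ` carrier (free_mod R m)) R M"
    by (rule lin_map_image_submodule[OF free_mod_module d])
  moreover have "S \<subseteq> d ` carrier (free_mod R m)"
  proof
    fix s assume "s \<in> S"
    then obtain j where j: "j < m" "s = w j" using wS by auto
    then have "s = d (unitv R m j)" unfolding d_def using lincomb_unitv[OF wM] by simp
    then show "s \<in> d ` carrier (free_mod R m)" using unitv_closed by blast
  qed
  ultimately have "W \<subseteq> d ` carrier (free_mod R m)"
    using S(2) unfolding submodule_generated_by_def by blast
  moreover have "d x \<in> W" if x: "x \<in> carrier (free_mod R m)" for x
    unfolding d_def lincomb_def
  proof (rule finsum_mem[OF submodule_zero[OF W] WM submoduleE(5)[OF W]])
    show "(\<lambda>j. x j \<odot>\<^bsub>M\<^esub> w j) \<in> {..<m} \<rightarrow> W" using x wW submoduleE(4)[OF W] by auto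
  qed
  ultimately show ?thesis using that[OF d] by blast
qed

lemma fin_gen_image:
  assumes "fin_gen R M"
  obtains m e where "lin_map R (free_mod R m) M e" "e ` carrier (free_mod R m) = carrier M"
proof -
  obtain S where S: "S \<subseteq> carrier M" "finite S"
    and gen: "\<And>x. x \<in> carrier M \<Longrightarrow> \<exists>a \<in> S \<rightarrow> carrier R. x = (\<Oplus>\<^bsub>M\<^esub>s\<in>S. a s \<odot>\<^bsub>M\<^esub> s)"
    using assms unfolding fin_gen_def by blast
  have "submodule_generated_by (carrier M) S"
    unfolding submodule_generated_by_def
  proof (intro conjI allI impI subsetI)
    fix U x assume U: "submodule U R M" and SU: "S \<subseteq> U" and x: "x \<in> carrier M"
    obtain a where a: "a \<in> S \<rightarrow> carrier R" "x = (\<Oplus>\<^bsub>M\<^esub>s\<in>S. a s \<odot>\<^bsub>M\<^esub> s)" using gen[OF x] by blast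
    show "x \<in> U" unfolding a(2)
    proof (rule finsum_mem[OF submodule_zero[OF U] submoduleE(1)[OF U] submoduleE(5)[OF U]])
      show "(\<lambda>s. a s \<odot>\<^bsub>M\<^esub> s) \<in> S \<rightarrow> U" using a(1) SU submoduleE(4)[OF U] by auto
    qed
  qed (use S in auto)
  from fin_gen_submodule_image[OF carrier_is_submodule S(2) this] that show ?thesis by blast
qed

end

section \<open>Finite generation of submodules of A^n over a Noetherian ring\<close>

lemma (in cring) submodule_coordinate_ideal:
  assumes W: "submodule W R (free_mod R n)" and k: "k < n"
  shows "ideal ((\<lambda>w. w k) ` W) R"
proof -
  interpret V: module R "free_mod R n" by (rule free_mod_module)
  note WE = V.submoduleE[OF W]
  have Wc: "w k \<in> carrier R" if "w \<in> W" for w using WE(1) that k by auto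
  show ?thesis
  proof (rule idealI[OF ring_axioms])
    show "subgroup ((\<lambda>w. w k) ` W) (add_monoid R)"
    proof (rule add.subgroupI)
      show "(\<lambda>w. w k) ` W \<noteq> {}" using WE(2) by auto
      show "\<ominus> a \<in> (\<lambda>w. w k) ` W" if a: "a \<in> (\<lambda>w. w k) ` W" for a
      proof -
        obtain w where w: "w \<in> W" "a = w k" using a by auto
        have "(\<ominus>\<^bsub>free_mod R n\<^esub> w) k = \<ominus> a"
          using WE(1) w k by (subst free_mod_neg) auto
        then show ?thesis using imageI[OF WE(3)[OF w(1)], of "\<lambda>w. w k"] by simp
      qed
      show "a \<oplus> b \<in> (\<lambda>w. w k) ` W" if ab: "a \<in> (\<lambda>w. w k) ` W" "b \<in> (\<lambda>w. w k) ` W" for a b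
      proof -
        obtain v w where vw: "v \<in> W" "a = v k" "w \<in> W" "b = w k" using ab by auto
        then have "(v \<oplus>\<^bsub>free_mod R n\<^esub> w) k = a \<oplus> b" using k by simp
        then show ?thesis using imageI[OF WE(5)[OF vw(1,3)], of "\<lambda>w. w k"] by simp
      qed
    qed (use Wc in auto)
    show l: "x \<otimes> a \<in> (\<lambda>w. w k) ` W" if a: "a \<in> (\<lambda>w. w k) ` W" and x: "x \<in> carrier R" for a x
    proof -
      obtain w where w: "w \<in> W" "a = w k" using a by auto
      then have "(x \<odot>\<^bsub>free_mod R n\<^esub> w) k = x \<otimes> a" using k by simp
      then show ?thesis using imageI[OF WE(4)[OF x w(1)], of "\<lambda>w. w k"] by simp
    qed
    show "a \<otimes> x \<in> (\<lambda>w. w k) ` W" if a: "a \<in> (\<lambda>w. w k) ` W" and x: "x \<in> carrier R" for a x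
      using l[OF a x] a x Wc m_comm by auto
  qed
qed

locale noetherian_cring = cring R + noetherian_ring R for R (structure)
begin

text \<open>Induction on the number of coordinates that may be nonzero. The values of the last of
  them on W form a finitely generated ideal, whose generators are lifted to W; the vectors of W on
  which it vanishes form the smaller submodule \<open>W0\<close>.\<close>

lemma free_mod_submodule_fin_gen_aux:
  assumes "k \<le> n" "submodule W R (free_mod R n)" "\<And>w i. w \<in> W \<Longrightarrow> k \<le> i \<Longrightarrow> i < n \<Longrightarrow> w i = \<zero>"
  shows "\<exists>S. finite S \<and> module.submodule_generated_by R (free_mod R n) W S"
  using assms
proof (induction k arbitrary: W)
  case 0
  interpret V: module R "free_mod R n" by (rule free_mod_module)
  have "w = \<zero>\<^bsub>free_mod R n\<^esub>" if w: "w \<in> W" for w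
    using 0(3)[OF w] V.submoduleE(1)[OF 0(2)] w by (fastforce simp: PiE_iff extensional_def)
  then have "V.submodule_generated_by W {}"
    unfolding V.submodule_generated_by_def using V.submodule_zero by (metis empty_subsetI subsetI)
  then show ?case by blast
next
  case (Suc k)
  interpret V: module R "free_mod R n" by (rule free_mod_module)
  note W = Suc.prems(2)
  have k: "k < n" using Suc.prems(1) by simp
  have Wc: "W \<subseteq> carrier (free_mod R n)" by (rule V.submoduleE(1)[OF W])
  obtain T where T: "T \<subseteq> carrier R" "finite T" "(\<lambda>w. w k) ` W = Idl T"
    using finetely_gen[OF submodule_coordinate_ideal[OF W k]] by blast
  have "T \<subseteq> (\<lambda>w. w k) ` W" unfolding T(3) by (rule genideal_self[OF T(1)])
  then have "\<forall>t\<in>T. \<exists>w\<in>W. w k = t" by fast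
  then obtain g where g: "\<And>t. t \<in> T \<Longrightarrow> g t \<in> W \<and> g t k = t" by metis
  define W0 where "W0 = W \<inter> {w \<in> carrier (free_mod R n). w k = \<zero>\<^bsub>reg_mod R\<^esub>}"
  have W0: "submodule W0 R (free_mod R n)" unfolding W0_def
    by (rule V.submodule_Int[OF W V.lin_map_kernel_submodule[OF reg_mod_module lin_map_coord[OF k]]])
  have "w i = \<zero>" if "w \<in> W0" "k \<le> i" "i < n" for w i
    using Suc.prems(3)[of w i] that by (cases "i = k") (auto simp: W0_def)
  with Suc.IH[OF _ W0] k obtain S where S: "finite S" "V.submodule_generated_by W0 S" by auto
  have "V.submodule_generated_by W (S \<union> g ` T)"
    unfolding V.submodule_generated_by_def
  proof (intro conjI allI impI subsetI)
    show "x \<in> W" if "x \<in> S \<union> g ` T" for x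
      using that S(2) g unfolding V.submodule_generated_by_def W0_def by auto
    fix U x assume U: "submodule U R (free_mod R n)" and SU: "S \<union> g ` T \<subseteq> U" and x: "x \<in> W"
    \<comment> \<open>The values of coordinate k on W \<inter> U form an ideal containing T, hence
      every value taken on W. So x differs from some element of U by an element of
      \<open>W0\<close>.\<close>
    have "ideal ((\<lambda>w. w k) ` (W \<inter> U)) R"
      by (rule submodule_coordinate_ideal[OF V.submodule_Int[OF W U] k])
    moreover have "T \<subseteq> (\<lambda>w. w k) ` (W \<inter> U)"
    proof
      fix t assume t: "t \<in> T"
      then have "g t \<in> W \<inter> U" "t = g t k" using g SU by auto
      then show "t \<in> (\<lambda>w. w k) ` (W \<inter> U)" using imageI[of "g t" "W \<inter> U" "\<lambda>w. w k"] by simp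
    qed
    ultimately have "Idl T \<subseteq> (\<lambda>w. w k) ` (W \<inter> U)" by (rule genideal_minimal)
    then obtain u where u: "u \<in> W" "u \<in> U" "u k = x k" using T(3) x by force
    have xc: "x \<in> carrier (free_mod R n)" and uc: "u \<in> carrier (free_mod R n)" using x u Wc by auto
    have "x k \<in> carrier R" using xc k by auto
    then have "(x \<ominus>\<^bsub>free_mod R n\<^esub> u) k = \<zero>"
      unfolding free_mod_minus_coord[OF xc uc k] u(3) by (simp add: a_minus_def r_neg)
    then have "x \<ominus>\<^bsub>free_mod R n\<^esub> u \<in> W0"
      unfolding W0_def using V.submodule_minus[OF W x u(1)] Wc by auto
    moreover have "W0 \<subseteq> U" using S(2) U SU unfolding V.submodule_generated_by_def by blast
    ultimately have "(x \<ominus>\<^bsub>free_mod R n\<^esub> u) \<oplus>\<^bsub>free_mod R n\<^esub> u \<in> U"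
      using V.submoduleE(5)[OF U] u(2) by blast
    moreover have "(x \<ominus>\<^bsub>free_mod R n\<^esub> u) \<oplus>\<^bsub>free_mod R n\<^esub> u = x"
      using V.M.add.m_assoc[OF xc V.M.a_inv_closed[OF uc] uc] V.M.l_neg[OF uc] V.M.r_zero[OF xc]
      unfolding a_minus_def by (simp del: free_mod_simps)
    ultimately show "x \<in> U" by simp
  qed
  moreover have "finite (S \<union> g ` T)" using S(1) T(2) by simp
  ultimately show ?case by (intro exI[of _ "S \<union> g ` T"] conjI)
qed

section \<open>Construction of a resolution by free modules of finite rank\<close>

lemma kernel_presentation:
  assumes "module R M" "lin_map R (free_mod R b) M f"
  obtains c d where "lin_map R (free_mod R c) (free_mod R b) d"
    "exact_at (free_mod R c) (free_mod R b) M d f"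
proof -
  interpret V: module R "free_mod R b" by (rule free_mod_module)
  let ?K = "{x \<in> carrier (free_mod R b). f x = \<zero>\<^bsub>M\<^esub>}"
  have K: "submodule ?K R (free_mod R b)" by (rule V.lin_map_kernel_submodule[OF assms])
  obtain S where S: "finite S" "V.submodule_generated_by ?K S"
    using free_mod_submodule_fin_gen_aux[OF le_refl K] by auto
  obtain c d where d: "lin_map R (free_mod R c) (free_mod R b) d" "d ` carrier (free_mod R c) = ?K"
    using V.fin_gen_submodule_image[OF K S] by blast
  show ?thesis
  proof (rule that[OF d(1)])
    show "exact_at (free_mod R c) (free_mod R b) M d f" unfolding exact_at_def d(2) by simp
  qed
qed

lemma free_resolution_exists:
  assumes "module R M" "fin_gen R M"
  shows "\<exists>P. is_free_resolution R M P"
proof -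
  interpret M: module R M by fact
  obtain n0 e where e: "lin_map R (free_mod R n0) M e" "e ` carrier (free_mod R n0) = carrier M"
    using M.fin_gen_image[OF assms(2)] by blast
  \<comment> \<open>The resolution is built by dependent choice from triples (target rank, source
    rank, differential). \<open>Q\<close> couples consecutive triples by exactness, and the clause
    of \<open>P\<close> at index 0 ties the first one to the augmentation.\<close>
  define P where "P i x = (case x of (a, b, d) \<Rightarrow> lin_map R (free_mod R b) (free_mod R a) d \<and>
      (i = (0::nat) \<longrightarrow> a = n0 \<and> exact_at (free_mod R b) (free_mod R a) M d e))" for i x
  define Q where "Q i x y = (case x of (a, b, d) \<Rightarrow> case y of (a', b', d') \<Rightarrow>
      a' = b \<and> exact_at (free_mod R b') (free_mod R b) (free_mod R a) d' d)" for i :: nat and x y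
  have "\<exists>f. \<forall>i. P i (f i) \<and> Q i (f i) (f (Suc i))"
  proof (rule dependent_nat_choice)
    show "\<exists>x. P 0 x" using kernel_presentation[OF assms(1) e(1)] unfolding P_def by fastforce
    fix x i assume "P i x"
    obtain a b d where x: "x = (a, b, d)" by (cases x) auto
    have d: "lin_map R (free_mod R b) (free_mod R a) d" using \<open>P i x\<close> unfolding P_def x by simp
    obtain c d' where "lin_map R (free_mod R c) (free_mod R b) d'"
      "exact_at (free_mod R c) (free_mod R b) (free_mod R a) d' d"
      using kernel_presentation[OF free_mod_module d] by blast
    then have "P (Suc i) (b, c, d') \<and> Q i x (b, c, d')" unfolding P_def Q_def x by simp
    then show "\<exists>y. P (Suc i) y \<and> Q i x y" by blast
  qed
  then obtain f where f: "\<And>i. P i (f i)" "\<And>i. Q i (f i) (f (Suc i))" by blast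
  define n where "n i = fst (f i)" for i
  define d where "d i = snd (snd (f i))" for i
  have fi: "f i = (n i, n (Suc i), d i)" for i
    using f(2)[of i] unfolding Q_def n_def d_def by (auto split: prod.splits)
  have d: "lin_map R (free_mod R (n (Suc i))) (free_mod R (n i)) (d i)" for i
    using f(1)[of i] unfolding P_def fi by simp
  have n0: "n 0 = n0" and ex0: "exact_at (free_mod R (n 1)) (free_mod R (n 0)) M (d 0) e"
    using f(1)[of 0] One_nat_def unfolding P_def fi prod.case by metis+
  have ex: "exact_at (free_mod R (n (Suc (Suc i)))) (free_mod R (n (Suc i))) (free_mod R (n i)) (d (Suc i)) (d i)" for i
    using f(2)[of i] unfolding Q_def fi by simp
  \<comment> \<open>\<open>linear_maps\<close> asks for extensional functions, whereas the chosen
    differentials are constrained only on the carriers.\<close>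
  define d' where "d' i = restrict (d i) (carrier (free_mod R (n (Suc i))))" for i
  have d': "d' i \<in> linear_maps R (free_mod R (n (Suc i))) (free_mod R (n i))" for i
    unfolding linear_maps_iff
  proof
    show "lin_map R (free_mod R (n (Suc i))) (free_mod R (n i)) (d' i)"
      by (rule lin_map_cong[OF d free_mod_module]) (simp add: d'_def)
  qed (auto simp: d'_def)
  have im: "d' i ` carrier (free_mod R (n (Suc i))) = d i ` carrier (free_mod R (n (Suc i)))" for i
    unfolding d'_def by auto
  have dc: "d i ` carrier (free_mod R (n (Suc i))) \<subseteq> carrier (free_mod R (n i))" for i
    using lin_map_closed[OF d] by blast
  have "is_free_resolution R M (n, d')"
    unfolding is_free_resolution_def prod.case
  proof (intro conjI allI)
    let ?e = "restrict e (carrier (free_mod R (n 0)))"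
    show "\<exists>\<epsilon>\<in>linear_maps R (free_mod R (n 0)) M. \<epsilon> ` carrier (free_mod R (n 0)) = carrier M \<and>
      a_kernel (free_mod R (n 0)) M \<epsilon> = d' 0 ` carrier (free_mod R (n 1))"
    proof (intro bexI[of _ ?e] conjI)
      show "?e \<in> linear_maps R (free_mod R (n 0)) M"
        unfolding linear_maps_iff
      proof
        show "lin_map R (free_mod R (n 0)) M ?e"
          by (rule lin_map_cong[OF e(1)[folded n0] free_mod_module]) simp
      qed auto
      show "?e ` carrier (free_mod R (n 0)) = carrier M" using e(2) n0 by auto
      show "a_kernel (free_mod R (n 0)) M ?e = d' 0 ` carrier (free_mod R (n 1))"
        using ex0 dc[of 0] im[of 0] unfolding a_kernel_def kernel_def exact_at_def
        by (auto simp del: free_mod_simps)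
    qed
    show "d' i \<in> linear_maps R (free_mod R (n (Suc i))) (free_mod R (n i))" for i by (rule d')
    show "a_kernel (free_mod R (n (Suc i))) (free_mod R (n i)) (d' i) =
      d' (Suc i) ` carrier (free_mod R (n (Suc (Suc i))))" for i
      using ex[of i] dc[of "Suc i"] im[of "Suc i"] unfolding a_kernel_def kernel_def exact_at_def
      by (auto simp del: free_mod_simps simp: d'_def)
  qed
  then show ?thesis by blast
qed

definition res_rank :: "('a, 'm, 'y) module_scheme \<Rightarrow> nat \<Rightarrow> nat" where
  "res_rank M = fst (free_resolution R M)"

lemma res_mod_eq: "res_mod R M i = free_mod R (res_rank M i)"
  unfolding res_mod_def res_rank_def ..

text \<open>The Hilbert choice in \<open>free_resolution\<close> is opened here once, using
  existence. All later arguments reach the chosen differentials through these three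
  properties.\<close>

lemma free_resolution_exact:
  assumes "module R M" "fin_gen R M"
  shows res_map_linear:
      "res_map R M i \<in> linear_maps R (free_mod R (res_rank M (Suc i))) (free_mod R (res_rank M i))"
    and res_map_exact: "exact_at (free_mod R (res_rank M (Suc (Suc i)))) (free_mod R (res_rank M (Suc i)))
      (free_mod R (res_rank M i)) (res_map R M (Suc i)) (res_map R M i)"
    and res_augmentation: "\<exists>e. lin_map R (free_mod R (res_rank M 0)) M e \<and>
      e ` carrier (free_mod R (res_rank M 0)) = carrier M \<and>
      exact_at (free_mod R (res_rank M (Suc 0))) (free_mod R (res_rank M 0)) M (res_map R M 0) e"
proof -
  have "is_free_resolution R M (free_resolution R M)"
    unfolding free_resolution_def by (rule someI_ex[OF free_resolution_exists[OF assms]])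
  then have res: "is_free_resolution R M (res_rank M, res_map R M)"
    unfolding res_rank_def res_map_def by simp
  note res = this[unfolded is_free_resolution_def prod.case]
  show "res_map R M i \<in> linear_maps R (free_mod R (res_rank M (Suc i))) (free_mod R (res_rank M i))"
    using res by blast
  have "a_kernel (free_mod R (res_rank M (Suc i))) (free_mod R (res_rank M i)) (res_map R M i) =
      res_map R M (Suc i) ` carrier (free_mod R (res_rank M (Suc (Suc i))))" using res by blast
  then show "exact_at (free_mod R (res_rank M (Suc (Suc i)))) (free_mod R (res_rank M (Suc i)))
      (free_mod R (res_rank M i)) (res_map R M (Suc i)) (res_map R M i)"
    unfolding exact_at_def a_kernel_def kernel_def by (auto simp del: free_mod_simps)
  obtain e where e: "e \<in> linear_maps R (free_mod R (res_rank M 0)) M"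
    "e ` carrier (free_mod R (res_rank M 0)) = carrier M"
    "a_kernel (free_mod R (res_rank M 0)) M e = res_map R M 0 ` carrier (free_mod R (res_rank M 1))"
    using res by blast
  have "exact_at (free_mod R (res_rank M (Suc 0))) (free_mod R (res_rank M 0)) M (res_map R M 0) e"
    using e(3) unfolding exact_at_def a_kernel_def kernel_def by (auto simp del: free_mod_simps)
  then show "\<exists>e. lin_map R (free_mod R (res_rank M 0)) M e \<and>
      e ` carrier (free_mod R (res_rank M 0)) = carrier M \<and>
      exact_at (free_mod R (res_rank M (Suc 0))) (free_mod R (res_rank M 0)) M (res_map R M 0) e"
    using e(1,2) unfolding linear_maps_iff by blast
qed

lemmas res_map_lin_map = res_map_linear[unfolded linear_maps_iff, THEN conjunct1]

end

text \<open>The single element of the quotient is its identity I, and x lies in the coset of x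
  because I contains the identity of G. Only this enters, so the lemma applies to the Hom complex
  before that is known to consist of groups.\<close>

lemma trivial_quotientD:
  assumes "trivial_group (G Mod I)" "\<one>\<^bsub>G\<^esub> \<in> I" "x \<in> carrier G" "\<one>\<^bsub>G\<^esub> \<otimes>\<^bsub>G\<^esub> x = x"
  shows "x \<in> I"
proof -
  have "carrier (G Mod I) = {I}" using assms(1) unfolding trivial_group_def by simp
  then have "I #>\<^bsub>G\<^esub> x = I" using assms(3) unfolding FactGroup_def RCOSETS_def by auto
  moreover have "\<one>\<^bsub>G\<^esub> \<otimes>\<^bsub>G\<^esub> x \<in> I #>\<^bsub>G\<^esub> x" using assms(2) unfolding r_coset_def by blast
  ultimately show ?thesis using assms(4) by simp
qed

lemma (in noetherian_cring) ext_one_zeroD: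
  assumes M: "module R M" "fin_gen R M" and N: "module R N"
    and ext: "trivial_group (Ext R 1 M N)"
    and f: "lin_map R (free_mod R (res_rank M 1)) N f"
    and fd: "\<And>x. x \<in> carrier (free_mod R (res_rank M 2)) \<Longrightarrow> f (res_map R M 1 x) = \<zero>\<^bsub>N\<^esub>"
  shows "\<exists>g. lin_map R (free_mod R (res_rank M 0)) N g \<and>
    (\<forall>x\<in>carrier (free_mod R (res_rank M 1)). f x = g (res_map R M 0 x))"
proof -
  interpret N: module R N by fact
  let ?H = "\<lambda>i. Hom R (free_mod R (res_rank M i)) N"
  let ?K = "kernel (?H 1) (?H 2) (Hom_map R M 1)"
  let ?G = "(?H 1)\<lparr>carrier := ?K\<rparr>"
  let ?I = "Hom_map R M 0 ` carrier (?H 0)"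
  note d0 = res_map_lin_map[OF M, of 0] and d1 = res_map_lin_map[OF M, of 1]
  \<comment> \<open>Cochains are extensional by definition of \<open>Hom\<close>, so f has to be cut
    off outside the carrier before it can be one.\<close>
  define F where "F = restrict f (carrier (free_mod R (res_rank M 1)))"
  have tr: "trivial_group (?G Mod ?I)"
    using ext by (simp add: res_mod_eq numeral_2_eq_2)
  have z: "lin_map R (free_mod R n) N (\<lambda>x\<in>carrier (free_mod R n). \<zero>\<^bsub>N\<^esub>)" for n
    by (rule lin_map_cong[OF lin_map_zero_map[OF N] free_mod_module]) simp
  have "\<one>\<^bsub>?G\<^esub> = Hom_map R M 0 (\<lambda>x\<in>carrier (free_mod R (res_rank M 0)). \<zero>\<^bsub>N\<^esub>)"
    using lin_map_closed[OF d0]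
    by (auto simp: Hom_def Hom_map_def compose_def res_mod_eq fun_eq_iff simp del: free_mod_simps)
  moreover have "(\<lambda>x\<in>carrier (free_mod R (res_rank M 0)). \<zero>\<^bsub>N\<^esub>) \<in> carrier (?H 0)"
    using z by (simp add: Hom_def linear_maps_iff del: free_mod_simps)
  ultimately have one: "\<one>\<^bsub>?G\<^esub> \<in> ?I" by blast
  have Fc: "F \<in> carrier (?H 1)"
    using lin_map_cong[OF f free_mod_module, of "restrict f (carrier (free_mod R (res_rank M 1)))"]
    by (simp add: Hom_def linear_maps_iff F_def del: free_mod_simps One_nat_def)
  have FK: "F \<in> carrier ?G"
    using Fc fd lin_map_closed[OF d1] unfolding kernel_def F_def
    by (auto simp: Hom_def Hom_map_def compose_def res_mod_eq fun_eq_iff numeral_2_eq_2 simp del: free_mod_simps)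
  have "\<one>\<^bsub>?G\<^esub> \<otimes>\<^bsub>?G\<^esub> F = F"
    using lin_map_closed[OF f] unfolding F_def by (auto simp: Hom_def fun_eq_iff simp del: free_mod_simps)
  from trivial_quotientD[OF tr one FK this] obtain g where g: "g \<in> carrier (?H 0)" "F = Hom_map R M 0 g"
    by blast
  have "lin_map R (free_mod R (res_rank M 0)) N g" using g(1) by (simp add: Hom_def linear_maps_iff)
  moreover have "f x = g (res_map R M 0 x)" if "x \<in> carrier (free_mod R (res_rank M 1))" for x
    using fun_cong[OF g(2), of x] that
    by (simp add: F_def Hom_map_def compose_def res_mod_eq del: free_mod_simps)
  ultimately show ?thesis by blast
qed

section \<open>Quotient modules\<close>

definition quot_class :: "('a, 'm, 'y) module_scheme \<Rightarrow> 'm set \<Rightarrow> 'm \<Rightarrow> 'm set" where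
  "quot_class V B x = {y \<in> carrier V. y \<ominus>\<^bsub>V\<^esub> x \<in> B}"

definition quot_rep :: "'m set \<Rightarrow> 'm" where
  "quot_rep C = (SOME x. x \<in> C)"

text \<open>For V = A^n the elements are sets of vectors, which is exactly the carrier type over
  which \<open>Tor_rigid\<close> quantifies. The operations act on chosen representatives and are
  independent of them once B is a submodule.\<close>

definition quotient_module :: "('a, 'm, 'y) module_scheme \<Rightarrow> 'm set \<Rightarrow> ('a, 'm set) module" where
  "quotient_module V B =
    \<lparr>carrier = quot_class V B ` carrier V, monoid.mult = undefined, monoid.one = undefined,
     ring.zero = quot_class V B \<zero>\<^bsub>V\<^esub>,
     ring.add = (\<lambda>C D. quot_class V B (quot_rep C \<oplus>\<^bsub>V\<^esub> quot_rep D)),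
     smult = (\<lambda>a C. quot_class V B (a \<odot>\<^bsub>V\<^esub> quot_rep C))\<rparr>"

context module
begin

lemma diff_add_diff:
  assumes "x \<in> carrier M" "y \<in> carrier M" "x' \<in> carrier M" "y' \<in> carrier M"
  shows "(x \<oplus>\<^bsub>M\<^esub> y) \<ominus>\<^bsub>M\<^esub> (x' \<oplus>\<^bsub>M\<^esub> y') = (x \<ominus>\<^bsub>M\<^esub> x') \<oplus>\<^bsub>M\<^esub> (y \<ominus>\<^bsub>M\<^esub> y')"
  using assms by (simp add: a_minus_def M.minus_add M.a_ac)

lemma smult_diff:
  assumes "a \<in> carrier R" "x \<in> carrier M" "y \<in> carrier M"
  shows "a \<odot>\<^bsub>M\<^esub> (x \<ominus>\<^bsub>M\<^esub> y) = a \<odot>\<^bsub>M\<^esub> x \<ominus>\<^bsub>M\<^esub> a \<odot>\<^bsub>M\<^esub> y"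
  using assms by (simp add: a_minus_def smult_r_distr smult_r_minus)

lemma diff_add_cancel:
  assumes "x \<in> carrier M" "y \<in> carrier M"
  shows "(x \<ominus>\<^bsub>M\<^esub> y) \<oplus>\<^bsub>M\<^esub> y = x"
  using assms by (simp add: a_minus_def M.a_assoc M.l_neg)

lemma diff_diff_diff:
  assumes "x \<in> carrier M" "y \<in> carrier M" "z \<in> carrier M"
  shows "(x \<ominus>\<^bsub>M\<^esub> y) \<oplus>\<^bsub>M\<^esub> (y \<ominus>\<^bsub>M\<^esub> z) = x \<ominus>\<^bsub>M\<^esub> z"
proof -
  have "(x \<ominus>\<^bsub>M\<^esub> y) \<oplus>\<^bsub>M\<^esub> (y \<oplus>\<^bsub>M\<^esub> \<ominus>\<^bsub>M\<^esub> z) = ((x \<ominus>\<^bsub>M\<^esub> y) \<oplus>\<^bsub>M\<^esub> y) \<oplus>\<^bsub>M\<^esub> \<ominus>\<^bsub>M\<^esub> z"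
    using assms by (intro M.a_assoc[symmetric]) auto
  then show ?thesis using diff_add_cancel assms by (simp add: a_minus_def)
qed

lemma diff_swap:
  assumes "x \<in> carrier M" "y \<in> carrier M"
  shows "\<ominus>\<^bsub>M\<^esub> (x \<ominus>\<^bsub>M\<^esub> y) = y \<ominus>\<^bsub>M\<^esub> x"
  using assms by (simp add: a_minus_def M.minus_add M.a_comm)

lemma fin_gen_if_image:
  assumes e: "lin_map R (free_mod R n) M e" "e ` carrier (free_mod R n) = carrier M"
  shows "fin_gen R M"
proof -
  define w where "w j = e (unitv R n j)" for j
  define S where "S = w ` {..<n}"
  \<comment> \<open>Several unit vectors may have the same image in S, so coefficients cannot be
    copied index by index. Closure of U under addition merges such repetitions.\<close>
  define U where "U = {(\<Oplus>\<^bsub>M\<^esub>s\<in>S. a s \<odot>\<^bsub>M\<^esub> s) | a. a \<in> S \<rightarrow> carrier R}"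
  have SM: "S \<subseteq> carrier M" unfolding S_def w_def using lin_map_closed[OF e(1) unitv_closed] by auto
  have fin: "finite S" unfolding S_def by simp
  have UI: "(\<Oplus>\<^bsub>M\<^esub>s\<in>S. a s \<odot>\<^bsub>M\<^esub> s) \<in> U" if "a \<in> S \<rightarrow> carrier R" for a
    using that unfolding U_def by blast
  have zero: "\<zero>\<^bsub>M\<^esub> \<in> U"
  proof -
    have "(\<Oplus>\<^bsub>M\<^esub>s\<in>S. \<zero> \<odot>\<^bsub>M\<^esub> s) = (\<Oplus>\<^bsub>M\<^esub>s\<in>S. \<zero>\<^bsub>M\<^esub>)" using SM by (intro M.finsum_cong') auto
    then have "\<zero>\<^bsub>M\<^esub> = (\<Oplus>\<^bsub>M\<^esub>s\<in>S. (\<lambda>_. \<zero>) s \<odot>\<^bsub>M\<^esub> s)" by simp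
    then show ?thesis using UI[of "\<lambda>_. \<zero>"] by simp
  qed
  have UM: "U \<subseteq> carrier M" using SM unfolding U_def by (force intro!: M.finsum_closed)
  have add: "x \<oplus>\<^bsub>M\<^esub> y \<in> U" if xy: "x \<in> U" "y \<in> U" for x y
  proof -
    obtain a b where a: "a \<in> S \<rightarrow> carrier R" "x = (\<Oplus>\<^bsub>M\<^esub>s\<in>S. a s \<odot>\<^bsub>M\<^esub> s)"
      and b: "b \<in> S \<rightarrow> carrier R" "y = (\<Oplus>\<^bsub>M\<^esub>s\<in>S. b s \<odot>\<^bsub>M\<^esub> s)" using xy unfolding U_def by blast
    have "x \<oplus>\<^bsub>M\<^esub> y = (\<Oplus>\<^bsub>M\<^esub>s\<in>S. a s \<odot>\<^bsub>M\<^esub> s \<oplus>\<^bsub>M\<^esub> b s \<odot>\<^bsub>M\<^esub> s)"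
      unfolding a(2) b(2) using a(1) b(1) SM by (intro M.finsum_addf[symmetric]) auto
    also have "\<dots> = (\<Oplus>\<^bsub>M\<^esub>s\<in>S. (a s \<oplus> b s) \<odot>\<^bsub>M\<^esub> s)"
      using a(1) b(1) SM by (intro M.finsum_cong') (auto simp: smult_l_distr Pi_iff subset_iff)
    finally have "x \<oplus>\<^bsub>M\<^esub> y = (\<Oplus>\<^bsub>M\<^esub>s\<in>S. (a s \<oplus> b s) \<odot>\<^bsub>M\<^esub> s)" .
    moreover have "(\<lambda>s. a s \<oplus> b s) \<in> S \<rightarrow> carrier R" using a(1) b(1) by auto
    ultimately show ?thesis using UI by metis
  qed
  have gen: "c \<odot>\<^bsub>M\<^esub> w j \<in> U" if c: "c \<in> carrier R" and j: "j < n" for c j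
  proof -
    let ?a = "\<lambda>s. if w j = s then c else \<zero>"
    have wj: "w j \<in> S" unfolding S_def using j by blast
    have "(\<Oplus>\<^bsub>M\<^esub>s\<in>S. ?a s \<odot>\<^bsub>M\<^esub> s) = (\<Oplus>\<^bsub>M\<^esub>s\<in>S. if w j = s then c \<odot>\<^bsub>M\<^esub> s else \<zero>\<^bsub>M\<^esub>)"
      using c SM by (intro M.finsum_cong') auto
    also have "\<dots> = c \<odot>\<^bsub>M\<^esub> w j"
      using c SM by (intro M.finsum_singleton[OF wj fin]) auto
    finally have "c \<odot>\<^bsub>M\<^esub> w j = (\<Oplus>\<^bsub>M\<^esub>s\<in>S. ?a s \<odot>\<^bsub>M\<^esub> s)" by simp
    moreover have "?a \<in> S \<rightarrow> carrier R" using c by simp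
    ultimately show ?thesis using UI[of ?a] by metis
  qed
  have "x \<in> U" if x: "x \<in> carrier M" for x
  proof -
    obtain y where y: "y \<in> carrier (free_mod R n)" "x = e y" using x e(2) by blast
    have "lincomb M n w y \<in> U" unfolding lincomb_def
      by (rule finsum_mem[OF zero UM add]) (use y(1) gen in auto)
    then show ?thesis unfolding y(2) w_def
      using lin_map_lincomb[OF module_axioms e(1) y(1)] by simp
  qed
  then show ?thesis unfolding fin_gen_def U_def using SM fin by blast
qed

context
  fixes B assumes B: "submodule B R M"
begin

lemma quot_class_self: "x \<in> carrier M \<Longrightarrow> x \<in> quot_class M B x"
  unfolding quot_class_def a_minus_def using submodule_zero[OF B] by (simp add: M.r_neg)

lemma quot_class_eq_iff:
  assumes "x \<in> carrier M" "y \<in> carrier M"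
  shows "quot_class M B x = quot_class M B y \<longleftrightarrow> x \<ominus>\<^bsub>M\<^esub> y \<in> B"
proof
  assume "quot_class M B x = quot_class M B y"
  then show "x \<ominus>\<^bsub>M\<^esub> y \<in> B" using quot_class_self[OF assms(1)] unfolding quot_class_def by blast
next
  assume xy: "x \<ominus>\<^bsub>M\<^esub> y \<in> B"
  have sub: "quot_class M B x \<subseteq> quot_class M B y"
    if "x \<ominus>\<^bsub>M\<^esub> y \<in> B" "x \<in> carrier M" "y \<in> carrier M" for x y
  proof
    fix z assume "z \<in> quot_class M B x"
    then have z: "z \<in> carrier M" "z \<ominus>\<^bsub>M\<^esub> x \<in> B" unfolding quot_class_def by auto
    have "z \<ominus>\<^bsub>M\<^esub> y \<in> B"
      using submoduleE(5)[OF B z(2) that(1)] diff_diff_diff[OF z(1) that(2,3)] by simp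
    then show "z \<in> quot_class M B y" using z(1) unfolding quot_class_def by simp
  qed
  have "y \<ominus>\<^bsub>M\<^esub> x \<in> B" using submoduleE(3)[OF B xy] diff_swap[OF assms] by simp
  then show "quot_class M B x = quot_class M B y" using sub xy assms by blast
qed

lemma quot_rep_class:
  assumes "x \<in> carrier M"
  shows "quot_rep (quot_class M B x) \<in> carrier M" "quot_rep (quot_class M B x) \<ominus>\<^bsub>M\<^esub> x \<in> B"
proof -
  have "quot_rep (quot_class M B x) \<in> quot_class M B x"
    unfolding quot_rep_def using quot_class_self[OF assms] by (rule someI)
  then show "quot_rep (quot_class M B x) \<in> carrier M" "quot_rep (quot_class M B x) \<ominus>\<^bsub>M\<^esub> x \<in> B"
    unfolding quot_class_def by auto
qed

lemma quotient_carrier: "carrier (quotient_module M B) = quot_class M B ` carrier M"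
  and quotient_zero: "\<zero>\<^bsub>quotient_module M B\<^esub> = quot_class M B \<zero>\<^bsub>M\<^esub>"
  by (simp_all add: quotient_module_def)

lemma quotient_add:
  assumes "x \<in> carrier M" "y \<in> carrier M"
  shows "quot_class M B x \<oplus>\<^bsub>quotient_module M B\<^esub> quot_class M B y = quot_class M B (x \<oplus>\<^bsub>M\<^esub> y)"
  using quot_rep_class[OF assms(1)] quot_rep_class[OF assms(2)] assms
    submoduleE(5)[OF B] diff_add_diff
  by (simp add: quotient_module_def quot_class_eq_iff)

lemma quotient_smult:
  assumes "a \<in> carrier R" "x \<in> carrier M"
  shows "a \<odot>\<^bsub>quotient_module M B\<^esub> quot_class M B x = quot_class M B (a \<odot>\<^bsub>M\<^esub> x)"
  using quot_rep_class[OF assms(2)] assms submoduleE(4)[OF B] smult_diff[OF assms(1)]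
  by (simp add: quotient_module_def quot_class_eq_iff flip: smult_diff)

lemma quotient_module: "module R (quotient_module M B)"
proof (rule moduleI)
  show "cring R" by (rule R.cring_axioms)
  show "abelian_group (quotient_module M B)"
  proof (rule abelian_groupI)
    fix C assume "C \<in> carrier (quotient_module M B)"
    then obtain x where "x \<in> carrier M" "C = quot_class M B x" unfolding quotient_carrier by blast
    then have "quot_class M B (\<ominus>\<^bsub>M\<^esub> x) \<oplus>\<^bsub>quotient_module M B\<^esub> C = \<zero>\<^bsub>quotient_module M B\<^esub>"
      by (simp add: quotient_add quotient_zero M.l_neg)
    then show "\<exists>y\<in>carrier (quotient_module M B). y \<oplus>\<^bsub>quotient_module M B\<^esub> C = \<zero>\<^bsub>quotient_module M B\<^esub>"
      using \<open>x \<in> carrier M\<close> unfolding quotient_carrier by (metis M.a_inv_closed imageI)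
  qed (auto simp: quotient_carrier quotient_zero quotient_add M.a_ac)
qed (auto simp: quotient_carrier quotient_add quotient_smult smult_l_distr smult_r_distr smult_assoc1)

lemma quot_class_lin_map: "lin_map R M (quotient_module M B) (quot_class M B)"
  unfolding lin_map_def by (auto simp: quotient_carrier quotient_add quotient_smult)

lemma quot_class_zero_iff:
  "x \<in> carrier M \<Longrightarrow> quot_class M B x = \<zero>\<^bsub>quotient_module M B\<^esub> \<longleftrightarrow> x \<in> B"
  by (simp add: quotient_zero quot_class_eq_iff M.diff_zero)

end

end

section \<open>Tensor products\<close>

locale module_pair = M: module R M + L: module R L
  for R :: "('a, 'x) ring_scheme" (structure)
    and M :: "('a, 'm, 'y) module_scheme" and L :: "('a, 'l, 'z) module_scheme"
begin

abbreviation F where "F \<equiv> free_Abelian_group (carrier M \<times> carrier L)"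

abbreviation T where "T \<equiv> tensor_relations R M L"

definition tensor_gens where
  "tensor_gens =
    {frag_of (x \<oplus>\<^bsub>M\<^esub> x', y) - frag_of (x, y) - frag_of (x', y) |x x' y.
        x \<in> carrier M \<and> x' \<in> carrier M \<and> y \<in> carrier L} \<union>
     {frag_of (x, y \<oplus>\<^bsub>L\<^esub> y') - frag_of (x, y) - frag_of (x, y') |x y y'.
        x \<in> carrier M \<and> y \<in> carrier L \<and> y' \<in> carrier L} \<union>
     {frag_of (a \<odot>\<^bsub>M\<^esub> x, y) - frag_of (x, a \<odot>\<^bsub>L\<^esub> y) |a x y.
        a \<in> carrier R \<and> x \<in> carrier M \<and> y \<in> carrier L}"

lemma tensor_gens_cases [consumes 1]:
  assumes "c \<in> tensor_gens"
  obtains x x' y where "c = frag_of (x \<oplus>\<^bsub>M\<^esub> x', y) - frag_of (x, y) - frag_of (x', y)"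
      "x \<in> carrier M" "x' \<in> carrier M" "y \<in> carrier L"
    | x y y' where "c = frag_of (x, y \<oplus>\<^bsub>L\<^esub> y') - frag_of (x, y) - frag_of (x, y')"
      "x \<in> carrier M" "y \<in> carrier L" "y' \<in> carrier L"
    | a x y where "c = frag_of (a \<odot>\<^bsub>M\<^esub> x, y) - frag_of (x, a \<odot>\<^bsub>L\<^esub> y)"
      "a \<in> carrier R" "x \<in> carrier M" "y \<in> carrier L"
  using assms unfolding tensor_gens_def by blast

lemma tensor_gensI:
  "x \<in> carrier M \<Longrightarrow> x' \<in> carrier M \<Longrightarrow> y \<in> carrier L \<Longrightarrow>
    frag_of (x \<oplus>\<^bsub>M\<^esub> x', y) - frag_of (x, y) - frag_of (x', y) \<in> tensor_gens"
  "x \<in> carrier M \<Longrightarrow> y \<in> carrier L \<Longrightarrow> y' \<in> carrier L \<Longrightarrow>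
    frag_of (x, y \<oplus>\<^bsub>L\<^esub> y') - frag_of (x, y) - frag_of (x, y') \<in> tensor_gens"
  "a \<in> carrier R \<Longrightarrow> x \<in> carrier M \<Longrightarrow> y \<in> carrier L \<Longrightarrow>
    frag_of (a \<odot>\<^bsub>M\<^esub> x, y) - frag_of (x, a \<odot>\<^bsub>L\<^esub> y) \<in> tensor_gens"
  unfolding tensor_gens_def by blast+

lemma T_eq: "T = generate F tensor_gens"
  unfolding tensor_relations_def tensor_gens_def ..

lemma F_diff: "a \<in> carrier F \<Longrightarrow> b \<in> carrier F \<Longrightarrow> a - b \<in> carrier F"
  using keys_diff[of a b] by auto

lemma F_add: "a \<in> carrier F \<Longrightarrow> b \<in> carrier F \<Longrightarrow> a + b \<in> carrier F"
  using keys_add[of a b] by auto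

lemma frag_F: "x \<in> carrier M \<Longrightarrow> y \<in> carrier L \<Longrightarrow> frag_of (x, y) \<in> carrier F"
  by simp

lemma tensor_gens_F: "tensor_gens \<subseteq> carrier F"
  unfolding tensor_gens_def
  by (auto simp del: carrier_free_Abelian_group_iff intro!: F_diff frag_F)

lemma T_subgroup: "subgroup T F"
  unfolding T_eq by (rule group.generate_is_subgroup[OF group_free_Abelian_group tensor_gens_F])

lemma T_normal: "T \<lhd> F"
  by (rule comm_group.subgroup_imp_normal[OF abelian_free_Abelian_group T_subgroup])

lemma T_F: "c \<in> T \<Longrightarrow> c \<in> carrier F"
  using subgroup.subset[OF T_subgroup] by blast

lemma T_zero: "0 \<in> T"
  using subgroup.one_closed[OF T_subgroup] by simp

lemma T_add: "a \<in> T \<Longrightarrow> b \<in> T \<Longrightarrow> a + b \<in> T"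
  using subgroup.m_closed[OF T_subgroup] by simp

lemma T_minus: "a \<in> T \<Longrightarrow> - a \<in> T"
  using subgroup.m_inv_closed[OF T_subgroup, of a] T_F[of a] inv_free_Abelian_group[of a] by simp

lemma T_diff: "a \<in> T \<Longrightarrow> b \<in> T \<Longrightarrow> a - b \<in> T"
  using T_add T_minus by (metis add_uminus_conv_diff)

lemma T_sym: "a - b \<in> T \<Longrightarrow> b - a \<in> T"
  using T_minus by fastforce

lemma T_trans: "a - b \<in> T \<Longrightarrow> b - c \<in> T \<Longrightarrow> a - c \<in> T"
  using T_add by fastforce

lemma T_sum: "(\<And>i. i \<in> I \<Longrightarrow> f i - g i \<in> T) \<Longrightarrow> sum f I - sum g I \<in> T"
proof (induction I rule: infinite_finite_induct)
  case (insert i I)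
  then have "(f i - g i) + (sum f I - sum g I) \<in> T" by (intro T_add) auto
  then show ?case using insert by (simp add: algebra_simps)
qed (auto simp: T_zero)

lemma T_mem_cong: "a - b \<in> T \<Longrightarrow> a \<in> T \<longleftrightarrow> b \<in> T"
  using T_add[of "a - b" b] T_diff[of a "a - b"] by auto

lemma T_gen: "c \<in> tensor_gens \<Longrightarrow> c \<in> T"
  unfolding T_eq by (rule generate.incl)

section \<open>Congruences modulo the tensor relations\<close>

lemma tensor_add_left:
  assumes "x \<in> carrier M" "x' \<in> carrier M" "y \<in> carrier L"
  shows "frag_of (x \<oplus>\<^bsub>M\<^esub> x', y) - (frag_of (x, y) + frag_of (x', y)) \<in> T"
proof -
  have "frag_of (x \<oplus>\<^bsub>M\<^esub> x', y) - frag_of (x, y) - frag_of (x', y) \<in> T"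
    using assms by (intro T_gen tensor_gensI)
  then show ?thesis by (simp add: diff_diff_add)
qed

lemma tensor_add_right:
  assumes "x \<in> carrier M" "y \<in> carrier L" "y' \<in> carrier L"
  shows "frag_of (x, y \<oplus>\<^bsub>L\<^esub> y') - (frag_of (x, y) + frag_of (x, y')) \<in> T"
proof -
  have "frag_of (x, y \<oplus>\<^bsub>L\<^esub> y') - frag_of (x, y) - frag_of (x, y') \<in> T"
    using assms by (intro T_gen tensor_gensI)
  then show ?thesis by (simp add: diff_diff_add)
qed

lemma tensor_smult:
  assumes "a \<in> carrier R" "x \<in> carrier M" "y \<in> carrier L"
  shows "frag_of (a \<odot>\<^bsub>M\<^esub> x, y) - frag_of (x, a \<odot>\<^bsub>L\<^esub> y) \<in> T"
  using assms by (intro T_gen tensor_gensI)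

text \<open>The additivity relation for 0 + 0 = 0 is the negative of the claimed element.\<close>

lemma tensor_zero_left: "y \<in> carrier L \<Longrightarrow> frag_of (\<zero>\<^bsub>M\<^esub>, y) \<in> T"
  using tensor_add_left[of "\<zero>\<^bsub>M\<^esub>" "\<zero>\<^bsub>M\<^esub>" y] T_minus by fastforce

lemma tensor_zero_right: "x \<in> carrier M \<Longrightarrow> frag_of (x, \<zero>\<^bsub>L\<^esub>) \<in> T"
  using tensor_add_right[of x "\<zero>\<^bsub>L\<^esub>" "\<zero>\<^bsub>L\<^esub>"] T_minus by fastforce

lemma tensor_diff_left:
  assumes "x \<in> carrier M" "x' \<in> carrier M" "y \<in> carrier L"
  shows "frag_of (x \<ominus>\<^bsub>M\<^esub> x', y) - (frag_of (x, y) - frag_of (x', y)) \<in> T"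
proof -
  have "frag_of (x, y) - (frag_of (x \<ominus>\<^bsub>M\<^esub> x', y) + frag_of (x', y)) \<in> T"
    using tensor_add_left[of "x \<ominus>\<^bsub>M\<^esub> x'" x' y] assms M.diff_add_cancel by simp
  from T_minus[OF this] show ?thesis by (simp add: algebra_simps)
qed

lemma tensor_sum_left:
  assumes "g \<in> I \<rightarrow> carrier M" "y \<in> carrier L" "finite I"
  shows "frag_of ((\<Oplus>\<^bsub>M\<^esub>i\<in>I. g i), y) - (\<Sum>i\<in>I. frag_of (g i, y)) \<in> T"
  using assms(3,1)
proof (induction I)
  case (insert i I)
  have "frag_of (g i \<oplus>\<^bsub>M\<^esub> (\<Oplus>\<^bsub>M\<^esub>i\<in>I. g i), y) - (frag_of (g i, y) + frag_of ((\<Oplus>\<^bsub>M\<^esub>i\<in>I. g i), y)) \<in> T"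
    using insert assms(2) by (intro tensor_add_left) auto
  from T_add[OF this insert.IH] show ?case using insert by (simp add: algebra_simps)
qed (use tensor_zero_left[OF assms(2)] in simp)

lemma tensor_sum_right:
  assumes "g \<in> I \<rightarrow> carrier L" "x \<in> carrier M" "finite I"
  shows "frag_of (x, (\<Oplus>\<^bsub>L\<^esub>i\<in>I. g i)) - (\<Sum>i\<in>I. frag_of (x, g i)) \<in> T"
  using assms(3,1)
proof (induction I)
  case (insert i I)
  have "frag_of (x, g i \<oplus>\<^bsub>L\<^esub> (\<Oplus>\<^bsub>L\<^esub>i\<in>I. g i)) - (frag_of (x, g i) + frag_of (x, (\<Oplus>\<^bsub>L\<^esub>i\<in>I. g i))) \<in> T"
    using insert assms(2) by (intro tensor_add_right) auto
  from T_add[OF this insert.IH] show ?case using insert by (simp add: algebra_simps)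
qed (use tensor_zero_right[OF assms(2)] in simp)

lemma tensor_lincomb_left:
  assumes "w \<in> {..<n} \<rightarrow> carrier M" "a \<in> {..<n} \<rightarrow> carrier R" "y \<in> carrier L"
  shows "frag_of (lincomb M n w a, y) - (\<Sum>j<n. frag_of (w j, a j \<odot>\<^bsub>L\<^esub> y)) \<in> T"
proof (rule T_trans)
  show "frag_of (lincomb M n w a, y) - (\<Sum>j<n. frag_of (a j \<odot>\<^bsub>M\<^esub> w j, y)) \<in> T"
    unfolding lincomb_def by (rule tensor_sum_left) (use assms in auto)
  show "(\<Sum>j<n. frag_of (a j \<odot>\<^bsub>M\<^esub> w j, y)) - (\<Sum>j<n. frag_of (w j, a j \<odot>\<^bsub>L\<^esub> y)) \<in> T"
    by (rule T_sum, rule tensor_smult) (use assms in auto)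
qed

text \<open>A balanced biadditive map extends to the free abelian group and kills the relations
  because it kills their generators. This is how information is extracted from membership in T: such
  an element has image zero under every h of this kind.\<close>

lemma tensor_universal:
  assumes N: "module R N" and b: "\<And>x y. x \<in> carrier M \<Longrightarrow> y \<in> carrier L \<Longrightarrow> b x y \<in> carrier N"
    and b1: "\<And>x x' y. x \<in> carrier M \<Longrightarrow> x' \<in> carrier M \<Longrightarrow> y \<in> carrier L \<Longrightarrow>
      b (x \<oplus>\<^bsub>M\<^esub> x') y = b x y \<oplus>\<^bsub>N\<^esub> b x' y"
    and b2: "\<And>x y y'. x \<in> carrier M \<Longrightarrow> y \<in> carrier L \<Longrightarrow> y' \<in> carrier L \<Longrightarrow>
      b x (y \<oplus>\<^bsub>L\<^esub> y') = b x y \<oplus>\<^bsub>N\<^esub> b x y'"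
    and b3: "\<And>a x y. a \<in> carrier R \<Longrightarrow> x \<in> carrier M \<Longrightarrow> y \<in> carrier L \<Longrightarrow>
      b (a \<odot>\<^bsub>M\<^esub> x) y = b x (a \<odot>\<^bsub>L\<^esub> y)"
  obtains h where "h \<in> hom F (add_monoid N)"
    "\<And>x y. x \<in> carrier M \<Longrightarrow> y \<in> carrier L \<Longrightarrow> h (frag_of (x, y)) = b x y"
    "\<And>c. c \<in> T \<Longrightarrow> h c = \<zero>\<^bsub>N\<^esub>"
proof -
  interpret N: module R N by fact
  obtain h where h: "h \<in> hom F (add_monoid N)"
    and hf: "\<And>x. x \<in> carrier M \<times> carrier L \<Longrightarrow> h (frag_of x) = (\<lambda>(x, y). b x y) x"
    using comm_group.free_Abelian_group_universal[OF N.M.a_comm_group, of "\<lambda>(x, y). b x y" "carrier M \<times> carrier L"] b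
    by (auto simp: image_subset_iff)
  have hb: "h (frag_of (x, y)) = b x y" if "x \<in> carrier M" "y \<in> carrier L" for x y
    using hf[of "(x, y)"] that by simp
  interpret h: group_hom F "add_monoid N" h
    unfolding group_hom_def group_hom_axioms_def
    by (intro conjI group_free_Abelian_group N.M.a_group h)
  have hd: "h (u - v) = h u \<ominus>\<^bsub>N\<^esub> h v" if u: "u \<in> carrier F" and v: "v \<in> carrier F" for u v
  proof -
    have mv: "- v \<in> carrier F" using v by simp
    have "h (u + - v) = h u \<oplus>\<^bsub>N\<^esub> h (- v)" using h.hom_mult[OF u mv] by simp
    moreover have "h (- v) = \<ominus>\<^bsub>N\<^esub> h v" using h.hom_inv[OF v] v by (simp add: a_inv_def)
    ultimately show ?thesis unfolding a_minus_def by simp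
  qed
  have dd: "(p \<oplus>\<^bsub>N\<^esub> q) \<ominus>\<^bsub>N\<^esub> p \<ominus>\<^bsub>N\<^esub> q = \<zero>\<^bsub>N\<^esub>" if "p \<in> carrier N" "q \<in> carrier N" for p q
  proof -
    have "(p \<oplus>\<^bsub>N\<^esub> q) \<ominus>\<^bsub>N\<^esub> p \<ominus>\<^bsub>N\<^esub> q = (p \<oplus>\<^bsub>N\<^esub> q) \<oplus>\<^bsub>N\<^esub> (\<ominus>\<^bsub>N\<^esub> p \<oplus>\<^bsub>N\<^esub> \<ominus>\<^bsub>N\<^esub> q)"
      unfolding a_minus_def using that by (intro N.M.a_assoc) auto
    also have "\<dots> = \<zero>\<^bsub>N\<^esub>" using that by (simp add: N.M.r_neg flip: N.M.minus_add)
    finally show ?thesis .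
  qed
  have "tensor_gens \<subseteq> kernel F (add_monoid N) h"
  proof
    fix c assume c: "c \<in> tensor_gens"
    then have cF: "c \<in> carrier F" using tensor_gens_F by blast
    have "h c = \<zero>\<^bsub>N\<^esub>" using c
    proof (cases rule: tensor_gens_cases)
      case (1 x x' y)
      have "h c = h (frag_of (x \<oplus>\<^bsub>M\<^esub> x', y)) \<ominus>\<^bsub>N\<^esub> h (frag_of (x, y)) \<ominus>\<^bsub>N\<^esub> h (frag_of (x', y))"
        unfolding 1(1) using 1(2-4) by (simp only: hd F_diff frag_F M.M.add.m_closed)
      then show ?thesis using 1(2-4) by (simp add: hb b b1 dd)
    next
      case (2 x y y')
      have "h c = h (frag_of (x, y \<oplus>\<^bsub>L\<^esub> y')) \<ominus>\<^bsub>N\<^esub> h (frag_of (x, y)) \<ominus>\<^bsub>N\<^esub> h (frag_of (x, y'))"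
        unfolding 2(1) using 2(2-4) by (simp only: hd F_diff frag_F L.M.add.m_closed)
      then show ?thesis using 2(2-4) by (simp add: hb b b2 dd)
    next
      case (3 a x y)
      have "h c = h (frag_of (a \<odot>\<^bsub>M\<^esub> x, y)) \<ominus>\<^bsub>N\<^esub> h (frag_of (x, a \<odot>\<^bsub>L\<^esub> y))"
        unfolding 3(1) using 3(2-4) by (simp only: hd F_diff frag_F M.smult_closed L.smult_closed)
      then show ?thesis using 3(2-4) by (simp add: hb b b3 a_minus_def N.M.r_neg)
    qed
    then show "c \<in> kernel F (add_monoid N) h" using cF unfolding kernel_def by simp
  qed
  then have "T \<subseteq> kernel F (add_monoid N) h"
    unfolding T_eq by (rule group.generate_subgroup_incl[OF group_free_Abelian_group _ h.subgroup_kernel])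
  then have hT: "h c = \<zero>\<^bsub>N\<^esub>" if "c \<in> T" for c using that unfolding kernel_def by auto
  show ?thesis by (rule that[OF h hb hT])
qed

lemma mem_coset_iff: "u \<in> T #>\<^bsub>F\<^esub> c \<longleftrightarrow> u - c \<in> T"
  unfolding r_coset_def by (auto intro: bexI[of _ "u - c"])

lemma coset_eq_iff: "T #>\<^bsub>F\<^esub> c = T #>\<^bsub>F\<^esub> c' \<longleftrightarrow> c - c' \<in> T"
proof
  assume "T #>\<^bsub>F\<^esub> c = T #>\<^bsub>F\<^esub> c'"
  then show "c - c' \<in> T" using mem_coset_iff[of c c] mem_coset_iff[of c c'] T_zero by simp
next
  assume c: "c - c' \<in> T"
  show "T #>\<^bsub>F\<^esub> c = T #>\<^bsub>F\<^esub> c'"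
  proof (rule Set.set_eqI)
    show "u \<in> T #>\<^bsub>F\<^esub> c \<longleftrightarrow> u \<in> T #>\<^bsub>F\<^esub> c'" for u
      unfolding mem_coset_iff using T_trans[OF _ c, of u] T_trans[OF _ T_sym[OF c], of u] by iprover
  qed
qed

lemma coset_zero: "T #>\<^bsub>F\<^esub> 0 = T"
  using mem_coset_iff[of _ 0] by auto

lemma tensor_carrier: "carrier (tensor R M L) = (\<lambda>c. T #>\<^bsub>F\<^esub> c) ` carrier F"
  unfolding tensor_def carrier_FactGroup ..

lemma tensor_one: "\<one>\<^bsub>tensor R M L\<^esub> = T"
  unfolding tensor_def by simp

lemma tensor_mult:
  "c \<in> carrier F \<Longrightarrow> c' \<in> carrier F \<Longrightarrow>
    (T #>\<^bsub>F\<^esub> c) \<otimes>\<^bsub>tensor R M L\<^esub> (T #>\<^bsub>F\<^esub> c') = T #>\<^bsub>F\<^esub> (c + c')"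
  unfolding tensor_def using normal.rcos_sum[OF T_normal, of c c'] by simp

lemma tensor_group: "group (tensor R M L)"
  unfolding tensor_def by (rule normal.factorgroup_is_group[OF T_normal])

end

section \<open>Functoriality of the tensor product in its first argument\<close>

definition frag_map :: "('m \<Rightarrow> 'n) \<Rightarrow> (('m \<times> 'l) \<Rightarrow>\<^sub>0 int) \<Rightarrow> (('n \<times> 'l) \<Rightarrow>\<^sub>0 int)" where
  "frag_map f = frag_extend (\<lambda>(x, y). frag_of (f x, y))"

lemma frag_map_simps [simp]:
  "frag_map f 0 = 0" "frag_map f (frag_of (x, y)) = frag_of (f x, y)"
  "frag_map f (a + b) = frag_map f a + frag_map f b"
  "frag_map f (a - b) = frag_map f a - frag_map f b"
  "frag_map f (- a) = - frag_map f a"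
  by (simp_all add: frag_map_def frag_extend_add frag_extend_diff frag_extend_minus)

locale module_pair_map = M: module_pair R M L + N: module_pair R N L
  for R :: "('a, 'x) ring_scheme" (structure)
    and M :: "('a, 'm, 'y) module_scheme" and N :: "('a, 'n, 'v) module_scheme"
    and L :: "('a, 'l, 'z) module_scheme" +
  fixes f assumes f: "lin_map R M N f"
begin

lemma frag_map_closed:
  assumes "c \<in> carrier M.F"
  shows "frag_map f c \<in> carrier N.F"
proof -
  have "Poly_Mapping.keys c \<subseteq> carrier M \<times> carrier L" using assms by simp
  then show ?thesis
  proof (rule free_Abelian_group_induct[where P = "\<lambda>c. frag_map f c \<in> carrier N.F"])
    fix z assume "z \<in> carrier M \<times> carrier L"
    then obtain x y where "z = (x, y)" "x \<in> carrier M" "y \<in> carrier L" by blast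
    then show "frag_map f (frag_of z) \<in> carrier N.F" using lin_map_closed[OF f] by simp
  next
    fix c c' assume "frag_map f c \<in> carrier N.F" "frag_map f c' \<in> carrier N.F"
    then show "frag_map f (c - c') \<in> carrier N.F" using N.F_diff by (simp only: frag_map_simps)
  qed simp
qed

lemma frag_map_relations: "c \<in> M.T \<Longrightarrow> frag_map f c \<in> N.T"
proof -
  let ?K = "{c \<in> carrier M.F. frag_map f c \<in> N.T}"
  have "subgroup ?K M.F"
  proof (rule group.subgroupI[OF group_free_Abelian_group])
    have "0 \<in> ?K" using N.T_zero by simp
    then show "?K \<noteq> {}" by blast
  qed (use M.F_add N.T_add N.T_minus in auto)
  moreover have "M.tensor_gens \<subseteq> ?K"
  proof
    fix c assume c: "c \<in> M.tensor_gens"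
    then have "c \<in> carrier M.F" using M.tensor_gens_F by blast
    moreover have "frag_map f c \<in> N.tensor_gens"
      using c
      by (cases rule: M.tensor_gens_cases)
        (simp_all add: lin_map_add[OF f] lin_map_smult[OF f] lin_map_closed[OF f] N.tensor_gensI)
    ultimately show "c \<in> ?K" using N.T_gen by blast
  qed
  ultimately have "M.T \<subseteq> ?K"
    unfolding M.T_eq using group.generate_subgroup_incl[OF group_free_Abelian_group] by blast
  then show "c \<in> M.T \<Longrightarrow> frag_map f c \<in> N.T" by blast
qed

lemma tensor_map_coset: "tensor_map R N L f (M.T #>\<^bsub>M.F\<^esub> c) = N.T #>\<^bsub>N.F\<^esub> frag_map f c"
proof -
  have eq: "N.T #>\<^bsub>N.F\<^esub> frag_map f u = N.T #>\<^bsub>N.F\<^esub> frag_map f c" if "u \<in> M.T #>\<^bsub>M.F\<^esub> c" for u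
    using frag_map_relations[of "u - c"] that unfolding M.mem_coset_iff N.coset_eq_iff by simp
  have c: "c \<in> M.T #>\<^bsub>M.F\<^esub> c" using M.mem_coset_iff M.T_zero by simp
  show ?thesis
    unfolding tensor_map_def frag_map_def[symmetric] using eq c by blast
qed

lemma tensor_map_hom: "tensor_map R N L f \<in> hom (tensor R M L) (tensor R N L)"
proof (rule homI)
  fix C assume "C \<in> carrier (tensor R M L)"
  then obtain c where "c \<in> carrier M.F" "C = M.T #>\<^bsub>M.F\<^esub> c" unfolding M.tensor_carrier by blast
  then show "tensor_map R N L f C \<in> carrier (tensor R N L)"
    unfolding N.tensor_carrier using frag_map_closed tensor_map_coset by blast
next
  fix C D assume "C \<in> carrier (tensor R M L)" "D \<in> carrier (tensor R M L)"
  then obtain c d where cd: "c \<in> carrier M.F" "C = M.T #>\<^bsub>M.F\<^esub> c" "d \<in> carrier M.F" "D = M.T #>\<^bsub>M.F\<^esub> d"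
    unfolding M.tensor_carrier by blast
  show "tensor_map R N L f (C \<otimes>\<^bsub>tensor R M L\<^esub> D) =
    tensor_map R N L f C \<otimes>\<^bsub>tensor R N L\<^esub> tensor_map R N L f D"
    unfolding cd M.tensor_mult[OF cd(1,3)] tensor_map_coset
      N.tensor_mult[OF frag_map_closed[OF cd(1)] frag_map_closed[OF cd(3)]] by simp
qed

lemma tensor_map_group_hom: "group_hom (tensor R M L) (tensor R N L) (tensor_map R N L f)"
  unfolding group_hom_def group_hom_axioms_def
  by (intro conjI M.tensor_group N.tensor_group tensor_map_hom)

end

section \<open>Tor with coefficients in the cokernel of a dual map\<close>

lemma frag_map_sum: "frag_map f (sum g I) = (\<Sum>i\<in>I. frag_map f (g i))"
  by (induction I rule: infinite_finite_induct) simp_all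

lemma (in module_pair) hom_sum:
  assumes N: "module R N" and h: "h \<in> hom F (add_monoid N)" and g: "\<And>i. i \<in> I \<Longrightarrow> g i \<in> carrier F"
    and I: "finite I"
  shows "h (sum g I) = (\<Oplus>\<^bsub>N\<^esub>i\<in>I. h (g i))"
proof -
  interpret N: module R N by fact
  interpret h: group_hom F "add_monoid N" h
    unfolding group_hom_def group_hom_axioms_def
    by (intro conjI group_free_Abelian_group N.M.a_group h)
  have hc: "h (g i) \<in> carrier N" if "i \<in> I" for i using h.hom_closed[OF g[OF that]] by simp
  show ?thesis using I g hc
  proof (induction I)
    case empty
    then show ?case using h.hom_one by simp
  next
    case (insert i I)
    have s: "sum g I \<in> carrier F" by (rule sum_closed_free_Abelian_group) (use insert in blast)
    have gi: "g i \<in> carrier F" using insert by blast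
    have "h (g i + sum g I) = h (g i) \<oplus>\<^bsub>N\<^esub> h (sum g I)" using h.hom_mult[OF gi s] by simp
    moreover have "h (sum g I) = (\<Oplus>\<^bsub>N\<^esub>i\<in>I. h (g i))" using insert by blast
    ultimately show ?case using insert by (simp add: N.M.finsum_insert Pi_iff)
  qed
qed

lemma (in group) trivial_Mod_carrier: "trivial_group (G Mod carrier G)"
proof -
  have "group (G Mod carrier G)"
    by (rule normal.factorgroup_is_group, rule normal_invI) (auto intro: subgroup_self)
  moreover have "carrier (G Mod carrier G) = {carrier G}"
    unfolding carrier_FactGroup using coset_join2[OF _ subgroup_self] by auto
  ultimately show ?thesis unfolding trivial_group_def by simp
qed

section \<open>The cokernel X of a dual map and the tensor products of A^b with X\<close>

locale dual_cokernel = cring R for R :: "('a, 'x) ring_scheme" (structure) +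
  fixes p q :: nat and d :: "(nat \<Rightarrow> 'a) \<Rightarrow> (nat \<Rightarrow> 'a)"
  assumes d: "lin_map R (free_mod R q) (free_mod R p) d"
begin

text \<open>The dual of A^q is identified with A^q by the values on unit vectors. Under this
  identification the set is the image of the dual of d, since \<zeta> is sent to \<zeta> after
  d.\<close>

definition dual_image where
  "dual_image = {(\<lambda>l\<in>{..<q}. \<zeta> (d (unitv R q l))) | \<zeta>. lin_map R (free_mod R p) (reg_mod R) \<zeta>}"

definition coker :: "('a, (nat \<Rightarrow> 'a) set) module" where
  "coker = quotient_module (free_mod R q) dual_image"

definition cls where
  "cls = quot_class (free_mod R q) dual_image"

text \<open>A representative of the image of v under the identification of Hom(A^q, A^b) with A^b
  tensored with the dual of A^q, followed by the projection to A^b tensored with X. The classes of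
  the unit vectors are those of the dual basis.\<close>

definition theta :: "((nat \<Rightarrow> 'a) \<Rightarrow> (nat \<Rightarrow> 'a)) \<Rightarrow> ((nat \<Rightarrow> 'a) \<times> (nat \<Rightarrow> 'a) set) \<Rightarrow>\<^sub>0 int" where
  "theta v = (\<Sum>l<q. frag_of (v (unitv R q l), cls (unitv R q l)))"

lemma dc: "x \<in> carrier (free_mod R q) \<Longrightarrow> d x \<in> carrier (free_mod R p)"
  by (rule lin_map_closed[OF d])

lemma dual_image_submodule: "submodule dual_image R (free_mod R q)"
proof -
  interpret V: module R "free_mod R q" by (rule free_mod_module)
  interpret S: module R "reg_mod R" by (rule reg_mod_module)
  let ?f = "\<lambda>\<zeta>. \<lambda>l\<in>{..<q}. \<zeta> (d (unitv R q l))"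
  have I: "?f \<zeta> \<in> dual_image" if "lin_map R (free_mod R p) (reg_mod R) \<zeta>" for \<zeta>
    using that unfolding dual_image_def by blast
  have sub: "dual_image \<subseteq> carrier (free_mod R q)"
  proof
    fix x assume "x \<in> dual_image"
    then obtain \<zeta> where \<zeta>: "lin_map R (free_mod R p) (reg_mod R) \<zeta>" "x = ?f \<zeta>" unfolding dual_image_def by blast
    show "x \<in> carrier (free_mod R q)"
      unfolding \<zeta>(2) using lin_map_closed[OF \<zeta>(1) dc[OF unitv_closed]] by simp
  qed
  show ?thesis
  proof (rule V.submoduleI)
    show "dual_image \<subseteq> carrier (free_mod R q)" by (rule sub)
    have z: "lin_map R (free_mod R p) (reg_mod R) (\<lambda>_. \<zero>)"
      using lin_map_zero_map[OF reg_mod_module] by simp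
    show "\<zero>\<^bsub>free_mod R q\<^esub> \<in> dual_image" using I[OF z] by simp
  next
    fix a assume "a \<in> dual_image"
    then obtain \<zeta> where \<zeta>: "lin_map R (free_mod R p) (reg_mod R) \<zeta>" "a = ?f \<zeta>" unfolding dual_image_def by blast
    have "\<ominus>\<^bsub>free_mod R q\<^esub> a = ?f (\<lambda>x. \<ominus>\<^bsub>reg_mod R\<^esub> \<zeta> x)"
    proof (rule V.M.add.inv_equality[symmetric, THEN sym])
      have c: "\<zeta> (d (unitv R q l)) \<in> carrier (reg_mod R)" for l
        by (rule lin_map_closed[OF \<zeta>(1) dc[OF unitv_closed]])
      have "\<ominus>\<^bsub>reg_mod R\<^esub> \<zeta> (d (unitv R q l)) \<oplus> \<zeta> (d (unitv R q l)) = \<zero>" for l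
        using S.M.l_neg[OF c] by simp
      then show "?f (\<lambda>x. \<ominus>\<^bsub>reg_mod R\<^esub> \<zeta> x) \<oplus>\<^bsub>free_mod R q\<^esub> a = \<zero>\<^bsub>free_mod R q\<^esub>"
        unfolding \<zeta>(2) by (auto intro!: restrict_ext)
      show "a \<in> carrier (free_mod R q)" using \<open>a \<in> dual_image\<close> sub by blast
      show "?f (\<lambda>x. \<ominus>\<^bsub>reg_mod R\<^esub> \<zeta> x) \<in> carrier (free_mod R q)"
        using S.M.a_inv_closed[OF c] by simp
    qed
    then show "\<ominus>\<^bsub>free_mod R q\<^esub> a \<in> dual_image"
      using I[OF lin_map_uminus[OF free_mod_module reg_mod_module \<zeta>(1)]] by simp
  next
    fix a b assume "a \<in> dual_image" "b \<in> dual_image"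
    then obtain \<zeta> \<xi> where \<zeta>: "lin_map R (free_mod R p) (reg_mod R) \<zeta>" "a = ?f \<zeta>"
      and \<xi>: "lin_map R (free_mod R p) (reg_mod R) \<xi>" "b = ?f \<xi>" unfolding dual_image_def by blast
    have "a \<oplus>\<^bsub>free_mod R q\<^esub> b = ?f (\<lambda>x. \<zeta> x \<oplus>\<^bsub>reg_mod R\<^esub> \<xi> x)"
      unfolding \<zeta>(2) \<xi>(2) by (auto intro!: restrict_ext)
    then show "a \<oplus>\<^bsub>free_mod R q\<^esub> b \<in> dual_image"
      using I[OF lin_map_plus[OF free_mod_module reg_mod_module \<zeta>(1) \<xi>(1)]] by simp
  next
    fix a x assume a: "a \<in> carrier R" and "x \<in> dual_image"
    then obtain \<zeta> where \<zeta>: "lin_map R (free_mod R p) (reg_mod R) \<zeta>" "x = ?f \<zeta>" unfolding dual_image_def by blast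
    have l: "lin_map R (free_mod R p) (reg_mod R) (\<lambda>x. a \<otimes> \<zeta> x)"
      using \<zeta>(1) a unfolding lin_map_def by (auto simp: Pi_iff r_distr m_lcomm)
    have "a \<odot>\<^bsub>free_mod R q\<^esub> x = ?f (\<lambda>x. a \<otimes> \<zeta> x)"
      unfolding \<zeta>(2) by (auto intro!: restrict_ext)
    then show "a \<odot>\<^bsub>free_mod R q\<^esub> x \<in> dual_image" using I[OF l] by simp
  qed
qed

lemma coker_module: "module R coker"
  unfolding coker_def by (rule module.quotient_module[OF free_mod_module dual_image_submodule])

lemma cls_lin_map: "lin_map R (free_mod R q) coker cls"
  unfolding coker_def cls_def by (rule module.quot_class_lin_map[OF free_mod_module dual_image_submodule])

lemma coker_carrier: "carrier coker = cls ` carrier (free_mod R q)"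
  unfolding coker_def cls_def
  by (rule module.quotient_carrier[OF free_mod_module dual_image_submodule])

lemma cls_zero_iff: "x \<in> carrier (free_mod R q) \<Longrightarrow> cls x = \<zero>\<^bsub>coker\<^esub> \<longleftrightarrow> x \<in> dual_image"
  unfolding coker_def cls_def
  by (rule module.quot_class_zero_iff[OF free_mod_module dual_image_submodule])

lemma coker_fin_gen: "fin_gen R coker"
  by (rule module.fin_gen_if_image[OF coker_module cls_lin_map coker_carrier[symmetric]])

lemma cls_unitv: "cls (unitv R q l) \<in> carrier coker"
  by (rule lin_map_closed[OF cls_lin_map unitv_closed])

lemma cls_expand:
  "x \<in> carrier (free_mod R q) \<Longrightarrow> cls x = (\<Oplus>\<^bsub>coker\<^esub>l\<in>{..<q}. x l \<odot>\<^bsub>coker\<^esub> cls (unitv R q l))"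
  using lin_map_lincomb[OF coker_module cls_lin_map] unfolding lincomb_def .

lemma module_pair_coker: "module R M \<Longrightarrow> module_pair R M coker"
  unfolding module_pair_def using coker_module by blast

lemma theta_closed:
  assumes "lin_map R (free_mod R q) (free_mod R b) v"
  shows "theta v \<in> carrier (free_Abelian_group (carrier (free_mod R b) \<times> carrier coker))"
  unfolding theta_def
proof (rule sum_closed_free_Abelian_group)
  fix l
  show "frag_of (v (unitv R q l), cls (unitv R q l))
      \<in> carrier (free_Abelian_group (carrier (free_mod R b) \<times> carrier coker))"
    using lin_map_closed[OF assms unitv_closed] cls_unitv by (simp del: free_mod_simps)
qed

lemma theta_diff:
  assumes v: "lin_map R (free_mod R q) (free_mod R b) v" and w: "lin_map R (free_mod R q) (free_mod R b) w"
  shows "theta (\<lambda>x. v x \<ominus>\<^bsub>free_mod R b\<^esub> w x) - (theta v - theta w)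
    \<in> tensor_relations R (free_mod R b) coker"
proof -
  interpret P: module_pair R "free_mod R b" coker by (rule module_pair_coker[OF free_mod_module])
  have "theta v - theta w =
      (\<Sum>l<q. frag_of (v (unitv R q l), cls (unitv R q l)) - frag_of (w (unitv R q l), cls (unitv R q l)))"
    unfolding theta_def by (rule sum_subtractf[symmetric])
  moreover have "theta (\<lambda>x. v x \<ominus>\<^bsub>free_mod R b\<^esub> w x) -
      (\<Sum>l<q. frag_of (v (unitv R q l), cls (unitv R q l)) - frag_of (w (unitv R q l), cls (unitv R q l)))
      \<in> P.T"
    unfolding theta_def
    by (intro P.T_sum P.tensor_diff_left lin_map_closed[OF v unitv_closed] lin_map_closed[OF w unitv_closed]
        cls_unitv)
  ultimately show ?thesis by simp
qed

text \<open>A generator x tensored with the class of y is rewritten, by expanding y in unit vectors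
  and moving the coefficients to the left, as theta of the map that sends the l-th unit vector to
  y_l x. Differences are covered by \<open>theta_diff\<close>.\<close>

lemma theta_onto:
  assumes "c \<in> carrier (free_Abelian_group (carrier (free_mod R b) \<times> carrier coker))"
  shows "\<exists>v. lin_map R (free_mod R q) (free_mod R b) v \<and>
    c - theta v \<in> tensor_relations R (free_mod R b) coker"
proof -
  interpret P: module_pair R "free_mod R b" coker by (rule module_pair_coker[OF free_mod_module])
  have "Poly_Mapping.keys c \<subseteq> carrier (free_mod R b) \<times> carrier coker" using assms by simp
  then show ?thesis
  proof (rule free_Abelian_group_induct[where P = "\<lambda>c. \<exists>v. lin_map R (free_mod R q) (free_mod R b) v \<and>
      c - theta v \<in> tensor_relations R (free_mod R b) coker"])
    let ?z = "\<lambda>_. \<zero>\<^bsub>free_mod R b\<^esub>"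
    have "lin_map R (free_mod R q) (free_mod R b) ?z"
      by (rule lin_map_zero_map[OF free_mod_module])
    moreover have "theta ?z - (\<Sum>l<q. 0) \<in> P.T"
      unfolding theta_def by (rule P.T_sum) (use P.tensor_zero_left[OF cls_unitv] in simp)
    then have "0 - theta ?z \<in> P.T" using P.T_minus by fastforce
    ultimately show "\<exists>v. lin_map R (free_mod R q) (free_mod R b) v \<and> 0 - theta v \<in> P.T" by blast
  next
    fix c c'
    assume "\<exists>v. lin_map R (free_mod R q) (free_mod R b) v \<and> c - theta v \<in> P.T"
      "\<exists>v. lin_map R (free_mod R q) (free_mod R b) v \<and> c' - theta v \<in> P.T"
    then obtain v v' where v: "lin_map R (free_mod R q) (free_mod R b) v" "c - theta v \<in> P.T"
      and v': "lin_map R (free_mod R q) (free_mod R b) v'" "c' - theta v' \<in> P.T" by blast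
    let ?u = "\<lambda>x. v x \<ominus>\<^bsub>free_mod R b\<^esub> v' x"
    have "lin_map R (free_mod R q) (free_mod R b) ?u"
      by (rule lin_map_diff[OF free_mod_module free_mod_module v(1) v'(1)])
    moreover have "(c - theta v) - (c' - theta v') - (theta ?u - (theta v - theta v')) \<in> P.T"
      by (intro P.T_diff v(2) v'(2) theta_diff v(1) v'(1))
    then have "(c - c') - theta ?u \<in> P.T" by (simp add: algebra_simps)
    ultimately show "\<exists>v. lin_map R (free_mod R q) (free_mod R b) v \<and> c - c' - theta v \<in> P.T" by blast
  next
    fix z assume "z \<in> carrier (free_mod R b) \<times> carrier coker"
    then obtain x y where x: "x \<in> carrier (free_mod R b)" and y: "y \<in> carrier (free_mod R q)"
      and z: "z = (x, cls y)" unfolding coker_carrier by (elim SigmaE imageE) simp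
    have yl: "y l \<in> carrier R" if "l < q" for l using y that by auto
    define w where "w l = y l \<odot>\<^bsub>free_mod R b\<^esub> x" for l
    have w: "w \<in> {..<q} \<rightarrow> carrier (free_mod R b)"
      unfolding w_def using P.M.smult_closed[OF yl x] by (simp del: free_mod_simps)
    let ?v = "lincomb (free_mod R b) q w"
    have "lin_map R (free_mod R q) (free_mod R b) ?v" by (rule P.M.lincomb_lin_map[OF w])
    moreover have "frag_of z - theta ?v \<in> P.T"
    proof (rule P.T_trans)
      show "frag_of z - (\<Sum>l<q. frag_of (x, y l \<odot>\<^bsub>coker\<^esub> cls (unitv R q l))) \<in> P.T"
        unfolding z cls_expand[OF y]
        by (rule P.tensor_sum_right) (use yl x P.L.smult_closed cls_unitv in auto)
      have "theta ?v - (\<Sum>l<q. frag_of (x, y l \<odot>\<^bsub>coker\<^esub> cls (unitv R q l))) \<in> P.T"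
        unfolding theta_def
      proof (rule P.T_sum)
        fix l assume "l \<in> {..<q}"
        then have l: "l < q" by simp
        show "frag_of (?v (unitv R q l), cls (unitv R q l)) -
          frag_of (x, y l \<odot>\<^bsub>coker\<^esub> cls (unitv R q l)) \<in> P.T"
          unfolding P.M.lincomb_unitv[OF w l] w_def by (rule P.tensor_smult[OF yl[OF l] x cls_unitv])
      qed
      then show "(\<Sum>l<q. frag_of (x, y l \<odot>\<^bsub>coker\<^esub> cls (unitv R q l))) - theta ?v \<in> P.T" by (rule P.T_sym)
    qed
    ultimately show "\<exists>v. lin_map R (free_mod R q) (free_mod R b) v \<and> frag_of z - theta v \<in> P.T" by blast
  qed
qed

text \<open>This is right exactness of the tensor product: the kernel of Hom(A^q, A^b) to A^b
  tensored with X is the image of Hom(A^p, A^b). From left to right, each coordinate of v gives the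
  zero class in X and so factors through d; the b factorizations are the coordinates of w. From
  right to left, w after d is expanded and its coefficients are moved into X.\<close>

lemma theta_relation_iff:
  assumes v: "lin_map R (free_mod R q) (free_mod R b) v"
  shows "theta v \<in> tensor_relations R (free_mod R b) coker \<longleftrightarrow>
    (\<exists>w. lin_map R (free_mod R p) (free_mod R b) w \<and> (\<forall>x\<in>carrier (free_mod R q). v x = w (d x)))"
    (is "?L \<longleftrightarrow> ?E")
proof
  interpret P: module_pair R "free_mod R b" coker by (rule module_pair_coker[OF free_mod_module])
  have vl: "v (unitv R q l) \<in> carrier (free_mod R b)" for l by (rule lin_map_closed[OF v unitv_closed])
  {
    assume L: ?L
    have "\<exists>\<zeta>. lin_map R (free_mod R p) (reg_mod R) \<zeta> \<and>
      (\<forall>l<q. v (unitv R q l) i = \<zeta> (d (unitv R q l)))" if i: "i < b" for i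
    proof -
      have xi: "x i \<in> carrier R" if "x \<in> carrier (free_mod R b)" for x using that i by auto
      \<comment> \<open>The i-th coordinate functional on A^b induces a map from A^b tensored with X
        to X. It takes theta v to the class of the i-th coordinate of v, read as a functional on
        A^q.\<close>
      obtain h where h: "h \<in> hom P.F (add_monoid coker)"
        and hb: "\<And>x y. x \<in> carrier (free_mod R b) \<Longrightarrow> y \<in> carrier coker \<Longrightarrow>
          h (frag_of (x, y)) = x i \<odot>\<^bsub>coker\<^esub> y"
        and hT: "\<And>c. c \<in> P.T \<Longrightarrow> h c = \<zero>\<^bsub>coker\<^esub>"
      proof (rule P.tensor_universal[OF coker_module, of "\<lambda>x y. x i \<odot>\<^bsub>coker\<^esub> y"])
        fix a x y assume a: "a \<in> carrier R" and x: "x \<in> carrier (free_mod R b)" and y: "y \<in> carrier coker"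
        have "(a \<odot>\<^bsub>free_mod R b\<^esub> x) i = x i \<otimes> a" using i xi[OF x] a by (simp add: m_comm)
        then show "(a \<odot>\<^bsub>free_mod R b\<^esub> x) i \<odot>\<^bsub>coker\<^esub> y = x i \<odot>\<^bsub>coker\<^esub> (a \<odot>\<^bsub>coker\<^esub> y)"
          using P.L.smult_assoc1[OF xi[OF x] a y] by simp
      next
        fix x x' y assume x: "x \<in> carrier (free_mod R b)" and x': "x' \<in> carrier (free_mod R b)"
          and y: "y \<in> carrier coker"
        have "(x \<oplus>\<^bsub>free_mod R b\<^esub> x') i = x i \<oplus> x' i" using i by simp
        then show "(x \<oplus>\<^bsub>free_mod R b\<^esub> x') i \<odot>\<^bsub>coker\<^esub> y = x i \<odot>\<^bsub>coker\<^esub> y \<oplus>\<^bsub>coker\<^esub> x' i \<odot>\<^bsub>coker\<^esub> y"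
          using P.L.smult_l_distr[OF xi[OF x] xi[OF x'] y] by simp
      qed (use xi P.L.smult_r_distr in \<open>auto simp del: free_mod_simps\<close>)
      let ?c = "\<lambda>l\<in>{..<q}. v (unitv R q l) i"
      have c: "?c \<in> carrier (free_mod R q)" using xi[OF vl] by auto
      have "\<zero>\<^bsub>coker\<^esub> = h (theta v)" using hT[OF L] by simp
      also have "\<dots> = (\<Oplus>\<^bsub>coker\<^esub>l\<in>{..<q}. h (frag_of (v (unitv R q l), cls (unitv R q l))))"
        unfolding theta_def
        by (rule P.hom_sum[OF coker_module h P.frag_F[OF vl cls_unitv]]) simp
      also have "\<dots> = (\<Oplus>\<^bsub>coker\<^esub>l\<in>{..<q}. ?c l \<odot>\<^bsub>coker\<^esub> cls (unitv R q l))"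
        by (rule P.L.M.finsum_cong')
          (use hb[OF vl cls_unitv] P.L.smult_closed[OF xi[OF vl] cls_unitv] in \<open>auto simp del: free_mod_simps\<close>)
      also have "\<dots> = cls ?c" by (rule cls_expand[OF c, symmetric])
      finally have "?c \<in> dual_image" using cls_zero_iff[OF c] by simp
      then obtain \<zeta> where \<zeta>: "lin_map R (free_mod R p) (reg_mod R) \<zeta>"
        "?c = (\<lambda>l\<in>{..<q}. \<zeta> (d (unitv R q l)))" unfolding dual_image_def by blast
      have "v (unitv R q l) i = \<zeta> (d (unitv R q l))" if "l < q" for l
        using fun_cong[OF \<zeta>(2), of l] that by simp
      then show ?thesis using \<zeta>(1) by blast
    qed
    then obtain \<zeta> where \<zeta>: "\<And>i. i < b \<Longrightarrow> lin_map R (free_mod R p) (reg_mod R) (\<zeta> i)"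
      "\<And>i l. i < b \<Longrightarrow> l < q \<Longrightarrow> v (unitv R q l) i = \<zeta> i (d (unitv R q l))" by metis
    define w where "w x = (\<lambda>i\<in>{..<b}. \<zeta> i x)" for x
    have w: "lin_map R (free_mod R p) (free_mod R b) w"
      unfolding lin_map_def
    proof (intro conjI ballI)
      show "w \<in> carrier (free_mod R p) \<rightarrow> carrier (free_mod R b)"
        unfolding w_def using lin_map_closed[OF \<zeta>(1)] by fastforce
    next
      fix x y assume "x \<in> carrier (free_mod R p)" "y \<in> carrier (free_mod R p)"
      then show "w (x \<oplus>\<^bsub>free_mod R p\<^esub> y) = w x \<oplus>\<^bsub>free_mod R b\<^esub> w y"
        unfolding w_def using lin_map_add[OF \<zeta>(1)] by (auto intro!: restrict_ext)
    next
      fix a x assume "a \<in> carrier R" "x \<in> carrier (free_mod R p)"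
      then show "w (a \<odot>\<^bsub>free_mod R p\<^esub> x) = a \<odot>\<^bsub>free_mod R b\<^esub> w x"
        unfolding w_def using lin_map_smult[OF \<zeta>(1)] by (auto intro!: restrict_ext)
    qed
    have "v (unitv R q l) = w (d (unitv R q l))" if l: "l < q" for l
    proof
      fix i
      show "v (unitv R q l) i = w (d (unitv R q l)) i"
        using vl[of l] \<zeta>(2)[OF _ l, of i] by (auto simp: w_def PiE_iff extensional_def)
    qed
    then have "v x = w (d x)" if "x \<in> carrier (free_mod R q)" for x
      by (rule lin_map_ext[OF free_mod_module v lin_map_comp[OF d w] _ that])
    then show ?E using w by blast
  next
    assume ?E
    then obtain w where w: "lin_map R (free_mod R p) (free_mod R b) w"
      and vw: "\<And>x. x \<in> carrier (free_mod R q) \<Longrightarrow> v x = w (d x)" by blast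
    have wj: "w (unitv R p j) \<in> carrier (free_mod R b)" for j by (rule lin_map_closed[OF w unitv_closed])
    have dl: "d (unitv R q l) j \<in> carrier R" if "j < p" for l j using dc[OF unitv_closed, of l] that by auto
    define G where "G l j = frag_of (w (unitv R p j), d (unitv R q l) j \<odot>\<^bsub>coker\<^esub> cls (unitv R q l))" for l j
    have 1: "theta v - (\<Sum>l<q. \<Sum>j<p. G l j) \<in> P.T"
      unfolding theta_def
    proof (rule P.T_sum)
      fix l
      have "v (unitv R q l) = lincomb (free_mod R b) p (\<lambda>j. w (unitv R p j)) (d (unitv R q l))"
        unfolding vw[OF unitv_closed] by (rule lin_map_lincomb[OF free_mod_module w dc[OF unitv_closed]])
      then show "frag_of (v (unitv R q l), cls (unitv R q l)) - (\<Sum>j<p. G l j) \<in> P.T"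
        unfolding G_def using P.tensor_lincomb_left[of "\<lambda>j. w (unitv R p j)" p "d (unitv R q l)"] wj dl cls_unitv
        by (simp add: Pi_iff del: free_mod_simps)
    qed
    \<comment> \<open>With the sums exchanged, the inner one is the image of the j-th unit vector
      under w tensored with the class of the j-th coordinate of d. That class is zero in X, because
      a coordinate of d is a functional composed with d.\<close>
    have "(\<Sum>j<p. \<Sum>l<q. G l j) - (\<Sum>j<p. 0) \<in> P.T"
    proof (rule P.T_sum)
      fix j assume "j \<in> {..<p}"
      then have j: "j < p" by simp
      let ?c = "\<lambda>l\<in>{..<q}. d (unitv R q l) j"
      have c: "?c \<in> carrier (free_mod R q)" using dl[OF j] by auto
      have "?c \<in> dual_image" 
        unfolding dual_image_def
        by (intro CollectI exI[of _ "\<lambda>x. x j"] conjI refl lin_map_coord[OF j])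
      then have "\<zero>\<^bsub>coker\<^esub> = (\<Oplus>\<^bsub>coker\<^esub>l\<in>{..<q}. ?c l \<odot>\<^bsub>coker\<^esub> cls (unitv R q l))"
        using cls_zero_iff[OF c] cls_expand[OF c] by simp
      also have "\<dots> = (\<Oplus>\<^bsub>coker\<^esub>l\<in>{..<q}. d (unitv R q l) j \<odot>\<^bsub>coker\<^esub> cls (unitv R q l))"
        by (rule P.L.M.finsum_cong') (use P.L.smult_closed[OF dl[OF j] cls_unitv] in auto)
      finally have "frag_of (w (unitv R p j), \<zero>\<^bsub>coker\<^esub>) - (\<Sum>l<q. G l j) \<in> P.T"
        unfolding G_def using P.L.smult_closed[OF dl[OF j] cls_unitv] wj[of j]
        by (simp add: P.tensor_sum_right del: free_mod_simps)
      from P.T_mem_cong[OF this] P.tensor_zero_right[OF wj]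
      show "(\<Sum>l<q. G l j) - 0 \<in> P.T" by simp
    qed
    then have "(\<Sum>l<q. \<Sum>j<p. G l j) \<in> P.T" by (subst sum.swap) simp
    then show ?L using P.T_mem_cong[OF 1] by simp
  }
qed

text \<open>Through theta, the cycles in A^b tensored with X are the maps v for which e after v
  factors through d (\<open>K\<close>), the boundaries are the maps e' after u (\<open>I\<close>),
  and two maps have the same class when they differ by one that factors through d
  (\<open>rel\<close>). Triviality of the homology then reads as \<open>tor_exact\<close>.\<close>

lemma tor_trivial_iff:
  assumes e: "lin_map R (free_mod R b) (free_mod R a) e"
    and e': "lin_map R (free_mod R c) (free_mod R b) e'"
    and ee: "\<And>x. x \<in> carrier (free_mod R c) \<Longrightarrow> e (e' x) = \<zero>\<^bsub>free_mod R a\<^esub>"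
  shows "trivial_group ((tensor R (free_mod R b) coker)
      \<lparr>carrier := kernel (tensor R (free_mod R b) coker) (tensor R (free_mod R a) coker)
        (tensor_map R (free_mod R a) coker e)\<rparr>
    Mod (tensor_map R (free_mod R b) coker e' ` carrier (tensor R (free_mod R c) coker)))
    \<longleftrightarrow> tor_exact R p q d a b c e e'" (is "trivial_group (?G Mod ?I) \<longleftrightarrow> ?E")
proof -
  interpret A: module_pair R "free_mod R a" coker by (rule module_pair_coker[OF free_mod_module])
  interpret B: module_pair R "free_mod R b" coker by (rule module_pair_coker[OF free_mod_module])
  interpret C: module_pair R "free_mod R c" coker by (rule module_pair_coker[OF free_mod_module])
  interpret E: module_pair_map R "free_mod R b" "free_mod R a" coker e
    by unfold_locales (rule e)
  interpret E': module_pair_map R "free_mod R c" "free_mod R b" coker e'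
    by unfold_locales (rule e')
  interpret h: group_hom "tensor R (free_mod R b) coker" "tensor R (free_mod R a) coker"
    "tensor_map R (free_mod R a) coker e" by (rule E.tensor_map_group_hom)
  have G: "group ?G" by (rule subgroup.subgroup_is_group[OF h.subgroup_kernel B.tensor_group])
  have frag_theta: "frag_map f (theta v) = theta (\<lambda>x. f (v x))" for f v
    unfolding theta_def frag_map_sum by simp
  have K: "C \<in> carrier ?G \<longleftrightarrow> (\<exists>v. lin_map R (free_mod R q) (free_mod R b) v \<and>
      C = B.T #>\<^bsub>B.F\<^esub> theta v \<and> theta (\<lambda>x. e (v x)) \<in> A.T)" for C
  proof
    assume "C \<in> carrier ?G"
    then have "C \<in> carrier (tensor R (free_mod R b) coker)" and hC: "tensor_map R (free_mod R a) coker e C = A.T"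
      unfolding kernel_def by (auto simp: A.tensor_one)
    then obtain u where u: "u \<in> carrier B.F" "C = B.T #>\<^bsub>B.F\<^esub> u" unfolding B.tensor_carrier by blast
    obtain v where v: "lin_map R (free_mod R q) (free_mod R b) v" "u - theta v \<in> B.T"
      using theta_onto[OF u(1)] by blast
    have C: "C = B.T #>\<^bsub>B.F\<^esub> theta v" using v(2) unfolding u(2) B.coset_eq_iff .
    have "A.T #>\<^bsub>A.F\<^esub> theta (\<lambda>x. e (v x)) = A.T #>\<^bsub>A.F\<^esub> 0"
      using hC unfolding C E.tensor_map_coset frag_theta A.coset_zero .
    then have "theta (\<lambda>x. e (v x)) \<in> A.T" unfolding A.coset_eq_iff by simp
    then show "\<exists>v. lin_map R (free_mod R q) (free_mod R b) v \<and>
      C = B.T #>\<^bsub>B.F\<^esub> theta v \<and> theta (\<lambda>x. e (v x)) \<in> A.T" using v(1) C by blast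
  next
    assume "\<exists>v. lin_map R (free_mod R q) (free_mod R b) v \<and>
      C = B.T #>\<^bsub>B.F\<^esub> theta v \<and> theta (\<lambda>x. e (v x)) \<in> A.T"
    then obtain v where v: "lin_map R (free_mod R q) (free_mod R b) v" "C = B.T #>\<^bsub>B.F\<^esub> theta v"
      "theta (\<lambda>x. e (v x)) \<in> A.T" by blast
    have "A.T #>\<^bsub>A.F\<^esub> theta (\<lambda>x. e (v x)) = A.T #>\<^bsub>A.F\<^esub> 0" unfolding A.coset_eq_iff using v(3) by simp
    then have "tensor_map R (free_mod R a) coker e C = A.T"
      unfolding v(2) E.tensor_map_coset frag_theta A.coset_zero .
    moreover have "C \<in> carrier (tensor R (free_mod R b) coker)"
      unfolding v(2) B.tensor_carrier using theta_closed[OF v(1)] by blast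
    ultimately show "C \<in> carrier ?G" unfolding kernel_def by (simp add: A.tensor_one)
  qed
  have I: "C \<in> ?I \<longleftrightarrow> (\<exists>u. lin_map R (free_mod R q) (free_mod R c) u \<and>
      C = B.T #>\<^bsub>B.F\<^esub> theta (\<lambda>x. e' (u x)))" for C
  proof
    assume "C \<in> ?I"
    then obtain D where D: "D \<in> carrier (tensor R (free_mod R c) coker)"
      "C = tensor_map R (free_mod R b) coker e' D" by blast
    then obtain z where "z \<in> carrier C.F" "D = C.T #>\<^bsub>C.F\<^esub> z" unfolding C.tensor_carrier by blast
    then have z: "z \<in> carrier C.F" "C = B.T #>\<^bsub>B.F\<^esub> frag_map e' z"
      unfolding D(2) using E'.tensor_map_coset by simp_all
    obtain u where u: "lin_map R (free_mod R q) (free_mod R c) u" "z - theta u \<in> C.T"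
      using theta_onto[OF z(1)] by blast
    have "frag_map e' z - frag_map e' (theta u) \<in> B.T" using E'.frag_map_relations[OF u(2)] by simp
    then have "C = B.T #>\<^bsub>B.F\<^esub> theta (\<lambda>x. e' (u x))" unfolding z(2) B.coset_eq_iff frag_theta .
    then show "\<exists>u. lin_map R (free_mod R q) (free_mod R c) u \<and> C = B.T #>\<^bsub>B.F\<^esub> theta (\<lambda>x. e' (u x))"
      using u(1) by blast
  next
    assume "\<exists>u. lin_map R (free_mod R q) (free_mod R c) u \<and> C = B.T #>\<^bsub>B.F\<^esub> theta (\<lambda>x. e' (u x))"
    then obtain u where u: "lin_map R (free_mod R q) (free_mod R c) u"
      "C = B.T #>\<^bsub>B.F\<^esub> theta (\<lambda>x. e' (u x))" by blast
    have "C = tensor_map R (free_mod R b) coker e' (C.T #>\<^bsub>C.F\<^esub> theta u)"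
      unfolding E'.tensor_map_coset frag_theta u(2) ..
    then show "C \<in> ?I" unfolding C.tensor_carrier using theta_closed[OF u(1)] by blast
  qed
  have rel: "B.T #>\<^bsub>B.F\<^esub> theta v = B.T #>\<^bsub>B.F\<^esub> theta (\<lambda>x. e' (u x)) \<longleftrightarrow>
      (\<exists>w. lin_map R (free_mod R p) (free_mod R b) w \<and>
        (\<forall>x\<in>carrier (free_mod R q). v x = w (d x) \<oplus>\<^bsub>free_mod R b\<^esub> e' (u x)))"
    if v: "lin_map R (free_mod R q) (free_mod R b) v" and u: "lin_map R (free_mod R q) (free_mod R c) u" for u v
  proof -
    have eu: "lin_map R (free_mod R q) (free_mod R b) (\<lambda>x. e' (u x))" by (rule lin_map_comp[OF u e'])
    let ?t = "\<lambda>x. v x \<ominus>\<^bsub>free_mod R b\<^esub> e' (u x)"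
    have t: "lin_map R (free_mod R q) (free_mod R b) ?t"
      by (rule lin_map_diff[OF free_mod_module free_mod_module v eu])
    have "B.T #>\<^bsub>B.F\<^esub> theta v = B.T #>\<^bsub>B.F\<^esub> theta (\<lambda>x. e' (u x)) \<longleftrightarrow> theta ?t \<in> B.T"
      unfolding B.coset_eq_iff using B.T_mem_cong[OF theta_diff[OF v eu]] by simp
    also have "\<dots> \<longleftrightarrow> (\<exists>w. lin_map R (free_mod R p) (free_mod R b) w \<and>
        (\<forall>x\<in>carrier (free_mod R q). ?t x = w (d x)))" by (rule theta_relation_iff[OF t])
    also have "\<dots> \<longleftrightarrow> (\<exists>w. lin_map R (free_mod R p) (free_mod R b) w \<and>
        (\<forall>x\<in>carrier (free_mod R q). v x = w (d x) \<oplus>\<^bsub>free_mod R b\<^esub> e' (u x)))"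
    proof (intro ex_cong1 conj_cong refl ball_cong)
      fix w x assume w: "lin_map R (free_mod R p) (free_mod R b) w" and x: "x \<in> carrier (free_mod R q)"
      show "?t x = w (d x) \<longleftrightarrow> v x = w (d x) \<oplus>\<^bsub>free_mod R b\<^esub> e' (u x)"
        using B.M.diff_add_cancel[OF lin_map_closed[OF v x] lin_map_closed[OF eu x]]
          B.M.M.add.r_cancel[of "?t x" "e' (u x)" "w (d x)"]
          lin_map_closed[OF eu x] lin_map_closed[OF t x] lin_map_closed[OF w dc[OF x]] by metis
    qed
    finally show ?thesis .
  qed
  have one: "\<one>\<^bsub>?G\<^esub> = B.T #>\<^bsub>B.F\<^esub> 0"
    unfolding B.coset_zero by (simp add: B.tensor_one del: free_mod_simps)
  show ?thesis
  proof
    assume tr: "trivial_group (?G Mod ?I)"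
    show ?E unfolding tor_exact_def
    proof (intro allI impI)
      fix v w
      assume v: "lin_map R (free_mod R q) (free_mod R b) v" and w: "lin_map R (free_mod R p) (free_mod R a) w"
        and vw: "\<forall>x\<in>carrier (free_mod R q). e (v x) = w (d x)"
      have "theta (\<lambda>x. e (v x)) \<in> A.T"
        unfolding theta_relation_iff[OF lin_map_comp[OF v e]] using w vw by blast
      then have vK: "B.T #>\<^bsub>B.F\<^esub> theta v \<in> carrier ?G" by (intro K[THEN iffD2] exI[of _ v] conjI v refl)
      have "tensor_map R (free_mod R b) coker e' (C.T #>\<^bsub>C.F\<^esub> 0) = B.T #>\<^bsub>B.F\<^esub> 0"
        unfolding E'.tensor_map_coset by simp
      moreover have "C.T #>\<^bsub>C.F\<^esub> 0 \<in> carrier (tensor R (free_mod R c) coker)"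
        unfolding C.tensor_carrier by (rule imageI) simp
      ultimately have "\<one>\<^bsub>?G\<^esub> \<in> ?I" unfolding one by (metis imageI)
      from trivial_quotientD[OF tr this vK monoid.l_one[OF group.is_monoid[OF G] vK]]
      have "B.T #>\<^bsub>B.F\<^esub> theta v \<in> ?I" .
      from I[THEN iffD1, OF this] obtain u where u: "lin_map R (free_mod R q) (free_mod R c) u"
        "B.T #>\<^bsub>B.F\<^esub> theta v = B.T #>\<^bsub>B.F\<^esub> theta (\<lambda>x. e' (u x))" by blast
      show "\<exists>w' u. lin_map R (free_mod R p) (free_mod R b) w' \<and> lin_map R (free_mod R q) (free_mod R c) u \<and>
        (\<forall>x\<in>carrier (free_mod R q). v x = w' (d x) \<oplus>\<^bsub>free_mod R b\<^esub> e' (u x))"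
        using rel[OF v u(1)] u by blast
    qed
  next
    assume ex: ?E
    have "?I = carrier ?G"
    proof (intro subset_antisym subsetI)
      fix C assume "C \<in> ?I"
      from I[THEN iffD1, OF this] obtain u where u: "lin_map R (free_mod R q) (free_mod R c) u"
        "C = B.T #>\<^bsub>B.F\<^esub> theta (\<lambda>x. e' (u x))" by blast
      have eu: "lin_map R (free_mod R q) (free_mod R b) (\<lambda>x. e' (u x))" by (rule lin_map_comp[OF u(1) e'])
      have z: "lin_map R (free_mod R p) (free_mod R a) (\<lambda>_. \<zero>\<^bsub>free_mod R a\<^esub>)"
        by (rule lin_map_zero_map[OF free_mod_module])
      have "theta (\<lambda>x. e (e' (u x))) \<in> A.T"
        unfolding theta_relation_iff[OF lin_map_comp[OF eu e]]
        using z ee[OF lin_map_closed[OF u(1)]] by blast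
      then show "C \<in> carrier ?G"
        by (intro K[THEN iffD2] exI[of _ "\<lambda>x. e' (u x)"] conjI eu u(2))
    next
      fix C assume "C \<in> carrier ?G"
      from K[THEN iffD1, OF this] obtain v where v: "lin_map R (free_mod R q) (free_mod R b) v"
        "C = B.T #>\<^bsub>B.F\<^esub> theta v" "theta (\<lambda>x. e (v x)) \<in> A.T" by blast
      obtain w where w: "lin_map R (free_mod R p) (free_mod R a) w"
        "\<forall>x\<in>carrier (free_mod R q). e (v x) = w (d x)"
        using v(3) unfolding theta_relation_iff[OF lin_map_comp[OF v(1) e]] by blast
      obtain w' u where u: "lin_map R (free_mod R q) (free_mod R c) u"
        and w': "lin_map R (free_mod R p) (free_mod R b) w'"
        "\<forall>x\<in>carrier (free_mod R q). v x = w' (d x) \<oplus>\<^bsub>free_mod R b\<^esub> e' (u x)"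
        using ex[unfolded tor_exact_def, rule_format, OF v(1) w(1)] w(2) by blast
      have "C = B.T #>\<^bsub>B.F\<^esub> theta (\<lambda>x. e' (u x))" unfolding v(2) rel[OF v(1) u] using w' by blast
      then show "C \<in> ?I" by (intro I[THEN iffD2] exI[of _ u] conjI u)
    qed
    then show "trivial_group (?G Mod ?I)" using group.trivial_Mod_carrier[OF G] by simp
  qed
qed

end

section \<open>Free modules over a Noetherian ring with a split socle element\<close>

locale noetherian_split_socle_ring = split_socle_ring + noetherian_ring R

sublocale noetherian_split_socle_ring \<subseteq> noetherian_cring R ..

context noetherian_split_socle_ring
begin

theorem free_if_Tor_rigid_Ext_zero:
  assumes M: "module R M" "fin_gen R M" and N: "module R N" "fin_gen R N"
    and rigid: "Tor_rigid R N" and ext: "trivial_group (Ext R 1 M N)"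
  shows "free_module R M \<or> free_module R N"
proof (rule disjCI)
  assume N_not_free: "\<not> free_module R N"
  define m where "m = res_rank M"
  define g where "g = res_rank N"
  define d where "d = res_map R M"
  define e where "e = res_map R N"
  note d = res_map_lin_map[OF M, folded m_def d_def] and e = res_map_lin_map[OF N, folded g_def e_def]
  note exd = res_map_exact[OF M, folded m_def d_def] and exe = res_map_exact[OF N, folded g_def e_def]
  have dd: "d i (d (Suc i) x) = \<zero>\<^bsub>free_mod R (m i)\<^esub>" if "x \<in> carrier (free_mod R (m (Suc (Suc i))))" for i x
    by (rule exact_atD1[OF exd _ that]) (use lin_map_closed[OF d] in blast)
  have ee: "e i (e (Suc i) x) = \<zero>\<^bsub>free_mod R (g i)\<^esub>" if "x \<in> carrier (free_mod R (g (Suc (Suc i))))" for i x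
    by (rule exact_atD1[OF exe _ that]) (use lin_map_closed[OF e] in blast)
  obtain a where a: "lin_map R (free_mod R (m 0)) M a" "a ` carrier (free_mod R (m 0)) = carrier M"
    "exact_at (free_mod R (m (Suc 0))) (free_mod R (m 0)) M (d 0) a"
    using res_augmentation[OF M, folded m_def d_def] by blast
  obtain b where b: "lin_map R (free_mod R (g 0)) N b" "b ` carrier (free_mod R (g 0)) = carrier N"
    "exact_at (free_mod R (g (Suc 0))) (free_mod R (g 0)) N (e 0) b"
    using res_augmentation[OF N, folded g_def e_def] by blast
  \<comment> \<open>The presentation uses d at index 1, from F_2 to F_1, since a class in Ext^1
    lives on F_1 and is tested against F_2. So X is the transpose of the first syzygy of M.\<close>
  interpret D: dual_cokernel R "m (Suc 0)" "m (Suc (Suc 0))" "d (Suc 0)"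
    by unfold_locales (rule d)
  have tor: "trivial_group (Tor R (Suc i) N D.coker) \<longleftrightarrow>
      tor_exact R (m (Suc 0)) (m (Suc (Suc 0))) (d (Suc 0)) (g i) (g (Suc i)) (g (Suc (Suc i))) (e i) (e (Suc i))" for i
    unfolding Tor.simps res_mod_eq g_def[symmetric] e_def[symmetric]
    by (rule D.tor_trivial_iff[OF e e ee])
  have ext': "\<exists>g. lin_map R (free_mod R (m 0)) N g \<and> (\<forall>x\<in>carrier (free_mod R (m (Suc 0))). f x = g (d 0 x))"
    if "lin_map R (free_mod R (m (Suc 0))) N f"
      "\<And>x. x \<in> carrier (free_mod R (m (Suc (Suc 0)))) \<Longrightarrow> f (d (Suc 0) x) = \<zero>\<^bsub>N\<^esub>" for f
    using ext_one_zeroD[OF M N(1) ext, folded m_def d_def] that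
    by (simp add: numeral_2_eq_2 del: free_mod_simps)
  have tor1: "trivial_group (Tor R (Suc 0) N D.coker)"
    unfolding tor by (rule tor_exact_if_ext_zero[OF d d dd N(1) b(1,2) e e b(3) exe ext'])
  \<comment> \<open>\<open>D.coker\<close> is a quotient of a finite power of the ring, so its type
    is the one fixed in \<open>Tor_rigid\<close> and the definition can be instantiated
    directly.\<close>
  have step: "trivial_group (Tor R (Suc i) N D.coker)"
    if "i \<ge> 1" "trivial_group (Tor R i N D.coker)" for i
    using rigid[unfolded Tor_rigid_def, rule_format, of D.coker i] that D.coker_module D.coker_fin_gen
    by (simp del: Tor.simps)
  from step[OF _ step[OF _ tor1]] have "trivial_group (Tor R (Suc (Suc (Suc 0))) N D.coker)"
    by (simp del: Tor.simps)
  note tor3 = this[unfolded tor]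
  \<comment> \<open>A vector at which the criterion fails for M is exactly the input x of
    \<open>tor_residue_zero\<close>, whose conclusion is the criterion for N. Since N is not free,
    no such vector exists.\<close>
  show "free_module R M"
  proof (rule free_module_criterion[OF M(1) a(1,2) d[of 0]])
    show "a x = \<zero>\<^bsub>M\<^esub> \<longleftrightarrow> x \<in> d 0 ` carrier (free_mod R (m (Suc 0)))" if "x \<in> carrier (free_mod R (m 0))" for x
      using a(3) that unfolding exact_at_def by blast
    fix x assume x: "x \<in> carrier (free_mod R (m (Suc 0)))" "d 0 x \<in> {..<m 0} \<rightarrow>\<^sub>E \<nn>"
    show "\<exists>w\<in>{..<m (Suc 0)} \<rightarrow>\<^sub>E \<nn>. d 0 w = d 0 x"
    proof (rule ccontr)
      assume xn: "\<not> (\<exists>w\<in>{..<m (Suc 0)} \<rightarrow>\<^sub>E \<nn>. d 0 w = d 0 x)"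
      have "free_module R N"
      proof (rule free_module_criterion[OF N(1) b(1,2) e[of 0]])
        show "b x = \<zero>\<^bsub>N\<^esub> \<longleftrightarrow> x \<in> e 0 ` carrier (free_mod R (g (Suc 0)))" if "x \<in> carrier (free_mod R (g 0))" for x
          using b(3) that unfolding exact_at_def by blast
        fix v assume v: "v \<in> carrier (free_mod R (g (Suc 0)))" "e 0 v \<in> {..<g 0} \<rightarrow>\<^sub>E \<nn>"
        show "\<exists>w\<in>{..<g (Suc 0)} \<rightarrow>\<^sub>E \<nn>. e 0 w = e 0 v"
          using xn by (intro tor_residue_zero[OF d d exd e e e e exe exe exe tor3 x _ v]) blast
      qed
      then show False using N_not_free by blast
    qed
  qed
qed

end

section \<open>The idealization of the residue field\<close>

lemma idealization_simps [simp]: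
  "carrier (R \<ltimes> L) = carrier R \<times> carrier L"
  "\<one>\<^bsub>R \<ltimes> L\<^esub> = (\<one>\<^bsub>R\<^esub>, \<zero>\<^bsub>L\<^esub>)"
  "\<zero>\<^bsub>R \<ltimes> L\<^esub> = (\<zero>\<^bsub>R\<^esub>, \<zero>\<^bsub>L\<^esub>)"
  "(r, l) \<otimes>\<^bsub>R \<ltimes> L\<^esub> (r', l') = (r \<otimes>\<^bsub>R\<^esub> r', (r \<odot>\<^bsub>L\<^esub> l') \<oplus>\<^bsub>L\<^esub> (r' \<odot>\<^bsub>L\<^esub> l))"
  "(r, l) \<oplus>\<^bsub>R \<ltimes> L\<^esub> (r', l') = (r \<oplus>\<^bsub>R\<^esub> r', l \<oplus>\<^bsub>L\<^esub> l')"
  by (simp_all add: idealization_def)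

context module
begin

lemma idealization_cring: "cring (R \<ltimes> M)"
proof (rule cringI)
  show "abelian_group (R \<ltimes> M)"
  proof (rule abelian_groupI)
    fix x assume "x \<in> carrier (R \<ltimes> M)"
    then obtain r l where "x = (r, l)" "r \<in> carrier R" "l \<in> carrier M" by auto
    then show "\<exists>y\<in>carrier (R \<ltimes> M). y \<oplus>\<^bsub>R \<ltimes> M\<^esub> x = \<zero>\<^bsub>R \<ltimes> M\<^esub>"
      by (intro bexI[of _ "(\<ominus> r, \<ominus>\<^bsub>M\<^esub> l)"]) (auto simp: R.l_neg M.l_neg)
  qed (auto simp: R.a_ac M.a_ac)
  show "Group.comm_monoid (R \<ltimes> M)"
    by (rule comm_monoidI)
      (auto simp: R.m_ac M.a_ac smult_r_distr smult_assoc1[symmetric])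
qed (auto simp: R.l_distr M.a_ac smult_l_distr smult_r_distr)

text \<open>Closure under negation follows from closure under multiplication, applied to the
  negative of one.\<close>

lemma idealization_idealI:
  assumes "I \<subseteq> carrier R \<times> carrier M" "(\<zero>, \<zero>\<^bsub>M\<^esub>) \<in> I"
    and add: "\<And>r l r' l'. (r, l) \<in> I \<Longrightarrow> (r', l') \<in> I \<Longrightarrow> (r \<oplus> r', l \<oplus>\<^bsub>M\<^esub> l') \<in> I"
    and mult: "\<And>r l r' l'. r \<in> carrier R \<Longrightarrow> l \<in> carrier M \<Longrightarrow> (r', l') \<in> I \<Longrightarrow>
      (r \<otimes> r', (r \<odot>\<^bsub>M\<^esub> l') \<oplus>\<^bsub>M\<^esub> (r' \<odot>\<^bsub>M\<^esub> l)) \<in> I"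
  shows "ideal I (R \<ltimes> M)"
proof -
  interpret A: cring "R \<ltimes> M" by (rule idealization_cring)
  have m: "x \<otimes>\<^bsub>R \<ltimes> M\<^esub> a \<in> I" if "a \<in> I" "x \<in> carrier (R \<ltimes> M)" for a x
    using that mult by (cases a, cases x) auto
  show ?thesis
  proof (rule idealI[OF A.ring_axioms])
    show "subgroup I (add_monoid (R \<ltimes> M))"
    proof (rule A.add.subgroupI)
      show "I \<subseteq> carrier (R \<ltimes> M)" using assms(1) by simp
      show "I \<noteq> {}" using assms(2) by blast
      show "\<ominus>\<^bsub>R \<ltimes> M\<^esub> a \<in> I" if a: "a \<in> I" for a
      proof -
        have ac: "a \<in> carrier (R \<ltimes> M)" using a assms(1) by auto
        have "(\<ominus>\<^bsub>R \<ltimes> M\<^esub> \<one>\<^bsub>R \<ltimes> M\<^esub>) \<otimes>\<^bsub>R \<ltimes> M\<^esub> a = \<ominus>\<^bsub>R \<ltimes> M\<^esub> a"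
          using A.l_minus[OF A.one_closed ac] A.l_one[OF ac] by simp
        then show ?thesis using m[OF a, of "\<ominus>\<^bsub>R \<ltimes> M\<^esub> \<one>\<^bsub>R \<ltimes> M\<^esub>"] A.a_inv_closed[OF A.one_closed] by simp
      qed
      show "a \<oplus>\<^bsub>R \<ltimes> M\<^esub> b \<in> I" if "a \<in> I" "b \<in> I" for a b
        using that add by (cases a, cases b) auto
    qed
    show "x \<otimes>\<^bsub>R \<ltimes> M\<^esub> a \<in> I" if "a \<in> I" "x \<in> carrier (R \<ltimes> M)" for a x by (rule m[OF that])
    show "a \<otimes>\<^bsub>R \<ltimes> M\<^esub> x \<in> I" if "a \<in> I" "x \<in> carrier (R \<ltimes> M)" for a x
      using m[OF that] A.m_comm[OF that(2)] that(1) assms(1) by auto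
  qed
qed

lemma idealization_fst_ideal:
  assumes "ideal I (R \<ltimes> M)"
  shows "ideal (fst ` I) R"
proof -
  interpret I: ideal I "R \<ltimes> M" by fact
  have Ic: "r \<in> carrier R" "l \<in> carrier M" if "(r, l) \<in> I" for r l using I.Icarr[OF that] by auto
  have m: "x \<otimes> a \<in> fst ` I" if a: "a \<in> fst ` I" and x: "x \<in> carrier R" for a x
  proof -
    obtain l where l: "(a, l) \<in> I" using a by auto
    have "(x, \<zero>\<^bsub>M\<^esub>) \<otimes>\<^bsub>R \<ltimes> M\<^esub> (a, l) \<in> I" using x by (intro I.I_l_closed[OF l]) simp
    then show ?thesis by (auto intro: rev_image_eqI)
  qed
  show ?thesis
  proof (rule idealI[OF R.ring_axioms])
    show "subgroup (fst ` I) (add_monoid R)"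
    proof (rule R.add.subgroupI)
      show "fst ` I \<subseteq> carrier R" using Ic by auto
      show "fst ` I \<noteq> {}" using additive_subgroup.zero_closed[OF ideal.axioms(1)[OF assms]] by blast
      show "\<ominus> a \<in> fst ` I" if a: "a \<in> fst ` I" for a
      proof -
        have ac: "a \<in> carrier R" using a Ic by auto
        have "(\<ominus> \<one>) \<otimes> a = \<ominus> a" using R.l_minus[OF R.one_closed ac] ac by simp
        then show ?thesis using m[OF a, of "\<ominus> \<one>"] by simp
      qed
      show "a \<oplus> b \<in> fst ` I" if ab: "a \<in> fst ` I" "b \<in> fst ` I" for a b
      proof -
        obtain l l' where "(a, l) \<in> I" "(b, l') \<in> I" using ab by auto
        from additive_subgroup.a_closed[OF ideal.axioms(1)[OF assms] this] show ?thesis by (auto intro: rev_image_eqI)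
      qed
    qed
    show "x \<otimes> a \<in> fst ` I" if "a \<in> fst ` I" "x \<in> carrier R" for a x by (rule m[OF that])
    show "a \<otimes> x \<in> fst ` I" if a: "a \<in> fst ` I" and x: "x \<in> carrier R" for a x
    proof -
      have "a \<in> carrier R" using a Ic by auto
      then show ?thesis using m[OF a x] R.m_comm[OF x] by simp
    qed
  qed
qed

end

section \<open>Units of a local ring and the residue field as a module\<close>

context noetherian_local_ring
begin

text \<open>A nonunit generates a proper ideal, which lies in a maximal one and hence in \<mm> by
  uniqueness. The chain condition of Zorn's lemma comes from Noetherianity: a nonempty chain of
  ideals contains its union, so properness is inherited.\<close>

lemma Units_if_notin_maximal:
  assumes a: "a \<in> carrier R" "a \<notin> \<mm>"
  shows "a \<in> Units R"
proof (rule ccontr)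
  assume nu: "a \<notin> Units R"
  let ?S = "{I. ideal I R \<and> PIdl a \<subseteq> I \<and> \<one> \<notin> I}"
  have "\<one> \<notin> PIdl a"
  proof
    assume "\<one> \<in> PIdl a"
    then obtain x where "x \<in> carrier R" "\<one> = x \<otimes> a" unfolding cgenideal_def by blast
    then have "a \<in> Units R" using a(1) m_comm unfolding Units_def by auto
    then show False using nu by blast
  qed
  then have "PIdl a \<in> ?S" using cgenideal_ideal[OF a(1)] by blast
  then have "\<exists>J\<in>?S. \<forall>I\<in>?S. J \<subseteq> I \<longrightarrow> I = J"
  proof (intro subset_Zorn_nonempty)
    fix C assume C: "C \<noteq> {}" "subset.chain ?S C"
    then have "subset.chain {I. ideal I R} C" unfolding pred_on.chain_def by blast
    then have "\<Union>C \<in> C" by (rule ideal_chain_is_trivial[OF C(1)])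
    then show "\<Union>C \<in> ?S" using C(2) unfolding pred_on.chain_def by blast
  qed blast
  then obtain J where JS: "J \<in> ?S" and max: "\<forall>I\<in>?S. J \<subseteq> I \<longrightarrow> I = J" by (elim bexE)
  then have J: "ideal J R" "PIdl a \<subseteq> J" "\<one> \<notin> J" by simp_all
  have "maximalideal J R"
  proof (rule maximalidealI[OF J(1)])
    show "carrier R \<noteq> J" using J(3) by auto
    fix I assume I: "ideal I R" "J \<subseteq> I" "I \<subseteq> carrier R"
    show "I = J \<or> I = carrier R"
    proof (cases "\<one> \<in> I")
      case True
      then show ?thesis using ideal.one_imp_carrier[OF I(1)] by simp
    next
      case False
      then have "I \<in> ?S" using I(1,2) J(2) by simp
      then show ?thesis using max I(2) by simp
    qed
  qed
  then have "J = \<mm>" by (rule unique_maximal)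
  then show False using a(2) J(2) cgenideal_self[OF a(1)] by blast
qed

abbreviation K where "K \<equiv> residue_module R \<mm>"

abbreviation Q where "Q \<equiv> R Quot \<mm>"

lemma residue_module_simps:
  "carrier K = carrier Q" "\<zero>\<^bsub>K\<^esub> = \<zero>\<^bsub>Q\<^esub>" "x \<oplus>\<^bsub>K\<^esub> y = x \<oplus>\<^bsub>Q\<^esub> y"
  "r \<odot>\<^bsub>K\<^esub> x = (\<mm> +> r) \<otimes>\<^bsub>Q\<^esub> x"
  by (simp_all add: residue_module_def ring.extend_def module.fields_def)

lemma mm_ideal: "ideal \<mm> R"
  using maximal by (simp add: maximalideal_def)

lemma residue_field: "field Q"
  by (rule maximalideal.quotient_is_field[OF maximal is_cring])

lemma residue_hom: "(+>) \<mm> \<in> ring_hom R Q"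
  by (rule ideal.rcos_ring_hom[OF mm_ideal])

lemma residue_onto: "c \<in> carrier Q \<Longrightarrow> \<exists>r\<in>carrier R. c = \<mm> +> r"
  by (auto simp: FactRing_def A_RCOSETS_def')

lemma residue_zero_iff: "r \<in> carrier R \<Longrightarrow> \<mm> +> r = \<zero>\<^bsub>Q\<^esub> \<longleftrightarrow> r \<in> \<mm>"
  using ideal.rcos_const_imp_mem[OF mm_ideal] abelian_subgroup.a_rcos_const[of \<mm> R r]
    abelian_subgroupI3[OF ideal.axioms(1)[OF mm_ideal] is_abelian_group]
  by (auto simp: FactRing_def)

lemma residue_module_module: "module R K"
proof -
  interpret Q: field Q by (rule residue_field)
  note h = ring_hom_closed[OF residue_hom] ring_hom_mult[OF residue_hom] ring_hom_add[OF residue_hom]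
    ring_hom_one[OF residue_hom]
  show ?thesis
  proof (rule moduleI[OF is_cring])
    show "abelian_group K"
      by (rule abelian_groupI)
        (auto simp: residue_module_simps Q.a_ac intro: Q.l_neg Q.a_inv_closed bexI[of _ "\<ominus>\<^bsub>Q\<^esub> _"])
  qed (auto simp: residue_module_simps h Q.l_distr Q.r_distr Q.m_assoc)
qed

section \<open>The ring structure of R \<ltimes> k\<close>

abbreviation A where "A \<equiv> R \<ltimes> K"

abbreviation max_A where "max_A \<equiv> \<mm> \<times> carrier K"

lemma residue_smult_zero: "r \<in> \<mm> \<Longrightarrow> c \<in> carrier K \<Longrightarrow> r \<odot>\<^bsub>K\<^esub> c = \<zero>\<^bsub>K\<^esub>"
proof -
  interpret Q: field Q by (rule residue_field)
  assume "r \<in> \<mm>" "c \<in> carrier K"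
  moreover from this have "\<mm> +> r = \<zero>\<^bsub>Q\<^esub>" using residue_zero_iff ideal.Icarr[OF mm_ideal] by blast
  ultimately show ?thesis by (simp add: residue_module_simps)
qed

text \<open>The residue field is one-dimensional over itself, so any nonzero element generates it; r
  is a lift of the quotient of c' by c.\<close>

lemma residue_smult_onto:
  assumes "c \<in> carrier K" "c \<noteq> \<zero>\<^bsub>K\<^esub>" "c' \<in> carrier K"
  shows "\<exists>r\<in>carrier R. c' = r \<odot>\<^bsub>K\<^esub> c"
proof -
  interpret Q: field Q by (rule residue_field)
  have u: "c \<in> Units Q" using assms Q.field_Units by (simp add: residue_module_simps)
  have c': "c' \<in> carrier Q" using assms by (simp add: residue_module_simps)
  obtain r where r: "r \<in> carrier R" "c' \<otimes>\<^bsub>Q\<^esub> inv\<^bsub>Q\<^esub> c = \<mm> +> r"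
    using residue_onto[of "c' \<otimes>\<^bsub>Q\<^esub> inv\<^bsub>Q\<^esub> c"] u c' by auto
  have "r \<odot>\<^bsub>K\<^esub> c = c' \<otimes>\<^bsub>Q\<^esub> (inv\<^bsub>Q\<^esub> c \<otimes>\<^bsub>Q\<^esub> c)"
    unfolding residue_module_simps r(2)[symmetric] using u c' by (intro Q.m_assoc) auto
  then have "c' = r \<odot>\<^bsub>K\<^esub> c" using u c' by simp
  then show ?thesis using r(1) by blast
qed

lemma idealization_residue_local: "local_cring A max_A"
proof -
  interpret K: module R K by (rule residue_module_module)
  interpret A: cring A by (rule K.idealization_cring)
  interpret mm: ideal \<mm> R by (rule mm_ideal)
  interpret nn: ideal max_A A
    by (rule K.idealization_idealI) (use mm.Icarr mm.I_l_closed in \<open>auto\<close>)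
  show ?thesis
  proof unfold_locales
    show "\<one>\<^bsub>A\<^esub> \<notin> max_A" using maximalideal.I_notcarr[OF maximal] mm.one_imp_carrier by auto
    fix x assume x: "x \<in> carrier A" "x \<notin> max_A"
    obtain r l where rl: "x = (r, l)" "r \<in> carrier R" "l \<in> carrier K" using x(1) by auto
    have r: "r \<in> Units R" using Units_if_notin_maximal[OF rl(2)] x(2) rl by auto
    have rc: "r \<in> carrier R" "inv r \<in> carrier R" using r by auto
    \<comment> \<open>The second component y solves r y + (1/r) l = 0, the condition for the
      off-diagonal part of the product with (r, l) to vanish.\<close>
    let ?y = "(inv r, \<ominus>\<^bsub>K\<^esub> (inv r \<odot>\<^bsub>K\<^esub> (inv r \<odot>\<^bsub>K\<^esub> l)))"
    have y: "?y \<in> carrier A" using rc rl by simp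
    have "r \<odot>\<^bsub>K\<^esub> (inv r \<odot>\<^bsub>K\<^esub> (inv r \<odot>\<^bsub>K\<^esub> l)) = inv r \<odot>\<^bsub>K\<^esub> l"
      using r rc rl K.smult_assoc1[of r "inv r" "inv r \<odot>\<^bsub>K\<^esub> l"] by simp
    then have xy: "x \<otimes>\<^bsub>A\<^esub> ?y = \<one>\<^bsub>A\<^esub>"
      using r rc rl by (simp add: K.smult_r_minus K.M.l_neg)
    then show "x \<in> Units A" using x(1) y A.m_comm[OF x(1) y] unfolding Units_def by force
  qed
qed

text \<open>An ideal I is controlled by its projection to R, which is finitely generated, and by its
  intersection with 0 \<times> k. As k is a simple module, the latter needs at most one
  generator.\<close>

lemma idealization_residue_noetherian: "noetherian_ring A"
proof -
  interpret K: module R K by (rule residue_module_module)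
  interpret A: cring A by (rule K.idealization_cring)
  show ?thesis
  proof (rule A.noetherian_ringI)
    fix I assume I: "ideal I A"
    interpret I: ideal I A by fact
    obtain T where T: "T \<subseteq> carrier R" "finite T" "fst ` I = Idl T"
      using finetely_gen[OF K.idealization_fst_ideal[OF I]] by blast
    have "T \<subseteq> fst ` I" unfolding T(3) by (rule genideal_self[OF T(1)])
    then have "\<forall>t\<in>T. \<exists>l. (t, l) \<in> I" by force
    then obtain l where l: "\<And>t. t \<in> T \<Longrightarrow> (t, l t) \<in> I" by metis
    \<comment> \<open>\<open>Z\<close> generates the part of I with first component zero: a single
      nonzero element if there is one, and the empty set otherwise.\<close>
    obtain Z where Z: "finite Z" "Z \<subseteq> I"
      and Zgen: "\<And>J c. ideal J A \<Longrightarrow> Z \<subseteq> J \<Longrightarrow> (\<zero>, c) \<in> I \<Longrightarrow> (\<zero>, c) \<in> J"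
    proof (cases "\<exists>c. (\<zero>, c) \<in> I \<and> c \<noteq> \<zero>\<^bsub>K\<^esub>")
      case True
      then obtain c where c: "(\<zero>, c) \<in> I" "c \<noteq> \<zero>\<^bsub>K\<^esub>" by blast
      have cK: "c \<in> carrier K" using I.Icarr[OF c(1)] by simp
      show ?thesis
      proof (rule that[of "{(\<zero>, c)}"])
        fix J c' assume J: "ideal J A" "{(\<zero>, c)} \<subseteq> J" and c': "(\<zero>, c') \<in> I"
        have "c' \<in> carrier K" using I.Icarr[OF c'] by simp
        then obtain r where r: "r \<in> carrier R" "c' = r \<odot>\<^bsub>K\<^esub> c"
          using residue_smult_onto[OF cK c(2)] by blast
        have "(r, \<zero>\<^bsub>K\<^esub>) \<otimes>\<^bsub>A\<^esub> (\<zero>, c) \<in> J" using J r by (intro ideal.I_l_closed[OF J(1)]) auto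
        then show "(\<zero>, c') \<in> J" using r cK by simp
      qed (use c in auto)
    next
      case False
      show ?thesis
      proof (rule that[of "{}"])
        fix J c assume J: "ideal J A" and "(\<zero>, c) \<in> I"
        then have "(\<zero>, c) = \<zero>\<^bsub>A\<^esub>" using False by auto
        then show "(\<zero>, c) \<in> J"
          using additive_subgroup.zero_closed[OF ideal.axioms(1)[OF J]] by simp
      qed auto
    qed
    define S where "S = (\<lambda>t. (t, l t)) ` T \<union> Z"
    have SI: "S \<subseteq> I" unfolding S_def using l Z(2) by auto
    have SA: "S \<subseteq> carrier A" using SI I.a_subset by blast
    interpret J: ideal "Idl\<^bsub>A\<^esub> S" A by (rule A.genideal_ideal[OF SA])
    have SJ: "S \<subseteq> Idl\<^bsub>A\<^esub> S" by (rule A.genideal_self[OF SA])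
    have "I \<subseteq> Idl\<^bsub>A\<^esub> S"
    proof
      fix x assume x: "x \<in> I"
      have "T \<subseteq> fst ` (Idl\<^bsub>A\<^esub> S)" using SJ unfolding S_def by force
      then have "Idl T \<subseteq> fst ` (Idl\<^bsub>A\<^esub> S)"
        by (rule genideal_minimal[OF K.idealization_fst_ideal[OF J.ideal_axioms]])
      moreover have "fst x \<in> Idl T" using x T(3) by blast
      \<comment> \<open>An element of the ideal generated by S with the same first component as x;
        the difference then falls into the part governed by \<open>Z\<close>.\<close>
      ultimately obtain y where y: "y \<in> Idl\<^bsub>A\<^esub> S" "fst y = fst x" by force
      have yI: "y \<in> I" using A.genideal_minimal[OF I SI] y(1) by blast
      have xy: "x \<ominus>\<^bsub>A\<^esub> y \<in> I" unfolding a_minus_def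
        by (rule additive_subgroup.a_closed[OF ideal.axioms(1)[OF I] x
              additive_subgroup.a_inv_closed[OF ideal.axioms(1)[OF I] yI]])
      have xA: "x \<in> carrier A" and yA: "y \<in> carrier A" using I.Icarr x yI by auto
      have add: "(x \<ominus>\<^bsub>A\<^esub> y) \<oplus>\<^bsub>A\<^esub> y = x"
        using xA yA by (simp add: a_minus_def A.a_assoc A.l_neg del: idealization_simps)
      have "fst (x \<ominus>\<^bsub>A\<^esub> y) \<oplus> fst y = fst x"
        using arg_cong[OF add, of fst] by (cases "x \<ominus>\<^bsub>A\<^esub> y", cases y) simp
      moreover have "fst (x \<ominus>\<^bsub>A\<^esub> y) \<in> carrier R" "fst x \<in> carrier R" using I.Icarr[OF xy] xA by auto
      ultimately have "fst (x \<ominus>\<^bsub>A\<^esub> y) = \<zero>" unfolding y(2) by (metis add.l_cancel_one add.m_comm zero_closed)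
      then have eq: "x \<ominus>\<^bsub>A\<^esub> y = (\<zero>, snd (x \<ominus>\<^bsub>A\<^esub> y))" by (metis prod.collapse)
      have "(\<zero>, snd (x \<ominus>\<^bsub>A\<^esub> y)) \<in> Idl\<^bsub>A\<^esub> S"
        by (rule Zgen[OF J.ideal_axioms]) (use SJ S_def eq xy in auto)
      then have "x \<ominus>\<^bsub>A\<^esub> y \<in> Idl\<^bsub>A\<^esub> S" using eq by simp
      from additive_subgroup.a_closed[OF ideal.axioms(1)[OF J.ideal_axioms] this y(1)] show "x \<in> Idl\<^bsub>A\<^esub> S" unfolding add .
    qed
    then have "I = Idl\<^bsub>A\<^esub> S" using A.genideal_minimal[OF I SI] by blast
    moreover have "finite S" unfolding S_def using T(2) Z(1) by simp
    ultimately show "\<exists>S\<subseteq>carrier A. finite S \<and> I = Idl\<^bsub>A\<^esub> S" using SA by blast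
  qed
qed

text \<open>Multiplying (r, c) by s = (0, 1) gives (0, r mod \<mm>). Hence \<mm> \<times> k
  annihilates s, and the multiples of s make up 0 \<times> k, a complement of \<mm> \<times> 0 in
  the maximal ideal. The set \<mm> \<times> 0 is an ideal because \<mm> kills k.\<close>

lemma idealization_residue_split_socle:
  "split_socle_ring A max_A (\<mm> \<times> {\<zero>\<^bsub>K\<^esub>}) (\<zero>, \<one>\<^bsub>Q\<^esub>)"
proof -
  interpret K: module R K by (rule residue_module_module)
  interpret Q: field Q by (rule residue_field)
  interpret mm: ideal \<mm> R by (rule mm_ideal)
  interpret A: local_cring A max_A by (rule idealization_residue_local)
  have one: "\<one>\<^bsub>Q\<^esub> \<in> carrier K" by (simp add: residue_module_simps)
  interpret P: ideal "\<mm> \<times> {\<zero>\<^bsub>K\<^esub>}" A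
    by (rule K.idealization_idealI)
      (use mm.Icarr mm.I_l_closed residue_smult_zero in \<open>auto\<close>)
  have s: "(\<zero>, \<one>\<^bsub>Q\<^esub>) \<otimes>\<^bsub>A\<^esub> (r, c) = (\<zero>, \<mm> +> r)" if "r \<in> carrier R" "c \<in> carrier K" for r c
    using that one ring_hom_closed[OF residue_hom that(1)] K.smult_l_null[OF that(2)]
    by (simp add: residue_module_simps)
  show ?thesis
  proof unfold_locales
    show "(\<zero>, \<one>\<^bsub>Q\<^esub>) \<in> carrier A" using one by simp
    show "(\<zero>, \<one>\<^bsub>Q\<^esub>) \<noteq> \<zero>\<^bsub>A\<^esub>" by (simp add: residue_module_simps)
    fix a
    {
      assume "a \<in> max_A"
      then obtain r c where rc: "a = (r, c)" "r \<in> \<mm>" "c \<in> carrier K" by blast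
      have r: "r \<in> carrier R" using mm.Icarr rc by blast
      show "(\<zero>, \<one>\<^bsub>Q\<^esub>) \<otimes>\<^bsub>A\<^esub> a = \<zero>\<^bsub>A\<^esub>"
        unfolding rc(1) s[OF r rc(3)] using residue_zero_iff[OF r] rc(2) by (simp add: residue_module_simps)
      \<comment> \<open>A lift t of c writes (0, c) as s times (t, 0), which gives the second
        summand of the splitting.\<close>
      obtain t where t: "t \<in> carrier R" "c = \<mm> +> t"
        using residue_onto[of c] rc(3) by (auto simp: residue_module_simps)
      have "a = (r, \<zero>\<^bsub>K\<^esub>) \<oplus>\<^bsub>A\<^esub> (\<zero>, \<one>\<^bsub>Q\<^esub>) \<otimes>\<^bsub>A\<^esub> (t, \<zero>\<^bsub>K\<^esub>)"
        unfolding s[OF t(1) K.M.zero_closed] rc(1) using t rc(3) r by simp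
      moreover have "(r, \<zero>\<^bsub>K\<^esub>) \<in> \<mm> \<times> {\<zero>\<^bsub>K\<^esub>}" "(t, \<zero>\<^bsub>K\<^esub>) \<in> carrier A" using rc(2) t(1) by auto
      ultimately show "\<exists>p\<in>\<mm> \<times> {\<zero>\<^bsub>K\<^esub>}. \<exists>c\<in>carrier A. a = p \<oplus>\<^bsub>A\<^esub> (\<zero>, \<one>\<^bsub>Q\<^esub>) \<otimes>\<^bsub>A\<^esub> c" by blast
    }
    assume "a \<in> carrier A" "(\<zero>, \<one>\<^bsub>Q\<^esub>) \<otimes>\<^bsub>A\<^esub> a \<in> \<mm> \<times> {\<zero>\<^bsub>K\<^esub>}"
    then show "(\<zero>, \<one>\<^bsub>Q\<^esub>) \<otimes>\<^bsub>A\<^esub> a = \<zero>\<^bsub>A\<^esub>" by (cases a) (auto simp: s simp del: idealization_simps(4))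
  qed
qed

lemma idealization_residue_noetherian_split_socle:
  "noetherian_split_socle_ring A max_A (\<mm> \<times> {\<zero>\<^bsub>K\<^esub>}) (\<zero>, \<one>\<^bsub>Q\<^esub>)"
  by (intro noetherian_split_socle_ring.intro idealization_residue_split_socle
      idealization_residue_noetherian)

end

theorem theorem3p4:
  fixes R :: "'r ring" and \<mm> :: "'r set"
    and M :: "('r \<times> 'r set, 'm) module" and N :: "('r \<times> 'r set, 'n) module"
  assumes "noetherian_local_ring R \<mm>"
    and "module (R \<ltimes> residue_module R \<mm>) M"
    and "fin_gen (R \<ltimes> residue_module R \<mm>) M"
    and "carrier M \<noteq> {\<zero>\<^bsub>M\<^esub>}"
    and "module (R \<ltimes> residue_module R \<mm>) N"
    and "fin_gen (R \<ltimes> residue_module R \<mm>) N"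
    and "carrier N \<noteq> {\<zero>\<^bsub>N\<^esub>}"
    and "Tor_rigid (R \<ltimes> residue_module R \<mm>) N"
    and "trivial_group (Ext (R \<ltimes> residue_module R \<mm>) 1 M N)"
  shows "free_module (R \<ltimes> residue_module R \<mm>) M \<or> free_module (R \<ltimes> residue_module R \<mm>) N"
proof -
  interpret L: noetherian_local_ring R \<mm> by fact
  interpret A: noetherian_split_socle_ring "R \<ltimes> residue_module R \<mm>" L.max_A
    "\<mm> \<times> {\<zero>\<^bsub>residue_module R \<mm>\<^esub>}" "(\<zero>\<^bsub>R\<^esub>, \<one>\<^bsub>R Quot \<mm>\<^esub>)"
    by (rule L.idealization_residue_noetherian_split_socle)
  show ?thesis by (rule A.free_if_Tor_rigid_Ext_zero) fact+
qed


end
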